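(* There is no $\delta>0$ such that $\delta\|F\|_{\mathcal{A}_0}\leq\|F\|_{\mathcal{A}_{0,S^1}}$ for all $F\in\mathcal{A}_0(\mathbb{R})$. Equivalently, $$\mathcal{A}_0(\mathbb{R})\subsetneq\mathcal{A}_{0,S^1}(\mathbb{R}).$$
   Context: All Banach spaces are complex. The Fourier transform of $h\in L^1(\mathbb{R})$ is $\widehat{h}(u)=\int_{\mathbb{R}}h(t)e^{-itu}\,dt$, and $H^1(\mathbb{R})=\{h\in L^1(\mathbb{R}):\widehat{h}(u)=0\ \forall u\leq 0\}$. $S^1$ and $S^\infty$ are the Banach spaces of trace class, resp. compact, operators on $\ell^2$, and $tr$ is the trace on $S^1$. $H^1(\mathbb{R};S^1)$ is the closure of $H^1(\mathbb{R})\otimes S^1$ in the Bochner space $L^1(\mathbb{R};S^1)$. $C_0(\mathbb{R};S^\infty)$ is the space of continuous functions $\mathbb{R}\to S^\infty$ vanishing at infinity, with the supremum norm. For $f\in C_0(\mathbb{R};S^\infty)$ and $h\in H^1(\mathbb{R};S^1)$, define $f\ast h\in C_0(\mathbb{R})$ by $(f\ast h)(s)=\int_{\mathbb{R}}tr(f(t)h(s-t))\,dt$. $\mathcal{A}_{0,S^1}(\mathbb{R})$ is the Banach space of all $F\colon\mathbb{R}\to\mathbb{C}$ for which there are sequences $(f_k)_{k\ge1}$ in $C_0(\mathbb{R};S^\infty)$ and $(h_k)_{k\ge1}$ in $H^1(\mathbb{R};S^1)$ with $\sum_k\|f_k\|_\infty\|h_k\|_1<\infty$ and $F(s)=\sum_k(f_k\ast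 h_k)(s)$ for all $s\in\mathbb{R}$; $\|F\|_{\mathcal{A}_{0,S^1}}$ is the infimum of $\sum_k\|f_k\|_\infty\|h_k\|_1$ over all such representations. $\mathcal{A}_0(\mathbb{R})$, with norm $\|\cdot\|_{\mathcal{A}_0}$, is the Banach space defined in the same way, except that the sequences $(f_k)$ and $(h_k)$ are required to lie in the scalar valued spaces $C_0(\mathbb{R})$ and $H^1(\mathbb{R})$, respectively (with ordinary convolution). One has $\mathcal{A}_0(\mathbb{R})\subset\mathcal{A}_{0,S^1}(\mathbb{R})$ with $\|F\|_{\mathcal{A}_{0,S^1}}\leq\|F\|_{\mathcal{A}_0}$ for $F\in\mathcal{A}_0(\mathbb{R})$, and $\mathcal{A}_0(\mathbb{R})$ is dense in $\mathcal{A}_{0,S^1}(\mathbb{R})$. *)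

theory Defs
  imports "HOL-Analysis.Analysis"
begin

section \<open>The complex Hilbert space of square summable sequences\<close>

typedef ell2 = "{x :: nat \<Rightarrow> complex. summable (\<lambda>n. (cmod (x n))\<^sup>2)}"
  morphisms ell2_nth Abs_ell2
  by (rule exI[of _ "\<lambda>_. 0"]) simp

setup_lifting type_definition_ell2

lemma ell2_eqI: "(\<And>n. ell2_nth x n = ell2_nth y n) \<Longrightarrow> x = y"
  by (simp add: ell2_nth_inject[symmetric] fun_eq_iff)

lemma summable_ell2: "summable (\<lambda>n. (cmod (ell2_nth x n))\<^sup>2)"
  using ell2_nth[of x] by simp

lemma square_summable_add:
  fixes x y :: "nat \<Rightarrow> complex"
  assumes "summable (\<lambda>n. (cmod (x n))\<^sup>2)" "summable (\<lambda>n. (cmod (y n))\<^sup>2)"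
  shows "summable (\<lambda>n. (cmod (x n + y n))\<^sup>2)"
proof (rule summable_comparison_test')
  show "summable (\<lambda>n. 2 * (cmod (x n))\<^sup>2 + 2 * (cmod (y n))\<^sup>2)"
    using assms by (intro summable_add summable_mult)
  fix n :: nat
  have "(cmod (x n + y n))\<^sup>2 \<le> (cmod (x n) + cmod (y n))\<^sup>2"
    by (intro power_mono norm_triangle_ineq) simp
  also have "\<dots> \<le> 2 * (cmod (x n))\<^sup>2 + 2 * (cmod (y n))\<^sup>2"
    using zero_le_power2[of "cmod (x n) - cmod (y n)"] by (simp add: power2_eq_square algebra_simps)
  finally show "norm ((cmod (x n + y n))\<^sup>2) \<le> 2 * (cmod (x n))\<^sup>2 + 2 * (cmod (y n))\<^sup>2"
    by simp
qed

lemma square_summable_mult: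
  fixes x :: "nat \<Rightarrow> complex"
  assumes "summable (\<lambda>n. (cmod (x n))\<^sup>2)"
  shows "summable (\<lambda>n. (cmod (c * x n))\<^sup>2)"
  using summable_mult[OF assms, of "(cmod c)\<^sup>2"] by (simp add: norm_mult power_mult_distrib)

instantiation ell2 :: real_vector
begin

lift_definition zero_ell2 :: ell2 is "\<lambda>_. 0" by simp

lift_definition plus_ell2 :: "ell2 \<Rightarrow> ell2 \<Rightarrow> ell2" is "\<lambda>x y n. x n + y n"
  by (rule square_summable_add)

lift_definition uminus_ell2 :: "ell2 \<Rightarrow> ell2" is "\<lambda>x n. - x n" by simp

definition minus_ell2 :: "ell2 \<Rightarrow> ell2 \<Rightarrow> ell2" where "minus_ell2 x y = x + - y"

lift_definition scaleR_ell2 :: "real \<Rightarrow> ell2 \<Rightarrow> ell2" is "\<lambda>r x n. complex_of_real r * x n"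
  by (rule square_summable_mult)

instance
  by standard
    (simp_all add: minus_ell2_def, (transfer, simp add: fun_eq_iff algebra_simps)+)

end

lift_definition scaleC :: "complex \<Rightarrow> ell2 \<Rightarrow> ell2" (infixr \<open>*\<^sub>C\<close> 75) is "\<lambda>c x n. c * x n"
  by (rule square_summable_mult)

lift_definition unit_vec :: "nat \<Rightarrow> ell2" is "\<lambda>k n. if n = k then 1 else 0"
proof -
  fix k :: nat
  show "summable (\<lambda>n. (cmod (if n = k then 1 else 0))\<^sup>2)"
    by (rule summable_finite[of "{k}"]) auto
qed

text \<open>The complex inner product is linear in its first argument.\<close>

definition cinner :: "ell2 \<Rightarrow> ell2 \<Rightarrow> complex"
  where "cinner x y = (\<Sum>n. ell2_nth x n * cnj (ell2_nth y n))"

lemma summable_cinner: "summable (\<lambda>n. ell2_nth x n * cnj (ell2_nth y n))"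
proof (rule summable_comparison_test')
  show "summable (\<lambda>n. (cmod (ell2_nth x n))\<^sup>2 + (cmod (ell2_nth y n))\<^sup>2)"
    by (intro summable_add summable_ell2)
  fix n :: nat
  have "0 \<le> cmod (ell2_nth x n) * cmod (ell2_nth y n)" by simp
  moreover have "2 * (cmod (ell2_nth x n) * cmod (ell2_nth y n))
      \<le> (cmod (ell2_nth x n))\<^sup>2 + (cmod (ell2_nth y n))\<^sup>2"
    using zero_le_power2[of "cmod (ell2_nth x n) - cmod (ell2_nth y n)"]
    by (simp add: power2_eq_square algebra_simps)
  ultimately show "norm (ell2_nth x n * cnj (ell2_nth y n))
      \<le> (cmod (ell2_nth x n))\<^sup>2 + (cmod (ell2_nth y n))\<^sup>2"
    unfolding norm_mult complex_mod_cnj by linarith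
qed

lemma ell2_nth_plus: "ell2_nth (x + y) n = ell2_nth x n + ell2_nth y n"
  by transfer simp

lemma ell2_nth_scaleR: "ell2_nth (r *\<^sub>R x) n = complex_of_real r * ell2_nth x n"
  by transfer simp

lemma ell2_nth_zero: "ell2_nth 0 n = 0"
  by transfer simp

lemma Re_cinner_sums:
  "(\<lambda>n. Re (ell2_nth x n * cnj (ell2_nth y n))) sums Re (cinner x y)"
  unfolding cinner_def by (intro sums_Re summable_sums summable_cinner)

lemma Re_cinner_self: "Re (cinner x x) = (\<Sum>n. (cmod (ell2_nth x n))\<^sup>2)"
proof -
  have "Re (ell2_nth x n * cnj (ell2_nth x n)) = (cmod (ell2_nth x n))\<^sup>2" for n
    unfolding cmod_power2 by (simp add: power2_eq_square)
  then show ?thesis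
    using Re_cinner_sums[of x x] by (simp only: sums_iff)
qed

instantiation ell2 :: real_inner
begin

definition inner_ell2 :: "ell2 \<Rightarrow> ell2 \<Rightarrow> real" where "inner_ell2 x y = Re (cinner x y)"

definition norm_ell2 :: "ell2 \<Rightarrow> real"
  where "norm_ell2 x = sqrt (\<Sum>n. (cmod (ell2_nth x n))\<^sup>2)"

definition dist_ell2 :: "ell2 \<Rightarrow> ell2 \<Rightarrow> real" where "dist_ell2 x y = norm (x - y)"

definition sgn_ell2 :: "ell2 \<Rightarrow> ell2" where "sgn_ell2 x = x /\<^sub>R norm x"

definition uniformity_ell2 :: "(ell2 \<times> ell2) filter"
  where "uniformity_ell2 = (INF e\<in>{0<..}. principal {(x, y). dist x y < e})"

definition open_ell2 :: "ell2 set \<Rightarrow> bool"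
  where "open_ell2 U \<longleftrightarrow> (\<forall>x\<in>U. \<forall>\<^sub>F (x', y) in uniformity. x' = x \<longrightarrow> y \<in> U)"

instance
proof
  fix x y z :: ell2 and r :: real
  show "inner x y = inner y x"
    using Re_cinner_sums[of x y] Re_cinner_sums[of y x]
    by (simp add: inner_ell2_def sums_iff mult.commute)
  show "inner (x + y) z = inner x z + inner y z"
    using sums_add[OF Re_cinner_sums[of x z] Re_cinner_sums[of y z]] Re_cinner_sums[of "x + y" z]
    unfolding inner_ell2_def ell2_nth_plus
    by (simp add: distrib_right add_ac sums_iff algebra_simps)
  show "inner (r *\<^sub>R x) y = r * inner x y"
    using sums_mult[OF Re_cinner_sums[of x y], of r] Re_cinner_sums[of "r *\<^sub>R x" y]
    unfolding inner_ell2_def ell2_nth_scaleR by (simp add: sums_iff algebra_simps)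
  show "0 \<le> inner x x"
    unfolding inner_ell2_def Re_cinner_self by (intro suminf_nonneg summable_ell2) simp
  show "inner x x = 0 \<longleftrightarrow> x = 0"
    unfolding inner_ell2_def Re_cinner_self
    by (subst suminf_eq_zero_iff[OF summable_ell2]) (auto intro!: ell2_eqI simp: ell2_nth_zero)
  show "norm x = sqrt (inner x x)"
    by (simp add: norm_ell2_def inner_ell2_def Re_cinner_self)
qed (simp_all add: dist_ell2_def sgn_ell2_def uniformity_ell2_def open_ell2_def)

end


section \<open>Compact and trace class operators\<close>

type_synonym ell2_op = "ell2 \<Rightarrow>\<^sub>L ell2"

text \<open>The elements of \<open>ell2_op\<close> are the bounded real-linear maps.\<close>

definition complex_linear :: "ell2_op \<Rightarrow> bool"
  where "complex_linear T \<longleftrightarrow> (\<forall>c x. T (c *\<^sub>C x) = c *\<^sub>C T x)"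

definition compact_ops :: "ell2_op set"
  where "compact_ops = {T. complex_linear T \<and> compact (closure (T ` cball 0 1))}"

definition positive_op :: "ell2_op \<Rightarrow> bool"
  where "positive_op P \<longleftrightarrow> complex_linear P \<and> (\<forall>x. cinner (P x) x \<in> \<real> \<and> 0 \<le> Re (cinner (P x) x))"

text \<open>\<open>|T|\<close> is the positive operator with square \<open>T* T\<close>; this
  identity is tested against all pairs of vectors.\<close>

definition abs_op :: "ell2_op \<Rightarrow> ell2_op"
  where "abs_op T = (THE P. positive_op P \<and> (\<forall>x y. cinner (P (P x)) y = cinner (T x) (T y)))"

definition trace_op :: "ell2_op \<Rightarrow> complex"
  where "trace_op T = (\<Sum>n. cinner (T (unit_vec n)) (unit_vec n))"

definition trace_class :: "ell2_op set"
  where "trace_class =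
    {T. complex_linear T \<and> summable (\<lambda>n. cinner (abs_op T (unit_vec n)) (unit_vec n))}"

definition trace_norm :: "ell2_op \<Rightarrow> real"
  where "trace_norm T = Re (trace_op (abs_op T))"


section \<open>Function spaces on the real line\<close>

definition C0 :: "(real \<Rightarrow>\<^sub>C complex) set"
  where "C0 = {f. (apply_bcontfun f \<longlongrightarrow> 0) at_infinity}"

definition C0_compact :: "(real \<Rightarrow>\<^sub>C ell2_op) set"
  where "C0_compact = {f. (\<forall>t. apply_bcontfun f t \<in> compact_ops) \<and> (apply_bcontfun f \<longlongrightarrow> 0) at_infinity}"

text \<open>Integrable functions are represented by Borel measurable functions and are not
  identified when they agree almost everywhere.\<close>

definition fourier :: "(real \<Rightarrow> complex) \<Rightarrow> real \<Rightarrow> complex"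
  where "fourier h u = (LINT t|lborel. h t * exp (- \<i> * of_real t * of_real u))"

definition H1 :: "(real \<Rightarrow> complex) set"
  where "H1 = {h. integrable lborel h \<and> (\<forall>u\<le>0. fourier h u = 0)}"

definition L1_norm :: "(real \<Rightarrow> complex) \<Rightarrow> real"
  where "L1_norm h = (LINT t|lborel. norm (h t))"

text \<open>Bochner space of functions with values in the trace class: strong measurability is
  with respect to the trace norm, so the library's \<open>integrable\<close> on \<open>ell2_op\<close>, which carries the
  operator norm, does not apply.\<close>

definition strongly_measurable_trace :: "(real \<Rightarrow> ell2_op) \<Rightarrow> bool"
  where "strongly_measurable_trace h \<longleftrightarrow>
    (\<exists>s. (\<forall>n. simple_function lborel (s n) \<and> range (s n) \<subseteq> trace_class) \<and>
      (\<forall>t. (\<lambda>n. trace_norm (s n t - h t)) \<longlonglongrightarrow> 0))"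

definition L1_trace :: "(real \<Rightarrow> ell2_op) set"
  where "L1_trace = {h. range h \<subseteq> trace_class \<and> strongly_measurable_trace h \<and>
    integrable lborel (\<lambda>t. trace_norm (h t))}"

definition L1_trace_norm :: "(real \<Rightarrow> ell2_op) \<Rightarrow> real"
  where "L1_trace_norm h = (LINT t|lborel. trace_norm (h t))"

definition H1_tensor_trace :: "(real \<Rightarrow> ell2_op) set"
  where "H1_tensor_trace = {g. \<exists>(N::nat) a T. (\<forall>i<N. a i \<in> H1 \<and> T i \<in> trace_class) \<and>
    (\<forall>t x. blinfun_apply (g t) x = (\<Sum>i<N. a i t *\<^sub>C blinfun_apply (T i) x))}"

definition H1_trace :: "(real \<Rightarrow> ell2_op) set"
  where "H1_trace = {h \<in> L1_trace. \<forall>\<epsilon>>0. \<exists>g\<in>H1_tensor_trace. L1_trace_norm (\<lambda>t. h t - g t) < \<epsilon>}"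


section \<open>The two function algebras\<close>

definition conv :: "(real \<Rightarrow>\<^sub>C complex) \<Rightarrow> (real \<Rightarrow> complex) \<Rightarrow> real \<Rightarrow> complex"
  where "conv f h s = (LINT t|lborel. f t * h (s - t))"

definition conv_trace :: "(real \<Rightarrow>\<^sub>C ell2_op) \<Rightarrow> (real \<Rightarrow> ell2_op) \<Rightarrow> real \<Rightarrow> complex"
  where "conv_trace f h s = (LINT t|lborel. trace_op (f t o\<^sub>L h (s - t)))"

definition A0_costs :: "(real \<Rightarrow> complex) \<Rightarrow> real set"
  where "A0_costs F = {\<Sum>k. norm (f k) * L1_norm (h k) | f h.
    (\<forall>k::nat. f k \<in> C0 \<and> h k \<in> H1) \<and> summable (\<lambda>k. norm (f k) * L1_norm (h k)) \<and>
    (\<forall>s. (\<lambda>k. conv (f k) (h k) s) sums F s)}"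

definition A0_trace_costs :: "(real \<Rightarrow> complex) \<Rightarrow> real set"
  where "A0_trace_costs F = {\<Sum>k. norm (f k) * L1_trace_norm (h k) | f h.
    (\<forall>k::nat. f k \<in> C0_compact \<and> h k \<in> H1_trace) \<and>
    summable (\<lambda>k. norm (f k) * L1_trace_norm (h k)) \<and>
    (\<forall>s. (\<lambda>k. conv_trace (f k) (h k) s) sums F s)}"

definition A0 :: "(real \<Rightarrow> complex) set"
  where "A0 = {F. A0_costs F \<noteq> {}}"

definition A0_norm :: "(real \<Rightarrow> complex) \<Rightarrow> real"
  where "A0_norm F = Inf (A0_costs F)"

definition A0_trace :: "(real \<Rightarrow> complex) set"
  where "A0_trace = {F. A0_trace_costs F \<noteq> {}}"

definition A0_trace_norm :: "(real \<Rightarrow> complex) \<Rightarrow> real"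
  where "A0_trace_norm F = Inf (A0_trace_costs F)"

end

theory Submission
  imports Defs "HOL-Probability.Sinc_Integral"
begin

text \<open>
  Testing \<open>h\<close> in \<open>H\<^sup>1\<close> against Riesz products on the frequencies \<open>lam n\<close> produces an analytic
  martingale with increments \<open>z n * \<phi> n\<close>, where \<open>\<phi> n\<close> depends on \<open>z m\<close> for \<open>m < n\<close> only.
  Since \<open>8 |x| - sqrt (|x|\<^sup>2 + |y|\<^sup>2)\<close> increases in mean along such increments, discarding the odd
  ones is bounded on \<open>L\<^sup>1\<close>. A second Riesz product turns this transform into a convolution operator,
  bounded on the scalar \<open>H\<^sup>1\<close> uniformly in the number of frequencies, whose symbol at
  \<open>lam A + lam B\<close> (\<open>B < A\<close>) is \<open>1/16\<close> for even \<open>A\<close> and \<open>0\<close> for odd \<open>A\<close>. Such operators are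
  functionals on the scalar algebra. With row frequencies \<open>lam (2 * j)\<close> and column frequencies
  \<open>lam (2 * i + 1)\<close> the symbol is a triangular truncation, which is not a bounded Schur multiplier:
  pairing Hilbert's matrix (bounded) with a rank one matrix (trace norm one) gives functions of
  bounded trace class cost on which the functionals grow like a harmonic sum. A gliding hump then
  yields an element of the larger algebra outside the smaller one.
\<close>

section \<open>The sequence space\<close>

text \<open>In the estimate, analyticity acts at one place. Expanding one factor of a Riesz product
  gives a term at \<open>+ lam n\<close> with coefficient \<open>z n\<close> and one at
  \<open>- lam n\<close> with \<open>cnj (z n)\<close>; against \<open>h\<close> in
  \<open>H1\<close> the latter vanishes, its spectrum being negative. The increment is then complex
  linear in \<open>z n\<close>, and for such increments the modulus grows enough in mean for an L1
  bound, which fails for transforms of general martingales. The transform still depends on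
  \<open>z\<close>, so it is no convolution: the second product carries the conjugate signs, and
  composing the two leaves the squared coefficients, 1/4 times 1/4. Uniformity in the number of
  frequencies comes from positivity of the Riesz products, whose total mass is constant. Hilbert's
  matrix is bounded by cancellation between entries of opposite sign, and truncation destroys it.
  The gliding hump needs two separate bounds: each functional is bounded on all test functions at
  once by a constant of its own, and each test function is bounded under all functionals at once by
  its scalar norm.\<close>

lemma ell2_nth_minus: "ell2_nth (x - y) n = ell2_nth x n - ell2_nth y n"
  unfolding minus_ell2_def ell2_nth_plus by transfer simp

lemma ell2_nth_uminus: "ell2_nth (- x) n = - ell2_nth x n"
  by transfer simp

lemma ell2_nth_scaleC: "ell2_nth (c *\<^sub>C x) n = c * ell2_nth x n"
  by transfer simp

lemma ell2_nth_unit_vec: "ell2_nth (unit_vec k) n = (if n = k then 1 else 0)"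
  by transfer simp

lemma ell2_nth_sum: "ell2_nth (\<Sum>i\<in>A. f i) n = (\<Sum>i\<in>A. ell2_nth (f i) n)"
  by (induction A rule: infinite_finite_induct) (simp_all add: ell2_nth_zero ell2_nth_plus)

lemmas ell2_nth_simps = ell2_nth_plus ell2_nth_minus ell2_nth_uminus ell2_nth_scaleR
  ell2_nth_scaleC ell2_nth_zero ell2_nth_unit_vec ell2_nth_sum

lemma scaleC_add_right: "c *\<^sub>C (x + y) = c *\<^sub>C x + c *\<^sub>C y"
  by (rule ell2_eqI) (simp add: ell2_nth_simps algebra_simps)

lemma scaleC_minus_right: "c *\<^sub>C (x - y) = c *\<^sub>C x - c *\<^sub>C y"
  by (rule ell2_eqI) (simp add: ell2_nth_simps algebra_simps)

lemma scaleC_scaleR: "c *\<^sub>C (r *\<^sub>R x) = r *\<^sub>R (c *\<^sub>C x)"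
  by (rule ell2_eqI) (simp add: ell2_nth_simps algebra_simps)

lemma scaleC_scaleC: "c *\<^sub>C (d *\<^sub>C x) = (c * d) *\<^sub>C x"
  by (rule ell2_eqI) (simp add: ell2_nth_simps algebra_simps)

lemma scaleC_add_left: "(c + d) *\<^sub>C x = c *\<^sub>C x + d *\<^sub>C x"
  by (rule ell2_eqI) (simp add: ell2_nth_simps algebra_simps)

lemma scaleC_of_real: "of_real r *\<^sub>C x = r *\<^sub>R x"
  by (rule ell2_eqI) (simp add: ell2_nth_simps)

lemma ell2_nth_fin_sum: "ell2_nth (\<Sum>a<N. f a *\<^sub>C unit_vec a) k = (if k < N then f k else 0)"
  by (simp add: ell2_nth_simps if_distrib[of "\<lambda>c. _ * c"] cong: if_cong)

section \<open>The complex inner product\<close>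

lemma cinner_sums: "(\<lambda>n. ell2_nth x n * cnj (ell2_nth y n)) sums cinner x y"
  unfolding cinner_def by (rule summable_sums[OF summable_cinner])

lemma cinner_eqI: "(\<lambda>n. ell2_nth x n * cnj (ell2_nth y n)) sums c \<Longrightarrow> cinner x y = c"
  using cinner_sums sums_unique2 by blast

lemma cinner_add_left: "cinner (x + y) z = cinner x z + cinner y z"
  by (rule cinner_eqI, rule sums_cong[THEN iffD1, OF _ sums_add[OF cinner_sums cinner_sums]])
    (simp add: ell2_nth_simps algebra_simps)

lemma cinner_scaleC_left: "cinner (c *\<^sub>C x) y = c * cinner x y"
  by (rule cinner_eqI, rule sums_cong[THEN iffD1, OF _ sums_mult[OF cinner_sums]])
    (simp add: ell2_nth_simps algebra_simps)

lemma cinner_commute: "cinner y x = cnj (cinner x y)"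
  by (rule cinner_eqI, rule sums_cong[THEN iffD1, OF _ sums_cnj[THEN iffD2, OF cinner_sums]])
    (simp add: algebra_simps)

lemma cinner_add_right: "cinner x (y + z) = cinner x y + cinner x z"
  by (simp add: cinner_commute[of x] cinner_add_left)

lemma cinner_scaleC_right: "cinner x (c *\<^sub>C y) = cnj c * cinner x y"
  by (simp add: cinner_commute[of x] cinner_scaleC_left)

lemma cinner_scaleR_left: "cinner (r *\<^sub>R x) y = of_real r * cinner x y"
  unfolding scaleC_of_real[symmetric] cinner_scaleC_left ..

lemma cinner_minus_left: "cinner (x - y) z = cinner x z - cinner y z"
  using cinner_add_left[of x "- y" z] cinner_scaleR_left[of "-1" y z] by simp

lemma cinner_minus_right: "cinner x (y - z) = cinner x y - cinner x z"
  by (simp add: cinner_commute[of x] cinner_minus_left)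

lemma cinner_zero [simp]: "cinner 0 x = 0" "cinner x 0 = 0"
  using cinner_minus_left[of x x x] cinner_minus_right[of x x x]
  by (metis cinner_minus_left cinner_minus_right diff_self)+

lemma cinner_sum_left: "cinner (\<Sum>i\<in>A. f i) y = (\<Sum>i\<in>A. cinner (f i) y)"
  by (induction A rule: infinite_finite_induct) (simp_all add: cinner_add_left)

lemma cinner_sum_right: "cinner y (\<Sum>i\<in>A. f i) = (\<Sum>i\<in>A. cinner y (f i))"
  by (induction A rule: infinite_finite_induct) (simp_all add: cinner_add_right)

lemma cinner_unit_vec: "cinner x (unit_vec n) = ell2_nth x n"
proof (rule cinner_eqI)
  have "(\<lambda>m. if m = n then ell2_nth x m else 0) sums ell2_nth x n"
    by (rule sums_single)
  then show "(\<lambda>m. ell2_nth x m * cnj (ell2_nth (unit_vec n) m)) sums ell2_nth x n"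
    by (rule sums_cong[THEN iffD1, rotated]) (simp add: ell2_nth_simps)
qed

lemma cinner_eq_inner: "cinner x y = Complex (inner x y) (inner x (\<i> *\<^sub>C y))"
  by (simp add: inner_ell2_def cinner_scaleC_right complex_eq_iff)

lemma cinner_self: "cinner x x = of_real ((norm x)\<^sup>2)"
proof -
  have "Im (cinner x x) = 0"
    using cinner_commute[of x x] by (metis complex_cnj_cancel_iff complex_cnj_complex_of_real Im_complex_of_real
        cnj.sel(2) equation_minus_iff add.inverse_inverse neg_equal_zero)
  then show ?thesis
    by (simp add: complex_eq_iff power2_norm_eq_inner inner_ell2_def)
qed

lemma norm_scaleC [simp]: "norm (c *\<^sub>C x) = cmod c * norm x"
proof -
  have "complex_of_real ((norm (c *\<^sub>C x))\<^sup>2) = of_real ((cmod c * norm x)\<^sup>2)"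
    unfolding cinner_self[symmetric] cinner_scaleC_left cinner_scaleC_right
    unfolding cinner_self by (simp add: power_mult_distrib complex_norm_square[symmetric] mult_ac )
  then show ?thesis
    by (simp only: of_real_eq_iff) (simp add: power2_eq_iff_nonneg)
qed

lemma norm_unit_vec [simp]: "norm (unit_vec n) = 1"
  using cinner_self[of "unit_vec n"] unfolding cinner_unit_vec ell2_nth_unit_vec
  by (simp add: norm_eq_1 power2_norm_eq_inner of_real_eq_1_iff[symmetric] del: of_real_power)

lemma cmod_cinner_le: "cmod (cinner x y) \<le> norm x * norm y"
proof (cases "cinner x y = 0")
  case False
  \<comment> \<open>This phase makes the inner product real and nonnegative, where it agrees with
    \<open>inner\<close>, so the real Cauchy-Schwarz inequality applies.\<close>
  define c where "c = cnj (sgn (cinner x y))"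
  have c: "cmod c = 1" using False by (simp add: c_def norm_sgn)
  have "cinner (c *\<^sub>C x) y = of_real (cmod (cinner x y))"
    unfolding cinner_scaleC_left c_def sgn_eq
    by (simp add: complex_norm_square[symmetric] divide_simps mult.commute) 
       (metis complex_norm_square mult.commute power2_eq_square of_real_mult of_real_power)
  then have "cmod (cinner x y) = inner (c *\<^sub>C x) y"
    by (simp add: inner_ell2_def)
  also have "\<dots> \<le> norm (c *\<^sub>C x) * norm y" by (rule norm_cauchy_schwarz)
  finally show ?thesis using c by simp
qed simp

lemma cmod_ell2_nth_le: "cmod (ell2_nth x n) \<le> norm x"
  using cmod_cinner_le[of x "unit_vec n"] by (simp add: cinner_unit_vec)

lemma ell2_sum_le_norm: "finite A \<Longrightarrow> (\<Sum>n\<in>A. (cmod (ell2_nth x n))\<^sup>2) \<le> (norm x)\<^sup>2"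
proof -
  assume "finite A"
  then have "(\<Sum>n\<in>A. (cmod (ell2_nth x n))\<^sup>2) \<le> (\<Sum>n. (cmod (ell2_nth x n))\<^sup>2)"
    by (intro sum_le_suminf summable_ell2) auto
  also have "\<dots> = (norm x)\<^sup>2"
    unfolding norm_ell2_def by (simp add: suminf_nonneg summable_ell2)
  finally show ?thesis .
qed

lemma ell2_norm_leI:
  assumes "\<And>M. (\<Sum>n<M. (cmod (ell2_nth x n))\<^sup>2) \<le> r\<^sup>2" "0 \<le> r"
  shows "norm x \<le> r"
proof -
  have "(\<Sum>n. (cmod (ell2_nth x n))\<^sup>2) \<le> r\<^sup>2"
    using assms by (intro suminf_le_const summable_ell2) auto
  then show ?thesis
    unfolding norm_ell2_def using assms(2) by (intro real_le_lsqrt suminf_nonneg summable_ell2) auto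
qed

text \<open>Completeness of the vectors carries over to the bounded operators, where the iteration
  for the square root needs a limit.\<close>

instance ell2 :: complete_space
proof
  fix X :: "nat \<Rightarrow> ell2" assume X: "Cauchy X"
  have "Cauchy (\<lambda>k. ell2_nth (X k) n)" for n
  proof (rule CauchyI)
    fix e :: real assume "0 < e"
    then obtain K where "\<forall>m\<ge>K. \<forall>k\<ge>K. norm (X m - X k) < e" using CauchyD[OF X] by blast
    moreover have "cmod (ell2_nth (X m) n - ell2_nth (X k) n) \<le> norm (X m - X k)" for m k
      using cmod_ell2_nth_le[of "X m - X k" n] by (simp add: ell2_nth_simps)
    ultimately show "\<exists>M. \<forall>m\<ge>M. \<forall>k\<ge>M. cmod (ell2_nth (X m) n - ell2_nth (X k) n) < e"
      by (meson order_le_less_trans)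
  qed
  then obtain l where l: "\<And>n. (\<lambda>k. ell2_nth (X k) n) \<longlonglongrightarrow> l n"
    unfolding Cauchy_convergent_iff convergent_def by metis
  \<comment> \<open>Only finitely many coordinates are compared, so the limit can be taken
    coordinatewise. The bound is independent of \<open>M\<close> and yields both square summability
    of \<open>l\<close> and convergence in norm.\<close>
  have tail: "(\<Sum>n<M. (cmod (ell2_nth (X m) n - l n))\<^sup>2) \<le> e\<^sup>2"
    if K: "\<forall>m\<ge>K. \<forall>k\<ge>K. norm (X m - X k) < e" and "m \<ge> K" for e :: real and K m M
  proof (rule LIMSEQ_le_const2)
    show "(\<lambda>k. \<Sum>n<M. (cmod (ell2_nth (X m) n - ell2_nth (X k) n))\<^sup>2)
        \<longlonglongrightarrow> (\<Sum>n<M. (cmod (ell2_nth (X m) n - l n))\<^sup>2)"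
      by (intro tendsto_intros l)
    have "(\<Sum>n<M. (cmod (ell2_nth (X m) n - ell2_nth (X k) n))\<^sup>2) \<le> e\<^sup>2" if "k \<ge> K" for k
    proof -
      have "(\<Sum>n<M. (cmod (ell2_nth (X m) n - ell2_nth (X k) n))\<^sup>2) \<le> (norm (X m - X k))\<^sup>2"
        using ell2_sum_le_norm[of "{..<M}" "X m - X k"] by (simp add: ell2_nth_simps)
      also have "\<dots> \<le> e\<^sup>2"
        using K \<open>m \<ge> K\<close> that by (intro power_mono) (auto intro: less_imp_le)
      finally show ?thesis .
    qed
    then show "\<exists>N. \<forall>k\<ge>N. (\<Sum>n<M. (cmod (ell2_nth (X m) n - ell2_nth (X k) n))\<^sup>2) \<le> e\<^sup>2" by blast
  qed
  have l_summable: "summable (\<lambda>n. (cmod (l n))\<^sup>2)"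
  proof -
    obtain K where K: "\<forall>m\<ge>K. \<forall>k\<ge>K. norm (X m - X k) < 1" using CauchyD[OF X, of 1] by auto
    have "summable (\<lambda>n. (cmod (ell2_nth (X K) n - l n))\<^sup>2)"
      by (rule summableI_nonneg_bounded[of _ "1\<^sup>2"]) (use tail[OF K order_refl] in auto)
    then have "summable (\<lambda>n. (cmod (-1 * (ell2_nth (X K) n - l n) + ell2_nth (X K) n))\<^sup>2)"
      by (intro square_summable_add square_summable_mult summable_ell2)
    then show ?thesis by simp
  qed
  define L where "L = Abs_ell2 l"
  have L: "ell2_nth L n = l n" for n
    unfolding L_def by (subst Abs_ell2_inverse) (use l_summable in auto)
  have "X \<longlonglongrightarrow> L"
  proof (rule LIMSEQ_I)
    fix e :: real assume e: "0 < e"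
    then obtain K where K: "\<forall>m\<ge>K. \<forall>k\<ge>K. norm (X m - X k) < e / 2" using CauchyD[OF X, of "e/2"] by auto
    have "norm (X m - L) \<le> e / 2" if "m \<ge> K" for m
      using tail[OF K that] e by (intro ell2_norm_leI) (auto simp: ell2_nth_simps L)
    then show "\<exists>K. \<forall>m\<ge>K. norm (X m - L) < e"
      using e by (intro exI[of _ K]) (force intro: le_less_trans)
  qed
  then show "convergent X" by (auto simp: convergent_def)
qed

instance ell2 :: banach ..

lemma ell2_expansion: "(\<lambda>n. ell2_nth x n *\<^sub>C unit_vec n) sums x"
  unfolding sums_def
proof (rule LIMSEQ_I)
  fix e :: real assume e: "0 < e"
  have nrm: "(norm ((\<Sum>n<M. ell2_nth x n *\<^sub>C unit_vec n) - x))\<^sup>2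
      = (\<Sum>k. (cmod (ell2_nth x (k + M)))\<^sup>2)" for M
  proof -
    have "(norm ((\<Sum>n<M. ell2_nth x n *\<^sub>C unit_vec n) - x))\<^sup>2
        = (\<Sum>k. (cmod (ell2_nth ((\<Sum>n<M. ell2_nth x n *\<^sub>C unit_vec n) - x) k))\<^sup>2)"
      unfolding norm_ell2_def by (simp add: suminf_nonneg summable_ell2)
    also have "\<dots> = (\<Sum>k. (cmod (ell2_nth ((\<Sum>n<M. ell2_nth x n *\<^sub>C unit_vec n) - x) (k + M)))\<^sup>2)
        + (\<Sum>k<M. (cmod (ell2_nth ((\<Sum>n<M. ell2_nth x n *\<^sub>C unit_vec n) - x) k))\<^sup>2)"
      by (rule suminf_split_initial_segment[OF summable_ell2])
    finally show ?thesis unfolding ell2_nth_minus ell2_nth_fin_sum by simp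
  qed
  obtain N where N: "\<And>n. n \<ge> N \<Longrightarrow> norm (\<Sum>k. (cmod (ell2_nth x (k + n)))\<^sup>2) < e\<^sup>2"
    using suminf_exist_split[OF _ summable_ell2[of x], of "e\<^sup>2"] e by auto
  have "norm ((\<Sum>n<M. ell2_nth x n *\<^sub>C unit_vec n) - x) < e" if "M \<ge> N" for M
    using N[OF that] e unfolding nrm[symmetric] by (simp add: power2_less_imp_less)
  then show "\<exists>N. \<forall>M\<ge>N. norm ((\<Sum>n<M. ell2_nth x n *\<^sub>C unit_vec n) - x) < e" by blast
qed

lemma tendsto_cinner_right: "(f \<longlongrightarrow> y) F \<Longrightarrow> ((\<lambda>i. cinner x (f i)) \<longlongrightarrow> cinner x y) F"
proof -
  assume f: "(f \<longlongrightarrow> y) F"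
  have "((\<lambda>i. \<i> *\<^sub>C f i) \<longlongrightarrow> \<i> *\<^sub>C y) F"
  proof (rule Lim_null[THEN iffD2], rule Lim_null_comparison)
    show "((\<lambda>i. norm (f i - y)) \<longlongrightarrow> 0) F"
      using f by (metis Lim_null tendsto_norm_zero)
    show "\<forall>\<^sub>F i in F. norm (\<i> *\<^sub>C f i - \<i> *\<^sub>C y) \<le> norm (f i - y)"
      unfolding scaleC_minus_right[symmetric] by simp
  qed
  then show ?thesis
    unfolding cinner_eq_inner by (intro tendsto_Complex tendsto_inner tendsto_const f)
qed

lemma complex_linearD: "complex_linear T \<Longrightarrow> T (c *\<^sub>C x) = c *\<^sub>C T x"
  by (simp add: complex_linear_def)

lemma cinner_right_ext: "(\<And>z. cinner x z = cinner y z) \<Longrightarrow> x = y"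
  by (metis cinner_unit_vec ell2_eqI)

text \<open>\<open>T* T\<close> is defined through its coordinates, so no Riesz representation theorem is needed.\<close>

lemma ex_adjoint_square:
  assumes T: "complex_linear T"
  shows "\<exists>S. complex_linear S \<and> (\<forall>x y. cinner (S x) y = cinner (T x) (T y))"
proof -
  \<comment> \<open>The summands come from the coordinates of the adjoint applied to
    \<open>y\<close>. Testing with their truncation \<open>u\<close> bounds \<open>s\<close> by a
    multiple of \<open>sqrt s\<close>, and one factor cancels.\<close>
  have partial: "(\<Sum>n<M. (cmod (cinner y (T (unit_vec n))))\<^sup>2) \<le> (norm T * norm y)\<^sup>2" for y M
  proof -
    define s where "s = (\<Sum>n<M. (cmod (cinner y (T (unit_vec n))))\<^sup>2)"
    define u where "u = (\<Sum>n<M. cinner y (T (unit_vec n)) *\<^sub>C unit_vec n)"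
    have u: "ell2_nth u k = (if k < M then cinner y (T (unit_vec k)) else 0)" for k
      by (simp add: u_def ell2_nth_fin_sum)
    have s0: "0 \<le> s" unfolding s_def by (intro sum_nonneg) simp
    have nu: "norm u \<le> sqrt s"
    proof (rule ell2_norm_leI)
      fix L
      have "(\<Sum>n<L. (cmod (ell2_nth u n))\<^sup>2) = (\<Sum>n\<in>{..<L} \<inter> {..<M}. (cmod (cinner y (T (unit_vec n))))\<^sup>2)"
        by (intro sum.mono_neutral_cong_right) (auto simp: u)
      also have "\<dots> \<le> s" unfolding s_def by (intro sum_mono2) auto
      finally show "(\<Sum>n<L. (cmod (ell2_nth u n))\<^sup>2) \<le> (sqrt s)\<^sup>2" using s0 by simp
    qed (use s0 in simp)
    have "cinner y (T u) = of_real s"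
      unfolding u_def s_def blinfun.sum_right complex_linearD[OF T] cinner_sum_right cinner_scaleC_right
      by (simp add: complex_norm_square[symmetric] mult.commute)
    then have "s = cmod (cinner y (T u))" using s0 by simp
    also have "\<dots> \<le> norm y * norm (T u)" by (rule cmod_cinner_le)
    also have "\<dots> \<le> norm y * (norm T * sqrt s)"
      using nu by (intro mult_left_mono order_trans[OF norm_blinfun] mult_left_mono) auto
    finally have *: "sqrt s * sqrt s \<le> (norm T * norm y) * sqrt s" using s0 by (simp add: mult_ac)
    have "sqrt s \<le> norm T * norm y"
    proof (cases "s = 0")
      case False
      then show ?thesis using * s0 by (metis antisym_conv3 mult_le_cancel_right not_less real_sqrt_gt_0_iff order_le_less)
    qed simp
    then have "(sqrt s)\<^sup>2 \<le> (norm T * norm y)\<^sup>2" using s0 by (intro power_mono) auto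
    then show ?thesis using s0 by (simp add: s_def)
  qed
  define S0 where "S0 y = Abs_ell2 (\<lambda>n. cinner (T y) (T (unit_vec n)))" for y
  have S0: "ell2_nth (S0 y) n = cinner (T y) (T (unit_vec n))" for y n
    unfolding S0_def
    by (subst Abs_ell2_inverse) (use partial[where y = "T y"] in \<open>auto intro!: summableI_nonneg_bounded[of _ "(norm T * norm (T y))\<^sup>2"]\<close>)
  have "bounded_linear S0"
  proof (rule bounded_linear_intro[where K = "norm T * norm T"])
    fix x y :: ell2 and r :: real
    show "S0 (x + y) = S0 x + S0 y"
      by (rule ell2_eqI) (simp add: ell2_nth_simps S0 blinfun.add_right cinner_add_left)
    show "S0 (r *\<^sub>R x) = r *\<^sub>R S0 x"
      by (rule ell2_eqI) (simp add: ell2_nth_simps S0 blinfun.scaleR_right cinner_scaleR_left)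
    have "norm (S0 x) \<le> norm T * norm (T x)"
      by (rule ell2_norm_leI) (use partial in \<open>simp_all add: S0\<close>)
    also have "\<dots> \<le> norm T * (norm T * norm x)"
      by (intro mult_left_mono norm_blinfun) simp
    finally show "norm (S0 x) \<le> norm x * (norm T * norm T)" by (simp add: mult_ac)
  qed
  then have app: "blinfun_apply (Blinfun S0) = S0" by (rule bounded_linear_Blinfun_apply)
  have "cinner (S0 x) y = cinner (T x) (T y)" for x y
  proof (rule cinner_eqI)
    have "(\<lambda>M. T (\<Sum>n<M. ell2_nth y n *\<^sub>C unit_vec n)) \<longlonglongrightarrow> T y"
      using ell2_expansion[of y] unfolding sums_def by (intro blinfun.tendsto tendsto_const)
    then have "(\<lambda>M. cinner (T x) (T (\<Sum>n<M. ell2_nth y n *\<^sub>C unit_vec n))) \<longlonglongrightarrow> cinner (T x) (T y)"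
      by (rule tendsto_cinner_right)
    then show "(\<lambda>n. ell2_nth (S0 x) n * cnj (ell2_nth y n)) sums cinner (T x) (T y)"
      unfolding sums_def S0 blinfun.sum_right cinner_sum_right complex_linearD[OF T] cinner_scaleC_right
      by (simp add: mult.commute)
  qed
  moreover have "S0 (c *\<^sub>C x) = c *\<^sub>C S0 x" for c x
    by (rule ell2_eqI) (simp add: ell2_nth_simps S0 complex_linearD[OF T] cinner_scaleC_left)
  ultimately show ?thesis
    by (intro exI[of _ "Blinfun S0"]) (simp add: app complex_linear_def)
qed

section \<open>The absolute value of an operator\<close>

lemma complex_linear_compose: "complex_linear S \<Longrightarrow> complex_linear T \<Longrightarrow> complex_linear (S o\<^sub>L T)"
  by (simp add: complex_linear_def)

lemma complex_linear_add: "complex_linear S \<Longrightarrow> complex_linear T \<Longrightarrow> complex_linear (S + T)"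
  by (simp add: complex_linear_def blinfun.add_left scaleC_add_right)

lemma complex_linear_minus: "complex_linear S \<Longrightarrow> complex_linear T \<Longrightarrow> complex_linear (S - T)"
  by (simp add: complex_linear_def blinfun.diff_left scaleC_minus_right)

lemma complex_linear_scaleR: "complex_linear S \<Longrightarrow> complex_linear (r *\<^sub>R S)"
  by (simp add: complex_linear_def blinfun.scaleR_left scaleC_scaleR)

lemma complex_linear_zero: "complex_linear 0"
  using complex_linear_def by (simp, metis ell2_eqI ell2_nth_scaleC ell2_nth_zero mult_zero_right)

lemma complex_linear_id: "complex_linear id_blinfun"
  by (simp add: complex_linear_def)

lemma complex_linear_limit:
  assumes "\<And>n. complex_linear (Y n)" "Y \<longlonglongrightarrow> L"
  shows "complex_linear L"
  unfolding complex_linear_def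
proof (intro allI)
  fix c x
  have 1: "(\<lambda>n. Y n (c *\<^sub>C x)) \<longlonglongrightarrow> L (c *\<^sub>C x)"
    by (intro blinfun.tendsto assms tendsto_const)
  have "(\<lambda>n. c *\<^sub>C Y n x) \<longlonglongrightarrow> c *\<^sub>C L x"
  proof (rule Lim_null[THEN iffD2], rule Lim_null_comparison)
    have "(\<lambda>n. Y n x - L x) \<longlonglongrightarrow> 0"
      by (rule Lim_null[THEN iffD1], intro blinfun.tendsto assms tendsto_const)
    then show "(\<lambda>n. cmod c * norm (Y n x - L x)) \<longlonglongrightarrow> 0"
      by (intro tendsto_mult_right_zero tendsto_norm_zero)
  qed (auto simp: scaleC_minus_right[symmetric])
  then show "L (c *\<^sub>C x) = c *\<^sub>C L x"
    using 1 assms(1) by (metis (no_types, lifting) LIMSEQ_unique complex_linearD ext)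
qed

lemma positive_op_inner:
  assumes "positive_op P"
  shows "0 \<le> inner (P x) x" "cinner (P x) x = of_real (inner (P x) x)"
  using assms by (auto simp: positive_op_def inner_ell2_def complex_is_Real_iff complex_eq_iff)

text \<open>Polarization: reality of the quadratic form at \<open>x + y\<close> settles the
  imaginary parts, at \<open>x + \<i> *\<^sub>C y\<close> the real parts.\<close>

lemma positive_op_adjoint:
  assumes "positive_op P"
  shows "cinner (P x) y = cinner x (P y)"
proof -
  have lin: "complex_linear P" using assms by (simp add: positive_op_def)
  have re: "Im (cinner (P x) x) = 0" for x
    using positive_op_inner(2)[OF assms, of x] by simp
  have 1: "Im (cinner (P x) y) + Im (cinner (P y) x) = 0"
    using re[of "x + y"] re[of x] re[of y]
    by (simp add: blinfun.add_right cinner_add_left cinner_add_right)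
  have 2: "Re (cinner (P y) x) - Re (cinner (P x) y) = 0"
    using re[of "x + \<i> *\<^sub>C y"] re[of x] re[of y]
    by (simp add: blinfun.add_right cinner_add_left cinner_add_right complex_linearD[OF lin]
        cinner_scaleC_left cinner_scaleC_right)
  show ?thesis
    using 1 2 by (simp add: cinner_commute[of x "P y"] complex_eq_iff)
qed

lemma positive_op_selfadjoint:
  assumes "positive_op P"
  shows "inner (P x) y = inner x (P y)"
  by (simp add: inner_ell2_def positive_op_adjoint[OF assms])

text \<open>Along \<open>y - t *\<^sub>R P y\<close> the form is nonnegative and vanishes at
  \<open>t = 0\<close>, so its linear coefficient, a multiple of
  \<open>(norm (P y))\<^sup>2\<close>, cannot be negative.\<close>

lemma positive_op_null:
  assumes P: "positive_op P" and "inner (P y) y = 0"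
  shows "P y = 0"
proof -
  have "2 * t * (norm (P y))\<^sup>2 \<le> t\<^sup>2 * inner (P (P y)) (P y)" for t :: real
  proof -
    have "0 \<le> inner (P (y - t *\<^sub>R P y)) (y - t *\<^sub>R P y)" by (rule positive_op_inner[OF P])
    also have "\<dots> = - 2 * t * (norm (P y))\<^sup>2 + t\<^sup>2 * inner (P (P y)) (P y)"
      using assms(2) positive_op_selfadjoint[OF P, of "P y" y]
      by (simp add: blinfun.diff_right blinfun.scaleR_right inner_diff_left inner_diff_right
          dot_square_norm[symmetric] algebra_simps power2_eq_square)
        (simp add: dot_square_norm power2_eq_square)
    finally show ?thesis by simp
  qed
  note * = this
  define a where "a = (norm (P y))\<^sup>2"
  define b where "b = inner (P (P y)) (P y)"
  have ab: "0 \<le> a" "0 \<le> b" using positive_op_inner[OF P] by (simp_all add: a_def b_def)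
  have "a \<le> 0"
  proof (rule ccontr)
    assume "\<not> a \<le> 0"
    \<comment> \<open>This choice gives \<open>t * b \<le> a\<close>, against
      \<open>2 * a \<le> t * b\<close>; the added 1 covers \<open>b = 0\<close>.\<close>
    define t where "t = a / (1 + b)"
    have t: "0 < t" using \<open>\<not> a \<le> 0\<close> ab by (simp add: t_def)
    have "t * (2 * a) \<le> t * (t * b)" using *[of t] by (simp add: a_def b_def power2_eq_square mult_ac)
    then have "2 * a \<le> t * b" using t by simp
    also have "t * b \<le> a" using ab by (simp add: t_def divide_le_eq algebra_simps)
    finally show False using \<open>\<not> a \<le> 0\<close> by simp
  qed
  then have "a = 0" using ab by simp
  then show ?thesis by (simp add: a_def)
qed

text \<open>The iteration \<open>Y \<mapsto> (A + Y\<^sup>2) / 2\<close> for a contraction \<open>A\<close> is dominated in norm by the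
  scalar iteration \<open>y \<mapsto> (1 + y\<^sup>2) / 2\<close>, which increases to \<open>1\<close>.\<close>

primrec root_iter :: "ell2_op \<Rightarrow> nat \<Rightarrow> ell2_op" where
  "root_iter A 0 = 0"
| "root_iter A (Suc n) = (1/2) *\<^sub>R (A + (root_iter A n o\<^sub>L root_iter A n))"

primrec scalar_iter :: "nat \<Rightarrow> real" where
  "scalar_iter 0 = 0"
| "scalar_iter (Suc n) = (1 + (scalar_iter n)\<^sup>2) / 2"

lemma scalar_iter_bounds: "0 \<le> scalar_iter n \<and> scalar_iter n \<le> 1"
  by (induction n) (auto simp: power_le_one)

lemma scalar_iter_mono: "scalar_iter n \<le> scalar_iter (Suc n)"
  using zero_le_power2[of "scalar_iter n - 1"] by (simp add: power2_diff)

lemma convergent_scalar_iter: "convergent scalar_iter"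
proof (rule Bseq_mono_convergent)
  show "Bseq scalar_iter"
    using scalar_iter_bounds by (intro BseqI'[where K = 1]) auto
  show "\<forall>m. \<forall>n\<ge>m. scalar_iter m \<le> scalar_iter n"
    using lift_Suc_mono_le[of scalar_iter, OF scalar_iter_mono] by blast
qed

lemma norm_root_iter:
  assumes A: "norm A \<le> 1"
  shows "norm (root_iter A n) \<le> scalar_iter n"
    and "norm (root_iter A (Suc n) - root_iter A n) \<le> scalar_iter (Suc n) - scalar_iter n"
proof -
  show bd: "norm (root_iter A n) \<le> scalar_iter n" for n
  proof (induction n)
    case (Suc n)
    have "norm (root_iter A n o\<^sub>L root_iter A n) \<le> (scalar_iter n)\<^sup>2"
      using mult_mono[OF Suc Suc] scalar_iter_bounds[of n] norm_blinfun_compose[of "root_iter A n" "root_iter A n"]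
      unfolding power2_eq_square by (smt (verit) norm_ge_zero)
    then show ?case
      using A norm_triangle_ineq[of A "root_iter A n o\<^sub>L root_iter A n"] by simp
  qed simp
  show "norm (root_iter A (Suc n) - root_iter A n) \<le> scalar_iter (Suc n) - scalar_iter n"
  proof (induction n)
    case 0
    then show ?case using A by simp
  next
    case (Suc n)
    define U where "U = root_iter A (Suc n)"
    define V where "V = root_iter A n"
    define u where "u = scalar_iter (Suc n)"
    define v where "v = scalar_iter n"
    have uv: "norm U \<le> u" "norm V \<le> v" "norm (U - V) \<le> u - v"
      using bd[of "Suc n"] bd[of n] Suc by (simp_all only: U_def V_def u_def v_def)
    have "root_iter A (Suc (Suc n)) - root_iter A (Suc n) = (1/2) *\<^sub>R ((U o\<^sub>L U) - (V o\<^sub>L V))"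
      unfolding U_def root_iter.simps(2)[of A "Suc n"] unfolding V_def
      by (simp add: algebra_simps)
    \<comment> \<open>A difference of squares without commutativity. Its norm is at most
      \<open>(u - v) * (u + v)\<close>, twice the next scalar increment.\<close>
    also have "(U o\<^sub>L U) - (V o\<^sub>L V) = (U o\<^sub>L (U - V)) + ((U - V) o\<^sub>L V)"
      by (rule blinfun_eqI) (simp add: blinfun.diff_left blinfun.diff_right blinfun.add_left)
    finally have "norm (root_iter A (Suc (Suc n)) - root_iter A (Suc n))
        = norm ((U o\<^sub>L (U - V)) + ((U - V) o\<^sub>L V)) / 2" by simp
    also have "\<dots> \<le> (norm U * norm (U - V) + norm (U - V) * norm V) / 2"
      using norm_triangle_ineq[of "U o\<^sub>L (U - V)" "(U - V) o\<^sub>L V"]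
        norm_blinfun_compose[of U "U - V"] norm_blinfun_compose[of "U - V" V] by simp
    also have "\<dots> \<le> (u * (u - v) + (u - v) * v) / 2"
      using uv scalar_iter_mono[of n, folded u_def v_def]
      by (intro divide_right_mono add_mono mult_mono) (auto intro: order_trans[OF norm_ge_zero])
    also have "\<dots> = scalar_iter (Suc (Suc n)) - scalar_iter (Suc n)"
      unfolding scalar_iter.simps(2)[of "Suc n"] u_def[symmetric]
      unfolding u_def scalar_iter.simps(2)[of n] v_def[symmetric] by (simp add: field_simps power2_eq_square)
    finally show ?case .
  qed
qed

lemma convergent_root_iter:
  assumes A: "norm A \<le> 1"
  shows "convergent (root_iter A)"
proof -
  have step: "norm (root_iter A (n + k) - root_iter A n) \<le> scalar_iter (n + k) - scalar_iter n" for n k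
  proof (induction k)
    case (Suc k)
    have "norm (root_iter A (n + Suc k) - root_iter A n)
      \<le> norm (root_iter A (Suc (n + k)) - root_iter A (n + k)) + norm (root_iter A (n + k) - root_iter A n)"
      by (rule order_trans[OF _ norm_triangle_ineq]) (simp del: root_iter.simps)
    then show ?case using Suc norm_root_iter(2)[OF A, of "n + k"] by (simp del: root_iter.simps scalar_iter.simps)
  qed simp
  have "Cauchy (root_iter A)"
  proof (rule CauchyI')
    fix e :: real assume "0 < e"
    then obtain M where M: "\<forall>m\<ge>M. \<forall>n\<ge>M. norm (scalar_iter m - scalar_iter n) < e"
      using CauchyD[OF convergent_Cauchy[OF convergent_scalar_iter]] by blast
    have "dist (root_iter A m) (root_iter A n) < e" if "m \<ge> M" "n > m" for m n
    proof -
      have "norm (root_iter A n - root_iter A m) \<le> scalar_iter n - scalar_iter m"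
        using step[of m "n - m"] that by simp
      also have "\<dots> < e" using M that by (smt (verit) less_imp_le order_trans real_norm_def)
      finally show ?thesis by (simp add: dist_norm norm_minus_commute)
    qed
    then show "\<exists>M. \<forall>m\<ge>M. \<forall>n>m. dist (root_iter A m) (root_iter A n) < e" by blast
  qed
  then show ?thesis by (rule Cauchy_convergent)
qed

text \<open>With \<open>c = (norm T)\<^sup>2\<close> and \<open>A = 1 - S / c\<close>, where
  \<open>S\<close> is the adjoint square, the limit \<open>L\<close> satisfies
  \<open>2 L = A + L\<^sup>2\<close>. Hence \<open>(1 - L)\<^sup>2 = S / c\<close>, and
  \<open>norm T\<close> times \<open>1 - L\<close> is the root. As a limit of polynomials in
  \<open>A\<close> it commutes with whatever commutes with \<open>A\<close>, in particular with any
  other root of \<open>S\<close>; the last clause records this for the uniqueness proof.\<close>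

lemma ex_abs_op:
  assumes T: "complex_linear T"
  shows "\<exists>P. positive_op P \<and> (\<forall>x y. cinner (P (P x)) y = cinner (T x) (T y)) \<and>
    (\<forall>Q. (\<forall>x y. cinner (blinfun_apply Q (Q x)) y = cinner (T x) (T y)) \<longrightarrow> P o\<^sub>L Q = Q o\<^sub>L P)"
proof (cases "T = 0")
  case True
  then show ?thesis
    by (intro exI[of _ 0]) (auto simp: positive_op_def complex_linear_zero intro!: blinfun_eqI)
next
  case False
  define c where "c = (norm T)\<^sup>2"
  have c: "c > 0" using False by (simp add: c_def)
  obtain S where S: "complex_linear S" "\<And>x y. cinner (S x) y = cinner (T x) (T y)"
    using ex_adjoint_square[OF T] by blast
  define A where "A = id_blinfun - (1 / c) *\<^sub>R S"
  have A: "A x = x - (1 / c) *\<^sub>R S x" for x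
    by (simp add: A_def blinfun.diff_left blinfun.scaleR_left)
  have innerS: "inner (S x) y = inner (T x) (T y)" for x y
    using S(2) by (simp add: inner_ell2_def)
  \<comment> \<open>In the expansion of \<open>(norm (A x))\<^sup>2\<close> the quadratic term is at
    most half of the subtracted one, because
    \<open>norm (S x) \<le> norm T * norm (T x)\<close>.\<close>
  have nA: "norm A \<le> 1"
  proof (rule norm_blinfun_bound)
    fix x
    have "(norm (S x))\<^sup>2 = inner (T x) (T (S x))" by (simp add: power2_norm_eq_inner innerS)
    also have "\<dots> \<le> norm (T x) * (norm T * norm (S x))"
      by (intro order_trans[OF norm_cauchy_schwarz] mult_left_mono norm_blinfun) simp
    finally have "norm (S x) * norm (S x) \<le> (norm T * norm (T x)) * norm (S x)"
      by (simp add: power2_eq_square mult_ac)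
    then have "norm (S x) \<le> norm T * norm (T x)"
      by (cases "norm (S x) = 0") (simp_all add: mult_le_cancel_right)
    then have "(norm (S x))\<^sup>2 \<le> c * (norm (T x))\<^sup>2"
      using power_mono[of "norm (S x)" "norm T * norm (T x)" 2] by (simp add: c_def power_mult_distrib)
    then have *: "(norm (S x))\<^sup>2 / c\<^sup>2 \<le> (norm (T x))\<^sup>2 / c"
      using c by (simp add: field_simps power2_eq_square)
    have "(norm (A x))\<^sup>2 = (norm x)\<^sup>2 - 2 * (norm (T x))\<^sup>2 / c + (norm (S x))\<^sup>2 / c\<^sup>2"
      unfolding A power2_norm_eq_inner inner_diff_left inner_diff_right inner_scaleR_left inner_scaleR_right
      using innerS[of x x] c
      by (simp add: inner_commute[of x "S x"] power2_eq_square) (simp add: field_simps)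
    also have "\<dots> \<le> (norm x)\<^sup>2"
    proof -
      have "0 \<le> (norm (T x))\<^sup>2 / c" using c by simp
      then show ?thesis using * by simp
    qed
    finally have "norm (A x) \<le> norm x" by (simp add: power2_le_iff_abs_le)
    then show "norm (A x) \<le> 1 * norm x" by simp
  qed simp
  obtain L where L: "root_iter A \<longlonglongrightarrow> L"
    using convergent_root_iter[OF nA] by (auto simp: convergent_def)
  have lim: "(\<lambda>n. (1/2) *\<^sub>R (A + (root_iter A n o\<^sub>L root_iter A n))) \<longlonglongrightarrow> (1/2) *\<^sub>R (A + (L o\<^sub>L L))"
    by (intro tendsto_intros bounded_bilinear.tendsto[OF bounded_bilinear_blinfun_compose] L)
  have fixL: "L = (1/2) *\<^sub>R (A + (L o\<^sub>L L))"
    by (rule LIMSEQ_unique[OF LIMSEQ_Suc[OF L]]) (unfold root_iter.simps, rule lim)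
  have "norm L \<le> 1"
  proof (rule LIMSEQ_le_const2[OF tendsto_norm[OF L]])
    have "norm (root_iter A n) \<le> 1" for n
      using norm_root_iter(1)[OF nA, of n] scalar_iter_bounds[of n] by linarith
    then show "\<exists>N. \<forall>n\<ge>N. norm (root_iter A n) \<le> 1" by blast
  qed
  have linA: "complex_linear A"
    unfolding A_def by (intro complex_linear_minus complex_linear_id complex_linear_scaleR S(1))
  have linL: "complex_linear L"
  proof (rule complex_linear_limit[OF _ L])
    show "complex_linear (root_iter A n)" for n
      by (induction n) (auto intro: complex_linear_zero complex_linear_scaleR complex_linear_add
          linA complex_linear_compose)
  qed
  have selfL: "inner (L x) y = inner x (L y)" for x y
  proof -
    have "inner (root_iter A n x) y = inner x (root_iter A n y)" for n x y
    proof (induction n arbitrary: x y)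
      case (Suc n)
      have "inner (A x) y = inner x (A y)"
        using innerS[of x y] innerS[of y x]
        by (simp add: A inner_diff_left inner_diff_right inner_commute)
      then show ?case
        by (simp add: blinfun.scaleR_left blinfun.add_left inner_add_left inner_add_right Suc)
    qed simp
    moreover have "(\<lambda>n. inner (root_iter A n x) y) \<longlonglongrightarrow> inner (L x) y"
      "(\<lambda>n. inner x (root_iter A n y)) \<longlonglongrightarrow> inner x (L y)"
      by (intro tendsto_inner blinfun.tendsto tendsto_const L)+
    ultimately show ?thesis by (simp add: LIMSEQ_unique)
  qed
  have comm: "L o\<^sub>L Q = Q o\<^sub>L L" if AQ: "A o\<^sub>L Q = Q o\<^sub>L A" for Q :: ell2_op
  proof -
    have AQ': "A (Q x) = Q (A x)" for x using AQ by (metis blinfun_apply_blinfun_compose)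
    have "root_iter A n (Q x) = Q (root_iter A n x)" for n x
      by (induction n arbitrary: x) (simp_all add: blinfun.scaleR_left blinfun.add_left blinfun.scaleR_right blinfun.add_right AQ')
    then have "root_iter A n o\<^sub>L Q = Q o\<^sub>L root_iter A n" for n by (intro blinfun_eqI) simp
    moreover have "(\<lambda>n. root_iter A n o\<^sub>L Q) \<longlonglongrightarrow> (L o\<^sub>L Q)" "(\<lambda>n. Q o\<^sub>L root_iter A n) \<longlonglongrightarrow> (Q o\<^sub>L L)"
      by (intro bounded_bilinear.tendsto[OF bounded_bilinear_blinfun_compose] tendsto_const L)+
    ultimately show ?thesis by (simp add: LIMSEQ_unique)
  qed
  define P where "P = norm T *\<^sub>R (id_blinfun - L)"
  have P: "P x = norm T *\<^sub>R (x - L x)" for x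
    by (simp add: P_def blinfun.scaleR_left blinfun.diff_left)
  have linP: "complex_linear P"
    unfolding P_def by (intro complex_linear_scaleR complex_linear_minus complex_linear_id linL)
  have selfP: "inner (P x) y = inner x (P y)" for x y
    by (simp add: P inner_diff_left inner_diff_right selfL)
  have PP: "P (P x) = S x" for x
  proof -
    have "L x = (1/2) *\<^sub>R (A x + L (L x))"
      using fixL by (metis blinfun.add_left blinfun.scaleR_left blinfun_apply_blinfun_compose)
    then have "2 *\<^sub>R L x = A x + L (L x)"
      by (metis scaleR_scaleR scaleR_one mult_numeral_1_right nonzero_eq_divide_eq zero_neq_numeral numeral_One divide_self_if mult.commute times_divide_eq_right)
    then have "L (L x) = 2 *\<^sub>R L x - A x" by (simp add: algebra_simps)
    then have *: "(x - L x) - (L x - L (L x)) = x - A x" by (simp add: scaleR_2)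
    have "P (P x) = (norm T * norm T) *\<^sub>R ((x - L x) - (L x - L (L x)))"
      by (simp add: P blinfun.diff_right blinfun.scaleR_right scaleR_diff_right)
    then have "P (P x) = (norm T * norm T) *\<^sub>R (x - A x)" unfolding * .
    then show ?thesis using c False by (simp add: A c_def power2_eq_square)
  qed
  have "positive_op P"
    unfolding positive_op_def
  proof (intro conjI allI linP)
    fix x
    \<comment> \<open>Real symmetry and complex linearity together: moving \<open>\<i>\<close>
      across the product changes the sign, so the form is real.\<close>
    have "inner (P x) (\<i> *\<^sub>C x) = - inner (P x) (\<i> *\<^sub>C x)"
    proof -
      have "inner (P x) (\<i> *\<^sub>C x) = inner x (\<i> *\<^sub>C P x)"
        by (simp add: selfP complex_linearD[OF linP])
      also have "\<dots> = - inner (P x) (\<i> *\<^sub>C x)"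
        unfolding inner_ell2_def cinner_scaleC_right cinner_commute[of x "P x"] by simp
      finally show ?thesis .
    qed
    then have "inner (P x) (\<i> *\<^sub>C x) = 0" by simp
    then show "cinner (P x) x \<in> \<real>" by (simp add: cinner_eq_inner complex_is_Real_iff)
    have "inner (L x) x \<le> norm (L x) * norm x" by (rule norm_cauchy_schwarz)
    also have "\<dots> \<le> (1 * norm x) * norm x"
      using \<open>norm L \<le> 1\<close> by (intro mult_right_mono order_trans[OF norm_blinfun]) auto
    finally have "inner (L x) x \<le> inner x x" by (simp add: dot_square_norm power2_eq_square)
    then show "0 \<le> Re (cinner (P x) x)"
      by (simp add: inner_ell2_def[symmetric] P inner_diff_left)
  qed
  moreover have "P o\<^sub>L Q = Q o\<^sub>L P" if Q: "\<forall>x y. cinner (blinfun_apply Q (Q x)) y = cinner (T x) (T y)" for Q :: ell2_op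
  proof -
    have "Q (Q x) = S x" for x
      by (rule cinner_right_ext) (simp add: Q S(2))
    then have "S (Q x) = Q (S x)" for x by metis
    then have "A o\<^sub>L Q = Q o\<^sub>L A"
      by (intro blinfun_eqI) (simp add: A blinfun.diff_right blinfun.scaleR_right)
    then have "L (Q x) = Q (L x)" for x using comm by (metis blinfun_apply_blinfun_compose)
    then show ?thesis
      by (intro blinfun_eqI) (simp add: P blinfun.diff_right blinfun.scaleR_right)
  qed
  ultimately show ?thesis by (intro exI[of _ P]) (simp add: PP S(2))
qed

text \<open>Two positive roots \<open>P\<close>, \<open>Q\<close> commute, so \<open>P + Q\<close>
  annihilates \<open>y = P x - Q x\<close>. Both forms then vanish at \<open>y\<close>, hence
  \<open>P y = Q y = 0\<close>, and self-adjointness gives \<open>inner y y = 0\<close>. This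
  justifies the definite description in \<open>abs_op\<close>.\<close>

lemma abs_op_ex1:
  assumes T: "complex_linear T"
  shows "\<exists>!P. positive_op P \<and> (\<forall>x y. cinner (P (P x)) y = cinner (T x) (T y))"
proof -
  obtain P where P: "positive_op P" "\<And>x y. cinner (P (P x)) y = cinner (T x) (T y)"
    and comm: "\<And>Q. (\<forall>x y. cinner (blinfun_apply Q (Q x)) y = cinner (T x) (T y)) \<Longrightarrow> P o\<^sub>L Q = Q o\<^sub>L P"
    using ex_abs_op[OF T] by blast
  have "Q = P" if Q: "positive_op Q" "\<forall>x y. cinner (Q (Q x)) y = cinner (T x) (T y)" for Q :: ell2_op
  proof (rule blinfun_eqI)
    fix x
    have PQ: "P (Q z) = Q (P z)" for z using comm[OF Q(2)] by (metis blinfun_apply_blinfun_compose)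
    have sq: "P (P z) = Q (Q z)" for z by (rule cinner_right_ext) (simp add: P(2) Q(2))
    define y where "y = P x - Q x"
    have "P y + Q y = 0" by (simp add: y_def blinfun.diff_right PQ sq)
    then have "inner (P y) y + inner (Q y) y = 0" by (metis inner_add_left inner_zero_left)
    then have "inner (P y) y = 0" "inner (Q y) y = 0"
      using positive_op_inner(1)[OF P(1), of y] positive_op_inner(1)[OF Q(1), of y] by linarith+
    then have "P y = 0" "Q y = 0" using positive_op_null P(1) Q(1) by blast+
    then have "inner y y = 0"
      using positive_op_selfadjoint[OF P(1), of x y] positive_op_selfadjoint[OF Q(1), of x y]
      by (simp add: y_def inner_diff_left)
    then show "Q x = P x" by (simp add: y_def)
  qed
  then show ?thesis using P by blast
qed

lemma abs_op_props:
  assumes "complex_linear T"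
  shows "positive_op (abs_op T)" "cinner (abs_op T (abs_op T x)) y = cinner (T x) (T y)"
  using theI'[OF abs_op_ex1[OF assms], folded abs_op_def] by auto

lemma abs_op_eqI:
  assumes "complex_linear T" "positive_op P" "\<And>x y. cinner (P (P x)) y = cinner (T x) (T y)"
  shows "abs_op T = P"
  using abs_op_ex1[OF assms(1)] abs_op_props[OF assms(1)] assms(2,3) by blast

lemma norm_abs_op_apply:
  assumes "complex_linear T"
  shows "norm (abs_op T x) = norm (T x)"
proof -
  have "inner (abs_op T x) (abs_op T x) = inner (T x) (T x)"
    using abs_op_props[OF assms] positive_op_selfadjoint[OF abs_op_props(1)[OF assms]]
    by (metis inner_ell2_def)
  then show ?thesis by (simp add: norm_eq_sqrt_inner)
qed

lemma trace_norm_nonneg: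
  assumes "T \<in> trace_class"
  shows "0 \<le> trace_norm T"
proof -
  have lin: "complex_linear T" and s: "summable (\<lambda>n. cinner (abs_op T (unit_vec n)) (unit_vec n))"
    using assms by (auto simp: trace_class_def)
  have "trace_norm T = (\<Sum>n. Re (cinner (abs_op T (unit_vec n)) (unit_vec n)))"
    unfolding trace_norm_def trace_op_def by (rule Re_suminf[OF s])
  also have "\<dots> \<ge> 0"
    using abs_op_props(1)[OF lin] by (intro suminf_nonneg summable_Re s) (simp add: positive_op_def)
  finally show ?thesis .
qed

section \<open>Finite matrices as operators\<close>

text \<open>All operator-valued functions built later take values in such corner matrices (row index
  first), so compactness, trace class and measurability reduce to finitely many entries.\<close>

definition fin_op :: "nat \<Rightarrow> (nat \<Rightarrow> nat \<Rightarrow> complex) \<Rightarrow> ell2_op"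
  where "fin_op N m = Blinfun (\<lambda>x. \<Sum>a<N. (\<Sum>b<N. m a b * ell2_nth x b) *\<^sub>C unit_vec a)"

lemma norm_fin_sum_le: "norm (\<Sum>a<N. c a *\<^sub>C unit_vec a) \<le> (\<Sum>a<N. cmod (c a))"
  by (rule order_trans[OF norm_sum]) simp

lemma bounded_linear_fin_op:
  "bounded_linear (\<lambda>x. \<Sum>a<N. (\<Sum>b<N. m a b * ell2_nth x b) *\<^sub>C unit_vec a)"
proof (rule bounded_linear_intro)
  fix x y :: ell2 and r :: real
  show "(\<Sum>a<N. (\<Sum>b<N. m a b * ell2_nth (x + y) b) *\<^sub>C unit_vec a)
    = (\<Sum>a<N. (\<Sum>b<N. m a b * ell2_nth x b) *\<^sub>C unit_vec a) + (\<Sum>a<N. (\<Sum>b<N. m a b * ell2_nth y b) *\<^sub>C unit_vec a)"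
    by (simp add: ell2_nth_simps distrib_left sum.distrib scaleC_add_left)
  show "(\<Sum>a<N. (\<Sum>b<N. m a b * ell2_nth (r *\<^sub>R x) b) *\<^sub>C unit_vec a)
    = r *\<^sub>R (\<Sum>a<N. (\<Sum>b<N. m a b * ell2_nth x b) *\<^sub>C unit_vec a)"
    by (simp add: ell2_nth_simps mult.left_commute[of _ "of_real r"] sum_distrib_left[symmetric]
        scaleC_scaleC[symmetric] scaleC_of_real scaleR_sum_right)
  have "norm (\<Sum>a<N. (\<Sum>b<N. m a b * ell2_nth x b) *\<^sub>C unit_vec a)
      \<le> (\<Sum>a<N. cmod (\<Sum>b<N. m a b * ell2_nth x b))" by (rule norm_fin_sum_le)
  also have "\<dots> \<le> (\<Sum>a<N. \<Sum>b<N. cmod (m a b) * norm x)"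
    by (intro sum_mono order_trans[OF norm_sum]) (simp add: norm_mult mult_left_mono cmod_ell2_nth_le)
  finally show "norm (\<Sum>a<N. (\<Sum>b<N. m a b * ell2_nth x b) *\<^sub>C unit_vec a)
      \<le> norm x * (\<Sum>a<N. \<Sum>b<N. cmod (m a b))"
    by (simp add: sum_distrib_left mult.commute)
qed

lemma fin_op_apply: "fin_op N m x = (\<Sum>a<N. (\<Sum>b<N. m a b * ell2_nth x b) *\<^sub>C unit_vec a)"
  unfolding fin_op_def by (simp add: bounded_linear_Blinfun_apply[OF bounded_linear_fin_op])

lemma ell2_nth_fin_op: "ell2_nth (fin_op N m x) a = (if a < N then \<Sum>b<N. m a b * ell2_nth x b else 0)"
  by (simp add: fin_op_apply ell2_nth_fin_sum)

lemma fin_op_eqI: "(\<And>a b. a < N \<Longrightarrow> b < N \<Longrightarrow> m a b = m' a b) \<Longrightarrow> fin_op N m = fin_op N m'"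
  unfolding fin_op_def by (intro arg_cong[where f = Blinfun] ext sum.cong arg_cong2[where f = scaleC]) auto

lemma complex_linear_fin_op: "complex_linear (fin_op N m)"
  unfolding complex_linear_def
  by (auto intro!: ell2_eqI simp: ell2_nth_fin_op ell2_nth_scaleC sum_distrib_left mult_ac)

lemma fin_op_diff: "fin_op N m - fin_op N m' = fin_op N (\<lambda>a b. m a b - m' a b)"
  by (auto intro!: blinfun_eqI ell2_eqI
      simp: ell2_nth_fin_op ell2_nth_minus blinfun.diff_left left_diff_distrib sum_subtractf)

lemma fin_op_add: "fin_op N m + fin_op N m' = fin_op N (\<lambda>a b. m a b + m' a b)"
  by (auto intro!: blinfun_eqI ell2_eqI
      simp: ell2_nth_fin_op ell2_nth_plus blinfun.add_left algebra_simps sum.distrib)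

lemma fin_op_zero: "fin_op N (\<lambda>a b. 0) = 0"
  by (auto intro!: blinfun_eqI ell2_eqI simp: ell2_nth_fin_op ell2_nth_zero)

lemma fin_op_sum: "(\<Sum>i\<in>A. fin_op N (m i)) = fin_op N (\<lambda>a b. \<Sum>i\<in>A. m i a b)"
  by (induction A rule: infinite_finite_induct) (simp_all add: fin_op_zero fin_op_add)

lemma norm_fin_op_le_sum: "norm (fin_op N m) \<le> (\<Sum>a<N. \<Sum>b<N. cmod (m a b))"
proof (rule norm_blinfun_bound)
  fix x
  have "norm (fin_op N m x) \<le> (\<Sum>a<N. cmod (\<Sum>b<N. m a b * ell2_nth x b))"
    unfolding fin_op_apply by (rule norm_fin_sum_le)
  also have "\<dots> \<le> (\<Sum>a<N. \<Sum>b<N. cmod (m a b) * norm x)"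
    by (intro sum_mono order_trans[OF norm_sum]) (simp add: norm_mult mult_left_mono cmod_ell2_nth_le)
  finally show "norm (fin_op N m x) \<le> (\<Sum>a<N. \<Sum>b<N. cmod (m a b)) * norm x"
    by (simp add: sum_distrib_right)
qed (intro sum_nonneg; simp)

text \<open>The form is bilinear, without conjugation, to match Hilbert's inequality. Testing it
  with the conjugated coordinates of \<open>fin_op N m x\<close> gives the squared norm of the
  image.\<close>

lemma norm_fin_op_le_form:
  assumes "\<And>x y. cmod (\<Sum>a<N. \<Sum>b<N. m a b * x b * y a)
      \<le> C * sqrt (\<Sum>b<N. (cmod (x b))\<^sup>2) * sqrt (\<Sum>a<N. (cmod (y a))\<^sup>2)"
    and "0 \<le> C"
  shows "norm (fin_op N m) \<le> C"
proof (rule norm_blinfun_bound)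
  fix x
  have sq: "sqrt (\<Sum>a<N. (cmod (ell2_nth z a))\<^sup>2) \<le> norm z" for z
    using ell2_sum_le_norm[of "{..<N}" z] by (intro real_le_lsqrt) (auto intro: sum_nonneg)
  define y where "y = fin_op N m x"
  have "cinner y y = (\<Sum>a<N. \<Sum>b<N. m a b * ell2_nth x b * cnj (ell2_nth y a))"
  proof -
    have "cinner y y = (\<Sum>a<N. (\<Sum>b<N. m a b * ell2_nth x b) * cnj (ell2_nth y a))"
      by (subst y_def, unfold fin_op_apply cinner_sum_left cinner_scaleC_left)
        (simp add: cinner_commute[of _ y] cinner_unit_vec)
    then show ?thesis by (simp add: sum_distrib_right)
  qed
  then have "(norm y)\<^sup>2 = cmod (\<Sum>a<N. \<Sum>b<N. m a b * ell2_nth x b * cnj (ell2_nth y a))"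
    unfolding cinner_self by (metis norm_of_real abs_of_nonneg zero_le_power2)
  also have "\<dots> \<le> C * sqrt (\<Sum>b<N. (cmod (ell2_nth x b))\<^sup>2) * sqrt (\<Sum>a<N. (cmod (ell2_nth y a))\<^sup>2)"
    using assms(1)[of "ell2_nth x" "\<lambda>a. cnj (ell2_nth y a)"] by simp
  also have "\<dots> \<le> C * norm x * norm y"
    using assms(2) by (intro mult_mono sq) (auto intro: sum_nonneg)
  finally have "norm y * norm y \<le> (C * norm x) * norm y" by (simp add: power2_eq_square)
  then show "norm (fin_op N m x) \<le> C * norm x"
    unfolding y_def[symmetric] using assms(2) by (cases "norm y = 0") (simp_all add: mult_le_cancel_right)
qed (rule assms)

lemma tendsto_fin_op:
  assumes "\<And>a b. a < N \<Longrightarrow> b < N \<Longrightarrow> ((\<lambda>t. m t a b) \<longlongrightarrow> l a b) F"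
  shows "((\<lambda>t. fin_op N (m t)) \<longlongrightarrow> fin_op N l) F"
proof (rule Lim_null[THEN iffD2], rule Lim_null_comparison)
  have "((\<lambda>t. \<Sum>a<N. \<Sum>b<N. cmod (m t a b - l a b)) \<longlongrightarrow> (\<Sum>a<N. \<Sum>b<N. cmod (l a b - l a b))) F"
    by (intro tendsto_intros assms) auto
  then show "((\<lambda>t. \<Sum>a<N. \<Sum>b<N. cmod (m t a b - l a b)) \<longlongrightarrow> 0) F" by simp
qed (auto simp: fin_op_diff norm_fin_op_le_sum)

lemma continuous_on_fin_op:
  assumes "\<And>a b. a < N \<Longrightarrow> b < N \<Longrightarrow> continuous_on S (\<lambda>t. m t a b)"
  shows "continuous_on S (\<lambda>t. fin_op N (m t))"
  using assms unfolding continuous_on_def by (blast intro: tendsto_fin_op)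

text \<open>Such a box contains the image of the unit ball under a corner matrix. It is built one
  coordinate at a time, adding the image of a closed disc.\<close>

lemma compact_fin_box: "compact {\<Sum>a<N. c a *\<^sub>C unit_vec a | c. \<forall>a<N. cmod (c a) \<le> R}"
proof (induction N)
  case (Suc N)
  let ?S = "{\<Sum>a<N. c a *\<^sub>C unit_vec a | c. \<forall>a<N. cmod (c a) \<le> R}"
  let ?D = "(\<lambda>z. z *\<^sub>C unit_vec N) ` cball 0 R"
  have "continuous_on UNIV (\<lambda>z. z *\<^sub>C unit_vec N)"
  proof (rule continuous_on_iff[THEN iffD2], intro ballI allI impI)
    fix z :: complex and e :: real assume "0 < e"
    moreover have "dist (w *\<^sub>C unit_vec N) (z *\<^sub>C unit_vec N) = dist w z" for w
      using scaleC_add_left[of "w - z" z "unit_vec N"] norm_scaleC[of "w - z" "unit_vec N"]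
      by (simp add: dist_norm)
    ultimately show "\<exists>d>0. \<forall>w\<in>UNIV. dist w z < d \<longrightarrow> dist (w *\<^sub>C unit_vec N) (z *\<^sub>C unit_vec N) < e"
      by auto
  qed
  then have "compact ?D"
    by (intro compact_continuous_image compact_cball) (rule continuous_on_subset, auto)
  then have "compact {u + v | u v. u \<in> ?S \<and> v \<in> ?D}"
    using Suc compact_sums by blast
  also have "{u + v | u v. u \<in> ?S \<and> v \<in> ?D} = {\<Sum>a<Suc N. c a *\<^sub>C unit_vec a | c. \<forall>a<Suc N. cmod (c a) \<le> R}"
    (is "?L = ?R")
  proof (intro equalityI subsetI)
    fix z assume "z \<in> ?L"
    then obtain c d where cd: "\<forall>a<N. cmod (c a) \<le> R" "cmod d \<le> R"
      and z: "z = (\<Sum>a<N. c a *\<^sub>C unit_vec a) + d *\<^sub>C unit_vec N" by auto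
    have "z = (\<Sum>a<Suc N. (c(N := d)) a *\<^sub>C unit_vec a)" unfolding z by simp
    moreover have "\<forall>a<Suc N. cmod ((c(N := d)) a) \<le> R" using cd by (auto simp: less_Suc_eq)
    ultimately show "z \<in> ?R" by blast
  next
    fix z assume "z \<in> ?R"
    then obtain c where "\<forall>a<Suc N. cmod (c a) \<le> R" "z = (\<Sum>a<Suc N. c a *\<^sub>C unit_vec a)" by auto
    then show "z \<in> ?L"
      by (intro CollectI exI[of _ "\<Sum>a<N. c a *\<^sub>C unit_vec a"] exI[of _ "c N *\<^sub>C unit_vec N"]) auto
  qed
  finally show ?case .
qed simp

lemma fin_op_compact: "fin_op N m \<in> compact_ops"
proof -
  define R where "R = (\<Sum>a<N. \<Sum>b<N. cmod (m a b))"
  let ?K = "{\<Sum>a<N. c a *\<^sub>C unit_vec a | c. \<forall>a<N. cmod (c a) \<le> R}"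
  have "fin_op N m ` cball 0 1 \<subseteq> ?K"
  proof (rule image_subsetI)
    fix x :: ell2 assume "x \<in> cball 0 1"
    then have "norm x \<le> 1" by simp
    have "cmod (\<Sum>b<N. m a b * ell2_nth x b) \<le> R" if "a < N" for a
    proof -
      have "cmod (\<Sum>b<N. m a b * ell2_nth x b) \<le> (\<Sum>b<N. cmod (m a b))"
        using order_trans[OF cmod_ell2_nth_le \<open>norm x \<le> 1\<close>]
        by (intro order_trans[OF norm_sum] sum_mono) (simp add: norm_mult mult_left_le)
      also have "\<dots> \<le> R"
        unfolding R_def using that by (intro member_le_sum[of a "{..<N}" "\<lambda>a. \<Sum>b<N. cmod (m a b)"]) (auto intro: sum_nonneg)
      finally show ?thesis .
    qed
    then show "fin_op N m x \<in> ?K" unfolding fin_op_apply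
      by (intro CollectI exI[of _ "\<lambda>a. \<Sum>b<N. m a b * ell2_nth x b"]) simp
  qed
  then have "closure (fin_op N m ` cball 0 1) \<subseteq> ?K"
    by (intro closure_minimal compact_imp_closed compact_fin_box)
  then have "compact (closure (fin_op N m ` cball 0 1))"
    using compact_Int_closed[OF compact_fin_box, of "closure (fin_op N m ` cball 0 1)" N R]
    by (simp add: Int_absorb1)
  then show ?thesis by (simp add: compact_ops_def complex_linear_fin_op)
qed

text \<open>\<open>abs_op T\<close> and \<open>T\<close> have the same norm on every vector, so they
  kill the same unit vectors and the trace becomes a finite sum.\<close>

lemma trace_fin_supp:
  assumes lin: "complex_linear T" and z: "\<And>n. n \<ge> N \<Longrightarrow> T (unit_vec n) = 0"
  shows "T \<in> trace_class" "trace_norm T \<le> (\<Sum>n<N. norm (T (unit_vec n)))"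
proof -
  have 0: "cinner (abs_op T (unit_vec n)) (unit_vec n) = 0" if "n \<notin> {..<N}" for n
    using norm_abs_op_apply[OF lin, of "unit_vec n"] z[of n] that by simp
  have "summable (\<lambda>n. cinner (abs_op T (unit_vec n)) (unit_vec n))"
    by (rule summable_finite[of "{..<N}", OF _ 0]) auto
  then show "T \<in> trace_class" by (simp add: trace_class_def lin)
  have "trace_norm T = (\<Sum>n<N. Re (cinner (abs_op T (unit_vec n)) (unit_vec n)))"
    unfolding trace_norm_def trace_op_def by (subst suminf_finite[of "{..<N}", OF _ 0]) auto
  also have "\<dots> \<le> (\<Sum>n<N. norm (T (unit_vec n)))"
  proof (rule sum_mono)
    fix n
    have "Re (cinner (abs_op T (unit_vec n)) (unit_vec n)) \<le> norm (abs_op T (unit_vec n)) * norm (unit_vec n)"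
      by (rule order_trans[OF complex_Re_le_cmod cmod_cinner_le])
    then show "Re (cinner (abs_op T (unit_vec n)) (unit_vec n)) \<le> norm (T (unit_vec n))"
      by (simp add: norm_abs_op_apply[OF lin])
  qed
  finally show "trace_norm T \<le> (\<Sum>n<N. norm (T (unit_vec n)))" .
qed

lemma fin_op_unit_vec: "fin_op N m (unit_vec n) = (if n < N then \<Sum>a<N. m a n *\<^sub>C unit_vec a else 0)"
  by (auto intro!: ell2_eqI simp: ell2_nth_fin_op ell2_nth_simps if_distrib[of "\<lambda>c. _ * c"] cong: if_cong)

lemma fin_op_trace_class: "fin_op N m \<in> trace_class"
  by (rule trace_fin_supp(1)[OF complex_linear_fin_op, of N]) (simp add: fin_op_unit_vec)

lemma trace_norm_fin_op_le: "trace_norm (fin_op N m) \<le> (\<Sum>b<N. \<Sum>a<N. cmod (m a b))"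
proof -
  have "trace_norm (fin_op N m) \<le> (\<Sum>b<N. norm (fin_op N m (unit_vec b)))"
    by (rule trace_fin_supp(2)[OF complex_linear_fin_op]) (simp add: fin_op_unit_vec)
  also have "\<dots> \<le> (\<Sum>b<N. \<Sum>a<N. cmod (m a b))"
    by (intro sum_mono) (simp add: fin_op_unit_vec norm_fin_sum_le)
  finally show ?thesis .
qed

lemma trace_op_fin_op: "trace_op (fin_op N m) = (\<Sum>a<N. m a a)"
proof -
  have "trace_op (fin_op N m) = (\<Sum>a<N. cinner (fin_op N m (unit_vec a)) (unit_vec a))"
    unfolding trace_op_def by (rule suminf_finite) (auto simp: fin_op_unit_vec)
  also have "\<dots> = (\<Sum>a<N. m a a)"
    by (intro sum.cong) (auto simp: cinner_unit_vec ell2_nth_fin_op ell2_nth_simps if_distrib[of "\<lambda>c. _ * c"] cong: if_cong)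
  finally show ?thesis .
qed

lemma fin_op_compose: "fin_op N m o\<^sub>L fin_op N m' = fin_op N (\<lambda>a b. \<Sum>k<N. m a k * m' k b)"
proof (rule blinfun_eqI, rule ell2_eqI)
  fix x a
  have "(\<Sum>k<N. m a k * (\<Sum>b<N. m' k b * ell2_nth x b)) = (\<Sum>b<N. (\<Sum>k<N. m a k * m' k b) * ell2_nth x b)"
    unfolding sum_distrib_left sum_distrib_right by (subst sum.swap) (simp add: mult.assoc)
  then show "ell2_nth ((fin_op N m o\<^sub>L fin_op N m') x) a = ell2_nth (fin_op N (\<lambda>a b. \<Sum>k<N. m a k * m' k b) x) a"
    by (simp add: ell2_nth_fin_op)
qed

text \<open>Here \<open>T x\<close> is \<open>cinner x v *\<^sub>C u\<close>, and
  \<open>abs_op T\<close> is the rank one operator along \<open>v\<close>, rescaled by the ratio of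
  the norms of \<open>u\<close> and \<open>v\<close>. The exact value matters: for the matrices used
  later the entrywise bound \<open>trace_norm_fin_op_le\<close> grows with \<open>N\<close>.\<close>

lemma trace_norm_rank_one:
  "trace_norm (fin_op N (\<lambda>a b. \<xi> a * \<eta> b)) = sqrt (\<Sum>a<N. (cmod (\<xi> a))\<^sup>2) * sqrt (\<Sum>b<N. (cmod (\<eta> b))\<^sup>2)"
proof -
  define X where "X = (\<Sum>a<N. (cmod (\<xi> a))\<^sup>2)"
  define H where "H = (\<Sum>b<N. (cmod (\<eta> b))\<^sup>2)"
  \<comment> \<open>For \<open>H = 0\<close> the quotient is 0 by convention; then
    \<open>v = 0\<close> and both operators vanish.\<close>
  define c where "c = sqrt X / sqrt H"
  have nonneg: "0 \<le> X" "0 \<le> H" unfolding X_def H_def by (intro sum_nonneg; simp)+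
  define u where "u = (\<Sum>a<N. \<xi> a *\<^sub>C unit_vec a)"
  define v where "v = (\<Sum>a<N. cnj (\<eta> a) *\<^sub>C unit_vec a)"
  define T where "T = fin_op N (\<lambda>a b. \<xi> a * \<eta> b)"
  define P where "P = fin_op N (\<lambda>a b. of_real c * cnj (\<eta> a) * \<eta> b)"
  have s: "(\<Sum>b<N. \<eta> b * ell2_nth x b) = cinner x v" for x
    unfolding v_def cinner_sum_right cinner_scaleC_right cinner_unit_vec by simp
  have T: "T x = cinner x v *\<^sub>C u" for x
    by (rule ell2_eqI) (simp add: T_def ell2_nth_fin_op u_def ell2_nth_scaleC ell2_nth_fin_sum s[symmetric]
        sum_distrib_left mult_ac)
  have P: "P x = (of_real c * cinner x v) *\<^sub>C v" for x
    by (rule ell2_eqI) (simp add: P_def ell2_nth_fin_op ell2_nth_scaleC ell2_nth_fin_sum[where f = "\<lambda>a. cnj (\<eta> a)" and N = N, folded v_def]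
        s[symmetric] sum_distrib_left sum_distrib_right mult_ac)
  have vv: "cinner v v = of_real H"
    unfolding s[symmetric] by (simp add: v_def ell2_nth_fin_sum H_def complex_norm_square[symmetric])
  have uu: "cinner u u = of_real X"
    by (subst (2) u_def, unfold cinner_sum_right cinner_scaleC_right cinner_unit_vec)
      (simp add: u_def ell2_nth_fin_sum X_def complex_norm_square[symmetric] mult.commute)
  have "abs_op T = P"
  proof (rule abs_op_eqI)
    show "complex_linear T" unfolding T_def by (rule complex_linear_fin_op)
    have Px: "cinner (P x) x = of_real (c * (cmod (cinner x v))\<^sup>2)" for x
      unfolding P cinner_scaleC_left cinner_commute[of v x] 
      by (simp add: complex_norm_square[symmetric] mult.assoc)
    show "positive_op P"
      unfolding positive_op_def
      by (auto simp: P_def complex_linear_fin_op) (unfold P_def[symmetric] Px, simp_all add: c_def nonneg)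
    fix x y
    have vy: "cinner v y = cnj (cinner y v)" by (rule cinner_commute)
    have *: "of_real c * (of_real c * of_real H) * (cinner x v * cnj (cinner y v)) = of_real X * (cinner x v * cnj (cinner y v))"
    proof (cases "H = 0")
      case True
      then have "v = 0" using vv by (simp add: cinner_self)
      then show ?thesis by simp
    next
      case False
      then have "c * (c * H) = X" using nonneg by (simp add: c_def)
      then show ?thesis by (metis of_real_mult)
    qed
    show "cinner (P (P x)) y = cinner (T x) (T y)"
      unfolding P T cinner_scaleC_left cinner_scaleC_right vv uu vy using * by (simp add: mult_ac)
  qed
  then have "trace_norm T = Re (\<Sum>a<N. of_real c * cnj (\<eta> a) * \<eta> a)"
    by (simp add: trace_norm_def P_def trace_op_fin_op)
  also have "\<dots> = c * H"
  proof -
    have eq: "of_real c * cnj (\<eta> a) * \<eta> a = of_real (c * (cmod (\<eta> a))\<^sup>2)" for a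
      using complex_norm_square[of "\<eta> a"] by (simp add: mult_ac)
    show ?thesis by (simp only: eq of_real_sum[symmetric] Re_complex_of_real H_def sum_distrib_left)
  qed
  also have "\<dots> = sqrt X * sqrt H"
    using nonneg by (cases "H = 0") (simp_all add: c_def real_div_sqrt field_simps)
  finally show ?thesis by (simp add: T_def X_def H_def)
qed

section \<open>Matrix-valued functions in the Bochner and Hardy spaces\<close>

lemma simple_function_fin_op:
  assumes "\<And>a b. a < N \<Longrightarrow> b < N \<Longrightarrow> simple_function M (\<lambda>t. m t a b)"
  shows "simple_function M (\<lambda>t. fin_op N (m t))"
proof -
  have "fin_op N (m t) = (\<Sum>p\<in>{..<N} \<times> {..<N}. fin_op N (\<lambda>i j. if (i, j) = p then m t (fst p) (snd p) else 0))" for t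
    unfolding fin_op_sum by (rule fin_op_eqI) (simp add: sum.delta)
  moreover have "simple_function M (\<lambda>t. fin_op N (\<lambda>i j. if (i, j) = p then m t (fst p) (snd p) else 0))"
    if "p \<in> {..<N} \<times> {..<N}" for p
    using simple_function_compose[OF assms[of "fst p" "snd p"], of "\<lambda>c. fin_op N (\<lambda>i j. if (i, j) = p then c else 0)"] that
    by (auto simp: comp_def)
  moreover have "finite Q \<Longrightarrow> (\<And>p. p \<in> Q \<Longrightarrow> simple_function M (\<lambda>t. g p t)) \<Longrightarrow> simple_function M (\<lambda>t. \<Sum>p\<in>Q. g p t)"
    for Q and g :: "nat \<times> nat \<Rightarrow> 'a \<Rightarrow> ell2_op"
    by (induction Q rule: finite_induct) (auto intro: simple_function_compose2[where h = "(+)"])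
  ultimately show ?thesis by simp
qed

text \<open>Simple approximations of the entries suffice, because for fixed \<open>N\<close> the
  trace norm is controlled by the entries.\<close>

lemma strongly_measurable_fin_op:
  assumes "\<And>a b. a < N \<Longrightarrow> b < N \<Longrightarrow> (\<lambda>t. m t a b) \<in> borel_measurable lborel"
  shows "strongly_measurable_trace (\<lambda>t. fin_op N (m t))"
proof -
  have "\<exists>u. (\<forall>i. simple_function lborel (u i)) \<and> (\<forall>t. (\<lambda>i. u i t) \<longlonglongrightarrow> m t a b)" if "a < N" "b < N" for a b
    using borel_measurable_implies_sequence_metric[OF assms[OF that], of 0] by auto
  then obtain u where u: "\<And>a b i. a < N \<Longrightarrow> b < N \<Longrightarrow> simple_function lborel (u a b i)"
    "\<And>a b t. a < N \<Longrightarrow> b < N \<Longrightarrow> (\<lambda>i. u a b i t) \<longlonglongrightarrow> m t a b"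
    by metis
  show ?thesis
    unfolding strongly_measurable_trace_def
  proof (intro exI[of _ "\<lambda>i t. fin_op N (\<lambda>a b. u a b i t)"] conjI allI)
    show "simple_function lborel (\<lambda>t. fin_op N (\<lambda>a b. u a b i t))" for i
      by (intro simple_function_fin_op) (simp add: u(1))
    show "range (\<lambda>t. fin_op N (\<lambda>a b. u a b i t)) \<subseteq> trace_class" for i
      by (auto simp: fin_op_trace_class)
    fix t
    show "(\<lambda>i. trace_norm (fin_op N (\<lambda>a b. u a b i t) - fin_op N (m t))) \<longlonglongrightarrow> 0"
    proof (rule tendsto_sandwich[OF _ _ tendsto_const])
      show "\<forall>\<^sub>F i in sequentially. 0 \<le> trace_norm (fin_op N (\<lambda>a b. u a b i t) - fin_op N (m t))"
        by (simp add: fin_op_diff trace_norm_nonneg fin_op_trace_class)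
      show "\<forall>\<^sub>F i in sequentially. trace_norm (fin_op N (\<lambda>a b. u a b i t) - fin_op N (m t))
          \<le> (\<Sum>b<N. \<Sum>a<N. cmod (u a b i t - m t a b))"
        by (simp add: fin_op_diff trace_norm_fin_op_le)
      have "(\<lambda>i. \<Sum>b<N. \<Sum>a<N. cmod (u a b i t - m t a b)) \<longlonglongrightarrow> (\<Sum>b<N. \<Sum>a<N. cmod (m t a b - m t a b))"
        by (intro tendsto_intros u) auto
      then show "(\<lambda>i. \<Sum>b<N. \<Sum>a<N. cmod (u a b i t - m t a b)) \<longlonglongrightarrow> 0" by simp
    qed
  qed
qed

lemma div_mod_less: "i < N * N \<Longrightarrow> i div N < N \<and> i mod N < (N::nat)"
  by (cases "N = 0") (simp_all add: less_mult_imp_div_less)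

text \<open>Tensors and cost series carry a single index, so the matrix cell \<open>(a, b)\<close>
  is coded as \<open>a * N + b\<close>.\<close>

lemma sum_div_mod: "(\<Sum>i<N * N. g (i div N) (i mod N)) = (\<Sum>a<N. \<Sum>b<(N::nat). g a b)"
proof -
  have "a * N + b < N * N" if "a < N" "b < N" for a b
    using mult_le_mono1[of "Suc a" N N] that by simp
  then have "(\<Sum>i<N * N. g (i div N) (i mod N)) = (\<Sum>p\<in>{..<N} \<times> {..<N}. g (fst p) (snd p))"
    by (intro sum.reindex_bij_witness[of _ "\<lambda>(a, b). a * N + b" "\<lambda>i. (i div N, i mod N)"])
      (auto dest: div_mod_less)
  then show ?thesis by (simp add: sum.cartesian_product case_prod_unfold)
qed

text \<open>The pointwise factorization gives the exact trace norm, and the entries times matrix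
  units exhibit the function as a finite tensor. Being a tensor, it approximates itself with error
  0.\<close>

lemma fin_op_H1_trace:
  assumes m: "\<And>t a b. a < N \<Longrightarrow> b < N \<Longrightarrow> m t a b = \<xi> t a * \<eta> t b"
    and H1: "\<And>a b. a < N \<Longrightarrow> b < N \<Longrightarrow> (\<lambda>t. m t a b) \<in> H1"
    and int: "integrable lborel (\<lambda>t. sqrt (\<Sum>a<N. (cmod (\<xi> t a))\<^sup>2) * sqrt (\<Sum>b<N. (cmod (\<eta> t b))\<^sup>2))"
  shows "(\<lambda>t. fin_op N (m t)) \<in> H1_trace"
    "L1_trace_norm (\<lambda>t. fin_op N (m t))
      = (LINT t|lborel. sqrt (\<Sum>a<N. (cmod (\<xi> t a))\<^sup>2) * sqrt (\<Sum>b<N. (cmod (\<eta> t b))\<^sup>2))"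
proof -
  have eq: "fin_op N (m t) = fin_op N (\<lambda>a b. \<xi> t a * \<eta> t b)" for t
    by (rule fin_op_eqI) (rule m)
  have tn: "trace_norm (fin_op N (m t)) = sqrt (\<Sum>a<N. (cmod (\<xi> t a))\<^sup>2) * sqrt (\<Sum>b<N. (cmod (\<eta> t b))\<^sup>2)" for t
    unfolding eq by (rule trace_norm_rank_one)
  show "L1_trace_norm (\<lambda>t. fin_op N (m t))
      = (LINT t|lborel. sqrt (\<Sum>a<N. (cmod (\<xi> t a))\<^sup>2) * sqrt (\<Sum>b<N. (cmod (\<eta> t b))\<^sup>2))"
    by (simp add: L1_trace_norm_def tn)
  have "(\<lambda>t. fin_op N (m t)) \<in> L1_trace"
    unfolding L1_trace_def
    using H1 by (auto simp: fin_op_trace_class tn int H1_def intro!: strongly_measurable_fin_op borel_measurable_integrable)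
  moreover have "(\<lambda>t. fin_op N (m t)) \<in> H1_tensor_trace"
  proof -
    define E where "E i = fin_op N (\<lambda>a b. if (a, b) = (i div N, i mod N) then 1 else 0)" for i
    define A where "A i = (\<lambda>t. m t (i div N) (i mod N))" for i
    have "blinfun_apply (fin_op N (m t)) x = (\<Sum>i<N * N. A i t *\<^sub>C blinfun_apply (E i) x)" for t x
    proof (rule ell2_eqI)
      fix k
      have cell: "ell2_nth (fin_op N (\<lambda>i j. if (i, j) = (a, b) then 1 else 0) x) k = (if k = a then ell2_nth x b else 0)"
        if "a < N" "b < N" for a b
        using that by (simp add: ell2_nth_fin_op if_distrib[of "\<lambda>c. c * _"] cong: if_cong)
      have "(\<Sum>i<N * N. A i t * ell2_nth (E i x) k)
        = (\<Sum>a<N. \<Sum>b<N. m t a b * ell2_nth (fin_op N (\<lambda>i j. if (i, j) = (a, b) then 1 else 0) x) k)"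
        unfolding A_def E_def by (rule sum_div_mod)
      also have "\<dots> = (\<Sum>a<N. \<Sum>b<N. m t a b * (if k = a then ell2_nth x b else 0))"
        by (intro sum.cong refl arg_cong2[where f = "(*)"] cell) auto
      also have "\<dots> = (\<Sum>a<N. if a = k then \<Sum>b<N. m t a b * ell2_nth x b else 0)"
        by (intro sum.cong refl) simp
      also have "\<dots> = ell2_nth (fin_op N (m t) x) k"
        by (simp add: ell2_nth_fin_op)
      finally show "ell2_nth (fin_op N (m t) x) k = ell2_nth (\<Sum>i<N * N. A i t *\<^sub>C E i x) k"
        by (simp add: ell2_nth_simps)
    qed
    moreover have "A i \<in> H1 \<and> E i \<in> trace_class" if "i < N * N" for i
      using H1 div_mod_less[OF that] by (auto simp: A_def E_def fin_op_trace_class)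
    ultimately show ?thesis unfolding H1_tensor_trace_def by blast
  qed
  moreover have "trace_norm (0::ell2_op) = 0"
    using trace_norm_rank_one[of 0 "\<lambda>_. 0" "\<lambda>_. 0"] by (simp add: fin_op_zero)
  then have "L1_trace_norm (\<lambda>t. fin_op N (m t) - fin_op N (m t)) = 0"
    by (simp add: L1_trace_norm_def)
  ultimately show "(\<lambda>t. fin_op N (m t)) \<in> H1_trace"
    unfolding H1_trace_def by force
qed

section \<open>Convolution on the line\<close>

text \<open>In contrast to \<open>conv\<close>, the first factor is a plain function, so that
  integrable kernels can be convolved with one another.\<close>

definition cv :: "(real \<Rightarrow> complex) \<Rightarrow> (real \<Rightarrow> complex) \<Rightarrow> real \<Rightarrow> complex"
  where "cv f g x = (LINT y|lborel. f y * g (x - y))"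

lemma integrable_reflect:
  fixes g :: "real \<Rightarrow> complex"
  assumes "integrable lborel g"
  shows "integrable lborel (\<lambda>y. g (x - y))"
  using lborel_integrable_real_affine[OF assms, of "-1" x] by simp

lemma integrable_translate:
  fixes g :: "real \<Rightarrow> complex"
  assumes "integrable lborel g"
  shows "integrable lborel (\<lambda>x. g (x - y))"
  using lborel_integrable_real_affine[OF assms, of 1 "-y"] by simp

lemma integrable_tensor:
  fixes f g :: "real \<Rightarrow> complex"
  assumes f: "integrable lborel f" and g: "integrable lborel g"
  shows "integrable (lborel \<Otimes>\<^sub>M lborel) (\<lambda>(x, y). f x * g y)"
proof (rule lborel_pair.Fubini_integrable)
  note [measurable] = borel_measurable_integrable[OF f] borel_measurable_integrable[OF g]
  show "(\<lambda>(x, y). f x * g y) \<in> borel_measurable (lborel \<Otimes>\<^sub>M lborel)" by measurable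
  show "integrable lborel (\<lambda>x. LINT y|lborel. norm (case (x, y) of (x, y) \<Rightarrow> f x * g y))"
    using f by (simp add: norm_mult)
  show "AE x in lborel. integrable lborel (\<lambda>y. case (x, y) of (x, y) \<Rightarrow> f x * g y)"
    using g by simp
qed

lemma integrable_cv_pair:
  fixes f g :: "real \<Rightarrow> complex"
  assumes f: "integrable lborel f" and g: "integrable lborel g"
  shows "integrable (lborel \<Otimes>\<^sub>M lborel) (\<lambda>(x, y). f y * g (x - y))"
proof -
  note [measurable] = borel_measurable_integrable[OF f] borel_measurable_integrable[OF g]
  have "integrable (lborel \<Otimes>\<^sub>M lborel) (\<lambda>(y, x). f y * g (x - y))"
  proof (rule lborel_pair.Fubini_integrable)
    show "(\<lambda>(y, x). f y * g (x - y)) \<in> borel_measurable (lborel \<Otimes>\<^sub>M lborel)" by measurable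
    have "(LINT x|lborel. norm (g (x - y))) = (LINT x|lborel. norm (g x))" for y
      using lborel_integral_real_affine[of 1 "\<lambda>x. norm (g x)" "-y"] by simp
    then show "integrable lborel (\<lambda>y. LINT x|lborel. norm (case (y, x) of (y, x) \<Rightarrow> f y * g (x - y)))"
      using f by (simp add: norm_mult)
    show "AE y in lborel. integrable lborel (\<lambda>x. case (y, x) of (y, x) \<Rightarrow> f y * g (x - y))"
      using integrable_translate[OF g] by simp
  qed
  from lborel_pair.integrable_product_swap[OF this] show ?thesis
    by (simp add: case_prod_unfold)
qed

lemma integrable_cv:
  assumes f: "integrable lborel f" and g: "integrable lborel g"
  shows "integrable lborel (cv f g)"
  using lborel_pair.integrable_fst'[OF integrable_cv_pair[OF assms]] by (simp add: cv_def[abs_def])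

lemma L1_norm_cv_le:
  assumes f: "integrable lborel f" and g: "integrable lborel g"
  shows "(LINT x|lborel. norm (cv f g x)) \<le> (LINT x|lborel. norm (f x)) * (LINT x|lborel. norm (g x))"
proof -
  note [measurable] = borel_measurable_integrable[OF f] borel_measurable_integrable[OF g]
  have int: "integrable (lborel \<Otimes>\<^sub>M lborel) (\<lambda>(x, y). norm (f y * g (x - y)))"
    using integrable_norm[OF integrable_cv_pair[OF assms]] by (simp add: case_prod_unfold)
  have "(LINT x|lborel. norm (cv f g x)) \<le> (LINT x|lborel. LINT y|lborel. norm (f y * g (x - y)))"
  proof (rule integral_mono)
    show "integrable lborel (\<lambda>x. norm (cv f g x))" using integrable_cv[OF assms] by simp
    show "integrable lborel (\<lambda>x. LINT y|lborel. norm (f y * g (x - y)))"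
      using lborel_pair.integrable_fst'[OF int] by simp
    show "norm (cv f g x) \<le> (LINT y|lborel. norm (f y * g (x - y)))" for x
      unfolding cv_def by (rule integral_norm_bound)
  qed
  also have "\<dots> = (LINT y|lborel. LINT x|lborel. norm (f y * g (x - y)))"
    using lborel_pair.Fubini_integral[OF int] by simp
  also have "\<dots> = (LINT y|lborel. norm (f y) * (LINT x|lborel. norm (g x)))"
  proof -
    have "(LINT x|lborel. norm (g (x - y))) = (LINT x|lborel. norm (g x))" for y
      using lborel_integral_real_affine[of 1 "\<lambda>x. norm (g x)" "-y"] by simp
    then show ?thesis by (simp add: norm_mult)
  qed
  finally show ?thesis by simp
qed

text \<open>Boundedness of the middle factor makes the double integral absolutely convergent at
  every \<open>x\<close>, so the identity holds everywhere and not just almost everywhere.\<close>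

lemma cv_assoc:
  assumes f: "integrable lborel f" and h: "integrable lborel h"
    and g[measurable]: "g \<in> borel_measurable lborel" and bd: "\<And>x. norm (g x) \<le> B"
  shows "cv (cv f g) h x = cv f (cv g h) x"
proof -
  note [measurable] = borel_measurable_integrable[OF f] borel_measurable_integrable[OF h]
  have int: "integrable (lborel \<Otimes>\<^sub>M lborel) (\<lambda>(r, p). f r * g (p - r) * h (x - p))"
  proof (rule Bochner_Integration.integrable_bound)
    show "integrable (lborel \<Otimes>\<^sub>M lborel) (\<lambda>q. of_real B * (case q of (r, p) \<Rightarrow> f r * h (x - p)))"
      by (intro integrable_mult_right integrable_tensor f integrable_reflect h)
    have "norm (f r * g (p - r) * h (x - p)) \<le> norm (of_real B * (f r * h (x - p)))" for r p
      using mult_right_mono[OF order_trans[OF bd[of "p - r"] abs_ge_self], of "norm (f r) * norm (h (x - p))"]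
      by (simp add: norm_mult mult_ac)
    then show "AE q in lborel \<Otimes>\<^sub>M lborel. norm (case q of (r, p) \<Rightarrow> f r * g (p - r) * h (x - p))
        \<le> norm (of_real B * (case q of (r, p) \<Rightarrow> f r * h (x - p)))"
      by (intro AE_I2) (auto split: prod.splits)
  qed simp
  have "cv (cv f g) h x = (LINT p|lborel. LINT r|lborel. f r * g (p - r) * h (x - p))"
    unfolding cv_def by simp
  also have "\<dots> = (LINT r|lborel. LINT p|lborel. f r * g (p - r) * h (x - p))"
    using lborel_pair.Fubini_integral[OF int] by simp
  also have "\<dots> = (LINT r|lborel. f r * (LINT p|lborel. g (p - r) * h (x - p)))"
    by (simp add: mult.assoc)
  also have "\<dots> = cv f (cv g h) x"
  proof -
    have "(LINT p|lborel. g (p - r) * h (x - p)) = cv g h (x - r)" for r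
      unfolding cv_def
      using lborel_integral_real_affine[of 1 "\<lambda>p. g (p - r) * h (x - p)" r] by (simp add: algebra_simps)
    then show ?thesis by (simp add: cv_def)
  qed
  finally show ?thesis .
qed

section \<open>The Fejer kernel\<close>

text \<open>The Fejer kernel of the line, whose Fourier transform is a multiple of the triangle on
  [-1, 1]. It is a nonnegative integrable window that spreads a frequency by at most 1.\<close>

definition fejer :: "real \<Rightarrow> real" where "fejer s = (sinc (s / 2))\<^sup>2"

lemma continuous_on_fejer: "continuous_on S fejer"
  unfolding fejer_def by (intro continuous_intros continuous_on_sinc) auto

lemma fejer_measurable [measurable]: "fejer \<in> borel_measurable borel"
  by (rule borel_measurable_continuous_onI[OF continuous_on_fejer])

lemma fejer_nonneg: "0 \<le> fejer s"
  by (simp add: fejer_def)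

lemma fejer_eq: "s \<noteq> 0 \<Longrightarrow> fejer s = 2 * (1 - cos s) / s\<^sup>2"
  using cos_double_sin[of "s / 2"] by (simp add: fejer_def power_divide)

lemma fejer_minus: "fejer (- s) = fejer s"
  using sinc_neg[of "s / 2"] by (simp only: fejer_def minus_divide_left)

lemma fejer_le: "fejer s \<le> 1" "(1 + s\<^sup>2) * fejer s \<le> 5"
proof -
  show 1: "fejer s \<le> 1"
  proof (cases "s = 0")
    case False
    have "\<bar>sin (s / 2)\<bar> \<le> \<bar>s / 2\<bar>" by (rule abs_sin_x_le_abs_x)
    then have "\<bar>sinc (s / 2)\<bar> \<le> 1" using False by simp
    then show ?thesis unfolding fejer_def by (simp add: abs_square_le_1)
  qed (simp add: fejer_def)
  have "s\<^sup>2 * fejer s \<le> 4"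
  proof (cases "s = 0")
    case False
    have "s\<^sup>2 * fejer s = 2 * (1 - cos s)" using False by (simp add: fejer_eq)
    show ?thesis unfolding \<open>s\<^sup>2 * fejer s = 2 * (1 - cos s)\<close> using cos_ge_minus_one[of s] by argo
  qed simp
  then show "(1 + s\<^sup>2) * fejer s \<le> 5" using 1 by (simp add: algebra_simps)
qed

lemma integrable_fejer: "integrable lborel fejer"
proof (rule Bochner_Integration.integrable_bound)
  have "einterval (-\<infinity>) \<infinity> = (UNIV :: real set)" by (auto simp: einterval_def)
  then have "integrable lborel (\<lambda>x. inverse (1 + x\<^sup>2) :: real)"
    using integrable_inverse_1_plus_square by (simp add: set_integrable_def)
  then show "integrable lborel (\<lambda>x. 5 * inverse (1 + x\<^sup>2) :: real)" by simp
  have "norm (fejer x) \<le> norm (5 * inverse (1 + x\<^sup>2))" for x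
  proof -
    have "0 < 1 + x\<^sup>2" by (rule add_pos_nonneg) auto
    then show ?thesis
      using fejer_le(2)[of x] fejer_nonneg[of x] by (simp add: divide_simps mult.commute abs_mult)
  qed
  then show "AE x in lborel. norm (fejer x) \<le> norm (5 * inverse (1 + x\<^sup>2))" by simp
qed simp

definition fejer_mass :: real where "fejer_mass = (LINT s|lborel. fejer s)"

lemma fejer_scale:
  "integrable lborel (\<lambda>s. (1 - cos (a * s)) / s\<^sup>2)"
  "(LINT s|lborel. (1 - cos (a * s)) / s\<^sup>2) = \<bar>a\<bar> / 2 * fejer_mass"
proof -
  have "integrable lborel (\<lambda>s. (1 - cos (a * s)) / s\<^sup>2) \<and>
    (LINT s|lborel. (1 - cos (a * s)) / s\<^sup>2) = \<bar>a\<bar> / 2 * fejer_mass"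
  proof (cases "a = 0")
    case False
    have ae: "AE s in lborel. a\<^sup>2 / 2 * fejer (a * s) = (1 - cos (a * s)) / s\<^sup>2"
      using AE_lborel_singleton[of 0] by eventually_elim (use False in \<open>simp add: fejer_eq power_mult_distrib field_simps\<close>)
    have i: "integrable lborel (\<lambda>s. fejer (a * s))"
      using lborel_integrable_real_affine[OF integrable_fejer, of a 0] False by simp
    have "fejer_mass = \<bar>a\<bar> * (LINT s|lborel. fejer (a * s))"
      unfolding fejer_mass_def using lborel_integral_real_affine[of a fejer 0] False by simp
    then have "(LINT s|lborel. a\<^sup>2 / 2 * fejer (a * s)) = \<bar>a\<bar> / 2 * fejer_mass"
    proof -
      have "a\<^sup>2 / 2 * x = \<bar>a\<bar> / 2 * (\<bar>a\<bar> * x)" for x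
        by (simp add: power2_eq_square mult.assoc[symmetric])
      then show ?thesis
        unfolding \<open>fejer_mass = \<bar>a\<bar> * (LINT s|lborel. fejer (a * s))\<close> integral_mult_right_zero .
    qed
    then show ?thesis
      using ae i integrable_cong_AE[OF _ _ ae] integral_cong_AE[OF _ _ ae] by (auto simp del: integral_mult_right)
  qed simp
  then show "integrable lborel (\<lambda>s. (1 - cos (a * s)) / s\<^sup>2)"
    "(LINT s|lborel. (1 - cos (a * s)) / s\<^sup>2) = \<bar>a\<bar> / 2 * fejer_mass" by auto
qed

lemma integrable_fejer_cis: "integrable lborel (\<lambda>s. of_real (fejer s) * cis (v * s))"
proof (rule Bochner_Integration.integrable_bound)
  show "integrable lborel fejer" by (rule integrable_fejer)
  show "(\<lambda>s. of_real (fejer s) * cis (v * s)) \<in> borel_measurable lborel"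
    by (simp, intro borel_measurable_continuous_onI continuous_intros continuous_on_fejer)
qed (auto simp: norm_mult)

text \<open>Only the scaling of the integral of \<open>(1 - cos s) / s\<^sup>2\<close> enters, not its value.\<close>

lemma fejer_fourier_zero:
  assumes v: "1 \<le> \<bar>v\<bar>"
  shows "(LINT s|lborel. of_real (fejer s) * cis (v * s)) = 0"
proof -
  define I where "I = (LINT s|lborel. of_real (fejer s) * cis (v * s))"
  have "Re I = (LINT s|lborel. fejer s * cos (v * s))"
    unfolding I_def by (subst integral_Re[symmetric, OF integrable_fejer_cis]) simp
  also have "\<dots> = (LINT s|lborel. (1 - cos ((v + 1) * s)) / s\<^sup>2 + (1 - cos ((v - 1) * s)) / s\<^sup>2 - 2 * ((1 - cos (v * s)) / s\<^sup>2))"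
  proof (rule integral_cong_AE)
    show "AE s in lborel. fejer s * cos (v * s) = (1 - cos ((v + 1) * s)) / s\<^sup>2 + (1 - cos ((v - 1) * s)) / s\<^sup>2 - 2 * ((1 - cos (v * s)) / s\<^sup>2)"
      using AE_lborel_singleton[of 0]
    proof eventually_elim
      case (elim s)
      have "cos ((v + 1) * s) + cos ((v - 1) * s) = 2 * cos (v * s) * cos s"
        by (simp add: distrib_right left_diff_distrib cos_add cos_diff)
      then have "2 * (1 - cos s) * cos (v * s) = (1 - cos ((v + 1) * s)) + (1 - cos ((v - 1) * s)) - 2 * (1 - cos (v * s))"
        by (simp add: algebra_simps)
      then have "2 * (1 - cos s) * cos (v * s) / s\<^sup>2 = ((1 - cos ((v + 1) * s)) + (1 - cos ((v - 1) * s)) - 2 * (1 - cos (v * s))) / s\<^sup>2"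
        by simp
      moreover have "fejer s * cos (v * s) = 2 * (1 - cos s) * cos (v * s) / s\<^sup>2"
        using elim by (simp add: fejer_eq)
      moreover have "(A + B - 2 * C) / s\<^sup>2 = A / s\<^sup>2 + B / s\<^sup>2 - 2 * (C / s\<^sup>2)" for A B C :: real
        by (simp add: add_divide_distrib diff_divide_distrib)
      ultimately show ?case by (simp only:)
    qed
  qed measurable
  \<comment> \<open>By scaling, each integral is proportional to the modulus of its frequency. What
    remains is a second difference of the modulus, which is 0 unless 0 lies strictly between
    \<open>v - 1\<close> and \<open>v + 1\<close>.\<close>
  also have "\<dots> = (\<bar>v + 1\<bar> + \<bar>v - 1\<bar> - 2 * \<bar>v\<bar>) / 2 * fejer_mass"
  proof -
    define D where "D a s = (1 - cos (a * s)) / s\<^sup>2" for a s :: real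
    have D: "integrable lborel (D a)" "(LINT s|lborel. D a s) = \<bar>a\<bar> / 2 * fejer_mass" for a
      using fejer_scale[of a] by (simp_all add: D_def[abs_def])
    show ?thesis
      unfolding D_def[symmetric] by (simp add: D algebra_simps)
  qed
  also have "\<dots> = 0" using v by (auto simp: abs_if)
  finally have re: "Re I = 0" .
  have "Im I = (LINT s|lborel. fejer s * sin (v * s))"
    unfolding I_def by (subst integral_Im[symmetric, OF integrable_fejer_cis]) simp
  moreover have "(LINT s|lborel. fejer s * sin (v * s)) = - (LINT s|lborel. fejer s * sin (v * s))"
    using lborel_integral_real_affine[of "-1" "\<lambda>s. fejer s * sin (v * s)" 0] by (simp add: fejer_minus)
  ultimately have "Im I = 0" by simp
  then show ?thesis using re by (simp add: I_def complex_eq_iff)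
qed

text \<open>A superposition of characters weighted by the triangle: it expresses convolution with a
  modulated window through values of a Fourier transform.\<close>

lemma fejer_repr:
  "complex_of_real (fejer y) = (LINT u:{0..1}|lborel. of_real (1 - u) * (cis (u * y) + cis (- u * y)))"
proof -
  have cis: "cis (u * y) + cis (- u * y) = of_real (2 * cos (u * y))" for u
    by (simp add: complex_eq_iff)
  have "(LINT u:{0..1}|lborel. of_real (1 - u) * (cis (u * y) + cis (- u * y)))
      = complex_of_real (LINT u:{0..1}|lborel. (1 - u) * (2 * cos (u * y)))"
    unfolding cis of_real_mult[symmetric] by (rule set_integral_complex_of_real)
  also have "(LINT u:{0..1}|lborel. (1 - u) * (2 * cos (u * y))) = fejer y"
  proof (cases "y = 0")
    case True
    have "(\<integral>u. (2 * (1 - u)) * indicator {0..1} u \<partial>lborel) = (2 * 1 - 1\<^sup>2) - (2 * 0 - 0\<^sup>2 :: real)"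
      by (rule integral_FTC_Icc_real) (auto intro!: derivative_eq_intros continuous_intros)
    then show ?thesis using True by (simp add: fejer_def set_lebesgue_integral_def mult_ac)
  next
    case False
    let ?G = "\<lambda>u. 2 * (1 - u) * sin (u * y) / y - 2 * cos (u * y) / y\<^sup>2"
    have "(\<integral>u. ((1 - u) * (2 * cos (u * y))) * indicator {0..1} u \<partial>lborel) = ?G 1 - ?G 0"
      by (rule integral_FTC_Icc_real)
        (use False in \<open>auto intro!: derivative_eq_intros continuous_intros simp: field_simps power2_eq_square\<close>)
    then show ?thesis using False by (simp add: fejer_eq set_lebesgue_integral_def mult_ac diff_divide_distrib right_diff_distrib)
  qed
  finally show ?thesis by simp
qed

lemma cis_integral_eq_fourier:
  "(LINT y|lborel. cis (v * y) * h (t - y)) = cis (v * t) * fourier h v"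
proof -
  have "(LINT y|lborel. cis (v * y) * h (t - y)) = (LINT x|lborel. cis (v * (t - x)) * h x)"
    using lborel_integral_real_affine[of "-1" "\<lambda>y. cis (v * y) * h (t - y)" t] by simp
  also have "\<dots> = (LINT x|lborel. cis (v * t) * (h x * exp (- \<i> * of_real x * of_real v)))"
    by (intro Bochner_Integration.integral_cong refl)
      (simp add: cis_conv_exp exp_add[symmetric] algebra_simps exp_diff exp_minus divide_simps)
  finally show ?thesis by (simp add: fourier_def)
qed

text \<open>Inserting \<open>fejer_repr\<close> and exchanging the integrals leaves only
  \<open>fourier h\<close> at the points \<open>\<kappa> + u\<close> and \<open>\<kappa> - u\<close>
  with \<open>u\<close> in [0, 1].\<close>

lemma cv_fejer_eq_0:
  assumes h: "integrable lborel h" and z: "\<And>u. \<bar>u - \<kappa>\<bar> \<le> 1 \<Longrightarrow> fourier h u = 0"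
  shows "cv (\<lambda>y. of_real (fejer y) * cis (\<kappa> * y)) h t = 0"
proof -
  note [measurable] = borel_measurable_integrable[OF h]
  define G where "G u y = indicator {0..1} u *\<^sub>R (of_real (1 - u) * (cis ((\<kappa> + u) * y) + cis ((\<kappa> - u) * y)) * h (t - y))" for u y :: real
  have int: "integrable (lborel \<Otimes>\<^sub>M lborel) (\<lambda>(u, y). G u y)"
  proof (rule Bochner_Integration.integrable_bound)
    have "integrable lborel (\<lambda>u::real. complex_of_real (2 * indicator {0..1} u))"
      by (intro integrable_of_real integrable_mult_right) simp
    then show "integrable (lborel \<Otimes>\<^sub>M lborel) (\<lambda>(u::real, y). complex_of_real (2 * indicator {0..1} u) * h (t - y))"
      by (intro integrable_tensor integrable_reflect h)
    show "(\<lambda>(u, y). G u y) \<in> borel_measurable (lborel \<Otimes>\<^sub>M lborel)"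
      unfolding G_def cis_conv_exp by measurable
    have "norm (G u y) \<le> norm (complex_of_real (2 * indicator {0..1} u) * h (t - y))" for u y
    proof (cases "u \<in> {0..1}")
      case True
      have "norm (G u y) = (1 - u) * norm (cis ((\<kappa> + u) * y) + cis ((\<kappa> - u) * y)) * norm (h (t - y))"
        using True by (simp add: G_def norm_mult del: of_real_diff)
      also have "\<dots> \<le> 1 * (1 + 1) * norm (h (t - y))"
        using True norm_triangle_ineq[of "cis ((\<kappa> + u) * y)" "cis ((\<kappa> - u) * y)"]
        by (intro mult_right_mono mult_mono) auto
      finally show ?thesis using True by (simp add: norm_mult)
    qed (simp add: G_def)
    then show "AE q in lborel \<Otimes>\<^sub>M lborel. norm (case q of (u, y) \<Rightarrow> G u y)
        \<le> norm (case q of (u, y) \<Rightarrow> complex_of_real (2 * indicator {0..1} u) * h (t - y))"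
      by (intro AE_I2) (auto split: prod.splits)
  qed
  have "cv (\<lambda>y. of_real (fejer y) * cis (\<kappa> * y)) h t = (LINT y|lborel. LINT u|lborel. G u y)"
  proof -
    have "of_real (fejer y) * cis (\<kappa> * y) * h (t - y) = (LINT u|lborel. G u y)" for y
    proof -
      have "of_real (fejer y) * cis (\<kappa> * y) * h (t - y)
        = (LINT u|lborel. (indicator {0..1} u *\<^sub>R (of_real (1 - u) * (cis (u * y) + cis (- u * y)))) * (cis (\<kappa> * y) * h (t - y)))"
        unfolding fejer_repr set_lebesgue_integral_def mult.assoc by (rule integral_mult_left_zero[symmetric])
      also have "\<dots> = (LINT u|lborel. G u y)"
      proof (intro Bochner_Integration.integral_cong refl)
        fix u :: real
        have "cis ((\<kappa> + u) * y) = cis (\<kappa> * y) * cis (u * y)" "cis ((\<kappa> - u) * y) = cis (\<kappa> * y) * cis (- u * y)"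
          by (simp_all add: cis_mult algebra_simps)
        then show "indicator {0..1} u *\<^sub>R (of_real (1 - u) * (cis (u * y) + cis (- u * y))) * (cis (\<kappa> * y) * h (t - y)) = G u y"
          unfolding G_def by (simp only: distrib_left[symmetric] scaleR_conv_of_real mult_ac)
      qed
      finally show ?thesis .
    qed
    then show ?thesis by (simp add: cv_def)
  qed
  also have "\<dots> = (LINT u|lborel. LINT y|lborel. G u y)"
    by (rule lborel_pair.Fubini_integral[OF int])
  also have "\<dots> = (LINT u|(lborel::real measure). 0)"
  proof (intro Bochner_Integration.integral_cong refl)
    fix u :: real
    have ci: "integrable lborel (\<lambda>y. cis (v * y) * h (t - y))" for v
    proof (rule Bochner_Integration.integrable_bound[OF integrable_reflect[OF h, of t]])
      show "(\<lambda>y. cis (v * y) * h (t - y)) \<in> borel_measurable lborel"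
        unfolding cis_conv_exp by measurable
    qed (auto simp: norm_mult)
    show "(LINT y|lborel. G u y) = 0"
    proof (cases "u \<in> {0..1}")
      case True
      have "(LINT y|lborel. G u y) = (LINT y|lborel. of_real (1 - u) * (cis ((\<kappa> + u) * y) * h (t - y) + cis ((\<kappa> - u) * y) * h (t - y)))"
        using True by (intro Bochner_Integration.integral_cong refl) (simp add: G_def algebra_simps)
      also have "\<dots> = of_real (1 - u) * ((LINT y|lborel. cis ((\<kappa> + u) * y) * h (t - y)) + (LINT y|lborel. cis ((\<kappa> - u) * y) * h (t - y)))"
        using ci by (simp del: of_real_diff)
      also have "\<dots> = 0"
        unfolding cis_integral_eq_fourier using True by (simp add: z)
      finally show ?thesis .
    qed (simp add: G_def)
  qed
  finally show ?thesis by simp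
qed

section \<open>Riesz products\<close>

text \<open>Ratio 4 makes each frequency exceed three times the sum of the earlier ones, so the
  signed sums in a Riesz product do not collide. Starting at 4 makes them multiples of 4, farther
  apart than two windows of radius 1.\<close>

definition lam :: "nat \<Rightarrow> real" where "lam n = 4 ^ Suc n"

definition lsum :: "nat \<Rightarrow> real" where "lsum n = (\<Sum>m<n. lam m)"

lemma lam_eq_lsum: "lam n = 3 * lsum n + 4"
  by (induction n) (simp_all add: lam_def lsum_def)

lemma lsum_Suc: "lsum (Suc n) = lsum n + lam n"
  by (simp add: lsum_def)

lemma lsum_nonneg: "0 \<le> lsum n"
  by (simp add: lsum_def lam_def sum_nonneg)

lemma lam_pos: "4 \<le> lam n"
  using lam_eq_lsum[of n] lsum_nonneg[of n] by simp

definition riesz :: "nat \<Rightarrow> (nat \<Rightarrow> complex) \<Rightarrow> real \<Rightarrow> real"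
  where "riesz n z t = (\<Prod>m<n. 1 + Re (z m * cis (lam m * t)))"

text \<open>The window makes the product integrable; the modulation by \<open>\<kappa>\<close> makes
  the family closed under splitting off the last factor.\<close>

definition rk :: "nat \<Rightarrow> (nat \<Rightarrow> complex) \<Rightarrow> real \<Rightarrow> real \<Rightarrow> complex"
  where "rk n z \<kappa> t = of_real (fejer t * riesz n z t) * cis (\<kappa> * t)"

lemma rk_0: "rk 0 z \<kappa> = (\<lambda>t. of_real (fejer t) * cis (\<kappa> * t))"
  by (rule ext) (simp add: rk_def riesz_def)

text \<open>A real part is half the sum of a number and its conjugate, so the last factor merely
  shifts \<open>\<kappa>\<close> both ways. The inductions over the number of factors rest on this
  identity.\<close>

lemma rk_Suc:
  "rk (Suc n) z \<kappa> t = rk n z \<kappa> t + z n / 2 * rk n z (\<kappa> + lam n) t + cnj (z n) / 2 * rk n z (\<kappa> - lam n) t"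
proof -
  have re: "complex_of_real (Re u) = (u + cnj u) / 2" for u by (simp add: complex_eq_iff)
  have c: "cis ((\<kappa> + lam n) * t) = cis (\<kappa> * t) * cis (lam n * t)"
    "cis ((\<kappa> - lam n) * t) = cis (\<kappa> * t) * cnj (cis (lam n * t))"
    by (simp_all add: cis_mult cis_cnj algebra_simps)
  define u where "u = z n * cis (lam n * t)"
  have R: "riesz (Suc n) z t = riesz n z t * (1 + Re u)" by (simp add: riesz_def u_def)
  have "rk (Suc n) z \<kappa> t = of_real (fejer t * riesz n z t) * cis (\<kappa> * t) * (1 + (u + cnj u) / 2)"
    unfolding rk_def R by (simp only: of_real_mult of_real_add of_real_1 re mult_ac)
  then show ?thesis
    unfolding rk_def c u_def complex_cnj_mult by (simp only: distrib_left distrib_right add_divide_distrib mult_1_right times_divide_eq_right times_divide_eq_left mult_ac)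
      (simp only: add.assoc mult_1)
qed

lemma rk_cong:
  assumes "\<And>m. m < n \<Longrightarrow> z m = z' m"
  shows "rk n z \<kappa> = rk n z' \<kappa>"
proof -
  have "riesz n z t = riesz n z' t" for t
    unfolding riesz_def by (intro prod.cong refl) (simp add: assms)
  then show ?thesis by (intro ext) (simp add: rk_def)
qed

lemma continuous_on_rk: "continuous_on S (rk n z \<kappa>)"
  unfolding rk_def[abs_def] riesz_def
  by (intro continuous_intros continuous_on_fejer)

lemma rk_measurable [measurable]: "rk n z \<kappa> \<in> borel_measurable borel"
  by (rule borel_measurable_continuous_onI[OF continuous_on_rk])

lemma norm_rk_le: "norm (rk n z \<kappa> t) \<le> (\<Prod>m<n. 1 + cmod (z m)) * fejer t"
proof -
  have "\<bar>riesz n z t\<bar> \<le> (\<Prod>m<n. 1 + cmod (z m))"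
    unfolding riesz_def abs_prod
  proof (intro prod_mono conjI)
    fix m
    have "\<bar>Re (z m * cis (lam m * t))\<bar> \<le> cmod (z m)"
      using abs_Re_le_cmod[of "z m * cis (lam m * t)"] by (simp add: norm_mult)
    then show "\<bar>1 + Re (z m * cis (lam m * t))\<bar> \<le> 1 + cmod (z m)" by linarith
  qed simp
  then show ?thesis
    using mult_right_mono[of "\<bar>riesz n z t\<bar>" "\<Prod>m<n. 1 + cmod (z m)" "fejer t"] fejer_nonneg[of t]
    by (simp add: rk_def norm_mult mult.commute[of "fejer t"])
qed

lemma prod_ge_one_cmod: "0 \<le> (\<Prod>m<n. 1 + cmod (z m))"
  by (intro prod_nonneg) auto

lemma norm_rk_bounded: "norm (rk n z \<kappa> t) \<le> (\<Prod>m<n. 1 + cmod (z m))"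
  using order_trans[OF norm_rk_le mult_left_mono[OF fejer_le(1) prod_ge_one_cmod]] by simp

lemma integrable_rk: "integrable lborel (rk n z \<kappa>)"
proof (rule Bochner_Integration.integrable_bound)
  show "integrable lborel (\<lambda>t. (\<Prod>m<n. 1 + cmod (z m)) * fejer t)"
    by (intro integrable_mult_right integrable_fejer)
  show "AE t in lborel. norm (rk n z \<kappa> t) \<le> norm ((\<Prod>m<n. 1 + cmod (z m)) * fejer t)"
    unfolding real_norm_def by (intro AE_I2 order_trans[OF norm_rk_le abs_ge_self])
qed simp

lemma integrable_cv_at:
  fixes f h :: "real \<Rightarrow> complex"
  assumes h: "integrable lborel h" and [measurable]: "f \<in> borel_measurable borel"
    and bd: "\<And>x. norm (f x) \<le> B"
  shows "integrable lborel (\<lambda>y. f y * h (x - y))"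
proof (rule Bochner_Integration.integrable_bound)
  note [measurable] = borel_measurable_integrable[OF h]
  show "integrable lborel (\<lambda>y. of_real B * h (x - y))"
    by (intro integrable_mult_right integrable_reflect h)
  show "(\<lambda>y. f y * h (x - y)) \<in> borel_measurable lborel" by measurable
  show "AE y in lborel. norm (f y * h (x - y)) \<le> norm (of_real B * h (x - y))"
    using order_trans[OF bd abs_ge_self] by (intro AE_I2) (simp add: norm_mult mult_right_mono)
qed

lemma integrable_rk_at: "integrable lborel h \<Longrightarrow> integrable lborel (\<lambda>y. rk n z \<kappa> y * h (x - y))"
  by (rule integrable_cv_at[OF _ _ norm_rk_bounded]) auto

lemma cv_rk_Suc:
  assumes h: "integrable lborel h"
  shows "cv (rk (Suc n) z \<kappa>) h t = cv (rk n z \<kappa>) h t + z n / 2 * cv (rk n z (\<kappa> + lam n)) h t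
    + cnj (z n) / 2 * cv (rk n z (\<kappa> - lam n)) h t"
proof -
  have "cv (rk (Suc n) z \<kappa>) h t = (LINT y|lborel. rk n z \<kappa> y * h (t - y)
      + z n / 2 * (rk n z (\<kappa> + lam n) y * h (t - y)) + cnj (z n) / 2 * (rk n z (\<kappa> - lam n) y * h (t - y)))"
    unfolding cv_def rk_Suc by (simp add: algebra_simps)
  also have "\<dots> = cv (rk n z \<kappa>) h t + z n / 2 * cv (rk n z (\<kappa> + lam n)) h t
    + cnj (z n) / 2 * cv (rk n z (\<kappa> - lam n)) h t"
    unfolding cv_def using integrable_rk_at[OF h]
    by (simp only: Bochner_Integration.integral_add Bochner_Integration.integrable_add
        integrable_mult_right integral_mult_right_zero)
  finally show ?thesis .
qed

text \<open>The frequencies of \<open>rk n z \<kappa>\<close> lie within \<open>1 + lsum n\<close>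
  of \<open>\<kappa>\<close>: 1 for the window, \<open>lsum n\<close> for the factors.\<close>

lemma cv_rk_eq_0:
  assumes h: "integrable lborel h" and "\<And>u. \<bar>u - \<kappa>\<bar> \<le> 1 + lsum n \<Longrightarrow> fourier h u = 0"
  shows "cv (rk n z \<kappa>) h t = 0"
  using assms(2)
proof (induction n arbitrary: \<kappa>)
  case 0
  then show ?case unfolding rk_0 by (intro cv_fejer_eq_0 h) (simp add: lsum_def)
next
  case (Suc n)
  have "cv (rk n z \<kappa>') h t = 0" if "\<bar>\<kappa>' - \<kappa>\<bar> \<le> lam n" for \<kappa>'
  proof (rule Suc.IH)
    fix u assume "\<bar>u - \<kappa>'\<bar> \<le> 1 + lsum n"
    then have "\<bar>u - \<kappa>\<bar> \<le> 1 + lsum (Suc n)" using that unfolding lsum_Suc by linarith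
    then show "fourier h u = 0" by (rule Suc.prems)
  qed
  then show ?case using lam_pos[of n] by (simp add: cv_rk_Suc[OF h])
qed

section \<open>Total mass and L1 norm of the Riesz kernels\<close>

lemma integral_rk_Suc:
  "(LINT t|lborel. rk (Suc n) z \<kappa> t) = (LINT t|lborel. rk n z \<kappa> t)
    + z n / 2 * (LINT t|lborel. rk n z (\<kappa> + lam n) t) + cnj (z n) / 2 * (LINT t|lborel. rk n z (\<kappa> - lam n) t)"
  unfolding rk_Suc using integrable_rk
  by (simp only: Bochner_Integration.integral_add Bochner_Integration.integrable_add
      integrable_mult_right integral_mult_right_zero)

lemma integral_rk_eq_0: "1 + lsum n \<le> \<bar>\<kappa>\<bar> \<Longrightarrow> (LINT t|lborel. rk n z \<kappa> t) = 0"
proof (induction n arbitrary: \<kappa>)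
  case 0
  then show ?case unfolding rk_0 by (intro fejer_fourier_zero) (simp add: lsum_def)
next
  case (Suc n)
  have "1 + lsum n \<le> \<bar>\<kappa>'\<bar>" if "\<bar>\<kappa>' - \<kappa>\<bar> \<le> lam n" for \<kappa>'
    using that Suc.prems unfolding lsum_Suc by linarith
  then show ?case using Suc.IH lam_pos[of n] by (simp add: integral_rk_Suc)
qed

text \<open>The two shifted terms of the recursion have their spectrum away from 0, because
  \<open>lam n\<close> outgrows the first \<open>n\<close> factors together with the window.\<close>

lemma integral_rk_0: "(LINT t|lborel. rk n z 0 t) = of_real fejer_mass"
proof (induction n)
  case 0
  then show ?case by (simp add: rk_0 fejer_mass_def)
next
  case (Suc n)
  have "1 + lsum n \<le> lam n" using lam_eq_lsum[of n] lsum_nonneg[of n] by simp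
  then show ?case using Suc lam_pos[of n] by (simp add: integral_rk_Suc integral_rk_eq_0)
qed

text \<open>For unimodular \<open>z\<close> all factors are nonnegative, so the modulus of the
  kernel is the kernel with \<open>\<kappa> = 0\<close>. This is the source of all bounds that do
  not deteriorate with the number of frequencies.\<close>

lemma L1_norm_rk:
  assumes z: "\<And>m. cmod (z m) = 1"
  shows "(LINT t|lborel. norm (rk n z \<kappa> t)) = fejer_mass"
proof -
  have nonneg: "0 \<le> riesz n z t" for t
    unfolding riesz_def
  proof (intro prod_nonneg)
    fix m
    have "\<bar>Re (z m * cis (lam m * t))\<bar> \<le> 1"
      using abs_Re_le_cmod[of "z m * cis (lam m * t)"] by (simp add: norm_mult z)
    then show "0 \<le> 1 + Re (z m * cis (lam m * t))" by linarith
  qed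
  have "complex_of_real (norm (rk n z \<kappa> t)) = rk n z 0 t" for t
    using nonneg[of t] fejer_nonneg[of t] by (simp add: rk_def norm_mult)
  then have "complex_of_real (LINT t|lborel. norm (rk n z \<kappa> t)) = of_real fejer_mass"
    unfolding integral_complex_of_real[symmetric] by (simp add: integral_rk_0)
  then show ?thesis by (simp only: of_real_eq_iff)
qed

section \<open>A martingale transform inequality\<close>

text \<open>Four points in place of the whole circle turn expectations into finite sums, and they
  suffice for the orthogonality and the convexity used below.\<close>

definition roots :: "complex set" where "roots = {1, \<i>, -1, -\<i>}"

lemma sum_roots: "(\<Sum>\<zeta>\<in>roots. f \<zeta>) = f 1 + f \<i> + f (-1) + f (-\<i>)"
  by (simp add: roots_def complex_eq_iff add.assoc)

lemma finite_roots [simp]: "finite roots" and norm_roots: "\<zeta> \<in> roots \<Longrightarrow> cmod \<zeta> = 1"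
  by (auto simp: roots_def)

text \<open>Padding with 1 makes the set finite and keeps every entry unimodular.\<close>

definition root_seqs :: "nat \<Rightarrow> (nat \<Rightarrow> complex) set"
  where "root_seqs n = {z. (\<forall>m<n. z m \<in> roots) \<and> (\<forall>m\<ge>n. z m = 1)}"

lemma norm_root_seqs: "z \<in> root_seqs n \<Longrightarrow> cmod (z m) = 1"
  by (cases "m < n") (auto simp: root_seqs_def norm_roots)

lemma root_seqs_0: "root_seqs 0 = {\<lambda>_. 1}"
  by (auto simp: root_seqs_def)

lemma bij_root_seqs_Suc: "bij_betw (\<lambda>(z, \<zeta>). z(n := \<zeta>)) (root_seqs n \<times> roots) (root_seqs (Suc n))"
proof (rule bij_betw_byWitness[where f' = "\<lambda>z. (z(n := 1), z n)"])
  show "\<forall>p\<in>root_seqs n \<times> roots. (\<lambda>z. (z(n := 1), z n)) ((\<lambda>(z, \<zeta>). z(n := \<zeta>)) p) = p"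
    by (auto simp: root_seqs_def fun_eq_iff)
  show "\<forall>z\<in>root_seqs (Suc n). (\<lambda>(z, \<zeta>). z(n := \<zeta>)) (z(n := 1), z n) = z"
    by auto
  show "(\<lambda>(z, \<zeta>). z(n := \<zeta>)) ` (root_seqs n \<times> roots) \<subseteq> root_seqs (Suc n)"
    by (auto simp: root_seqs_def less_Suc_eq)
  show "(\<lambda>z. (z(n := 1), z n)) ` root_seqs (Suc n) \<subseteq> root_seqs n \<times> roots"
    by (auto simp: root_seqs_def)
qed

lemma finite_root_seqs [simp]: "finite (root_seqs n)"
proof (induction n)
  case (Suc n)
  then show ?case using bij_betw_finite[OF bij_root_seqs_Suc[of n]] by simp
qed (simp add: root_seqs_0)

lemma card_root_seqs: "card (root_seqs n) = 4 ^ n"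
proof (induction n)
  case (Suc n)
  have "card roots = 4" by (simp add: roots_def complex_eq_iff)
  then show ?case using bij_betw_same_card[OF bij_root_seqs_Suc[of n]] Suc by (simp add: card_cartesian_product)
qed (simp add: root_seqs_0)

lemma sum_root_seqs_Suc: "(\<Sum>z\<in>root_seqs (Suc n). F z) = (\<Sum>z\<in>root_seqs n. \<Sum>\<zeta>\<in>roots. F (z(n := \<zeta>)))"
  using sum.reindex_bij_betw[OF bij_root_seqs_Suc[of n], of F]
  by (simp add: sum.cartesian_product case_prod_unfold)

text \<open>Complex uniform convexity of the modulus, over the fourth roots of unity.\<close>

lemma sum_roots_cmod_ge:
  "2 * cmod x + 2 * sqrt ((cmod x)\<^sup>2 + (cmod w)\<^sup>2 / 2) \<le> (\<Sum>\<zeta>\<in>roots. cmod (x + \<zeta> * w))"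
proof (cases "x = 0")
  case True
  have "sqrt ((cmod w)\<^sup>2 / 2) \<le> cmod w" by (intro real_le_lsqrt) auto
  also have "\<dots> \<le> 2 * cmod w" by simp
  finally show ?thesis using True by (simp add: sum_roots norm_mult)
next
  case False
  \<comment> \<open>Multiplying all vectors by \<open>cnj x\<close> makes the centre the positive
    real number \<open>a\<close>.\<close>
  define a where "a = (cmod x)\<^sup>2"
  have a: "0 < a" using False by (simp add: a_def)
  have pair: "2 * sqrt (a\<^sup>2 + (Im v)\<^sup>2) \<le> cmod (of_real a + v) + cmod (of_real a - v)" for v
  proof -
    \<comment> \<open>Conjugating the second vector preserves its modulus and cancels the real part
      of \<open>v\<close> in the sum.\<close>
    have "2 * sqrt (a\<^sup>2 + (Im v)\<^sup>2) = cmod ((of_real a + v) + (of_real a - cnj v))"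
    proof -
      have "(of_real a + v) + (of_real a - cnj v) = 2 * Complex a (Im v)" by (simp add: complex_eq_iff)
      then show ?thesis by (simp only: norm_mult complex_norm) simp
    qed
    also have "\<dots> \<le> cmod (of_real a + v) + cmod (of_real a - cnj v)" by (rule norm_triangle_ineq)
    also have "cmod (of_real a - cnj v) = cmod (of_real a - v)"
      by (metis complex_cnj_complex_of_real complex_cnj_diff complex_mod_cnj)
    finally show ?thesis .
  qed
  define v where "v = w * cnj x"
  have scale: "cmod x * cmod (x + \<zeta> * w) = cmod (of_real a + \<zeta> * v)" for \<zeta>
  proof -
    have "of_real a + \<zeta> * v = (x + \<zeta> * w) * cnj x"
      unfolding a_def v_def by (simp only: complex_norm_square) (simp add: algebra_simps)
    then show ?thesis by (simp add: norm_mult)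
  qed
  \<comment> \<open>The larger of the two squared coordinates is at least half of
    \<open>(cmod v)\<^sup>2\<close>; the other square root is at least \<open>a\<close>.\<close>
  have key: "a + sqrt (a\<^sup>2 + (cmod v)\<^sup>2 / 2) \<le> sqrt (a\<^sup>2 + (Im v)\<^sup>2) + sqrt (a\<^sup>2 + (Re v)\<^sup>2)"
  proof -
    have aa: "a \<le> sqrt (a\<^sup>2 + b\<^sup>2)" for b using a by (intro real_le_rsqrt) simp
    show ?thesis
    proof (cases "(Re v)\<^sup>2 \<le> (Im v)\<^sup>2")
      case True
      then have "sqrt (a\<^sup>2 + (cmod v)\<^sup>2 / 2) \<le> sqrt (a\<^sup>2 + (Im v)\<^sup>2)" by (simp add: cmod_power2)
      then show ?thesis using aa[of "Re v"] by linarith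
    next
      case False
      then have "sqrt (a\<^sup>2 + (cmod v)\<^sup>2 / 2) \<le> sqrt (a\<^sup>2 + (Re v)\<^sup>2)" by (simp add: cmod_power2)
      then show ?thesis using aa[of "Im v"] by linarith
    qed
  qed
  have "cmod x * (2 * cmod x + 2 * sqrt ((cmod x)\<^sup>2 + (cmod w)\<^sup>2 / 2)) = 2 * a + 2 * sqrt (a\<^sup>2 + (cmod v)\<^sup>2 / 2)"
  proof -
    have "cmod x * sqrt ((cmod x)\<^sup>2 + (cmod w)\<^sup>2 / 2) = sqrt ((cmod x)\<^sup>2 * ((cmod x)\<^sup>2 + (cmod w)\<^sup>2 / 2))"
      by (simp add: real_sqrt_mult)
    also have "(cmod x)\<^sup>2 * ((cmod x)\<^sup>2 + (cmod w)\<^sup>2 / 2) = a\<^sup>2 + (cmod v)\<^sup>2 / 2"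
      by (simp add: a_def v_def norm_mult power_mult_distrib power2_eq_square algebra_simps)
    finally show ?thesis by (simp add: a_def power2_eq_square distrib_left)
  qed
  also have "\<dots> \<le> cmod x * (\<Sum>\<zeta>\<in>roots. cmod (x + \<zeta> * w))"
    unfolding sum_roots distrib_left scale
    using key pair[of v] pair[of "\<i> * v"] by simp
  finally show ?thesis using False by (simp add: mult_le_cancel_left)
qed

text \<open>Jensen's inequality for the square root, through its tangent at \<open>T\<close>.
  Squares summed over the four roots have no cross terms, and the two coordinates together add at
  most \<open>2 * (cmod w)\<^sup>2\<close> in mean.\<close>

lemma sum_roots_sqrt_le:
  fixes \<epsilon> :: real
  assumes "0 \<le> \<epsilon>" "\<epsilon> \<le> 1"
  shows "(\<Sum>\<zeta>\<in>roots. sqrt ((cmod (x + \<zeta> * w))\<^sup>2 + (cmod (y + \<epsilon> * (\<zeta> * w)))\<^sup>2))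
    \<le> 4 * sqrt ((cmod x)\<^sup>2 + (cmod y)\<^sup>2 + 2 * (cmod w)\<^sup>2)"
proof -
  define g where "g \<zeta> = (cmod (x + \<zeta> * w))\<^sup>2 + (cmod (y + \<epsilon> * (\<zeta> * w)))\<^sup>2" for \<zeta>
  have par: "(cmod (u + v))\<^sup>2 + (cmod (u + \<i> * v))\<^sup>2 + (cmod (u - v))\<^sup>2 + (cmod (u - \<i> * v))\<^sup>2
      = 4 * (cmod u)\<^sup>2 + 4 * (cmod v)\<^sup>2" for u v
    unfolding cmod_power2 by (simp add: power2_eq_square algebra_simps)
  have "(\<Sum>\<zeta>\<in>roots. g \<zeta>) = (4 * (cmod x)\<^sup>2 + 4 * (cmod w)\<^sup>2) + (4 * (cmod y)\<^sup>2 + 4 * (cmod (\<epsilon> * w))\<^sup>2)"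
    unfolding par[symmetric] sum_roots g_def by (simp add: algebra_simps)
  also have "(cmod (\<epsilon> * w))\<^sup>2 \<le> (cmod w)\<^sup>2"
    using assms by (intro power_mono) (auto simp: norm_mult mult_left_le_one_le)
  finally have g: "(\<Sum>\<zeta>\<in>roots. g \<zeta>) \<le> 4 * ((cmod x)\<^sup>2 + (cmod y)\<^sup>2 + 2 * (cmod w)\<^sup>2)" by simp
  define T where "T = (cmod x)\<^sup>2 + (cmod y)\<^sup>2 + 2 * (cmod w)\<^sup>2"
  have T: "0 \<le> T" by (simp add: T_def)
  show ?thesis
  proof (cases "T = 0")
    case True
    then have "x = 0" "y = 0" "w = 0" unfolding T_def by (auto simp: add_nonneg_eq_0_iff)
    then show ?thesis by (simp add: sum_roots)
  next
    case False
    have "sqrt b \<le> (b / sqrt T + sqrt T) / 2" if "0 \<le> b" for b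
    proof -
      have "2 * (sqrt b * sqrt T) \<le> b + T"
        using that T zero_le_power2[of "sqrt b - sqrt T"] by (simp add: power2_diff)
      then show ?thesis using False T by (simp add: field_simps)
    qed
    then have "(\<Sum>\<zeta>\<in>roots. sqrt (g \<zeta>)) \<le> (\<Sum>\<zeta>\<in>roots. (g \<zeta> / sqrt T + sqrt T) / 2)"
      by (intro sum_mono) (simp add: g_def)
    also have "\<dots> = ((\<Sum>\<zeta>\<in>roots. g \<zeta>) / sqrt T + 4 * sqrt T) / 2"
      by (simp add: sum_roots add_divide_distrib)
    also have "\<dots> \<le> (4 * T / sqrt T + 4 * sqrt T) / 2"
      using g T by (simp add: T_def divide_right_mono)
    also have "\<dots> = 4 * sqrt T"
      using T by (simp add: real_div_sqrt flip: times_divide_eq_right)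
    finally show ?thesis by (simp add: g_def T_def)
  qed
qed

text \<open>In the notation of the proof, the modulus gains at least
  \<open>2 * (sqrt (a\<^sup>2 + q) - a)\<close> over the four roots, and the square root grows by at
  most \<open>4 * (sqrt (s\<^sup>2 + 4 * q) - s)\<close>. The latter is at most 8 times the gain,
  whence the constant 8.\<close>

lemma martingale_step:
  fixes \<epsilon> :: real
  assumes "0 \<le> \<epsilon>" "\<epsilon> \<le> 1"
  shows "4 * (8 * cmod x - sqrt ((cmod x)\<^sup>2 + (cmod y)\<^sup>2))
    \<le> (\<Sum>\<zeta>\<in>roots. 8 * cmod (x + \<zeta> * w) - sqrt ((cmod (x + \<zeta> * w))\<^sup>2 + (cmod (y + \<epsilon> * (\<zeta> * w)))\<^sup>2))"
proof -
  define a where "a = cmod x"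
  define q where "q = (cmod w)\<^sup>2 / 2"
  define s where "s = sqrt (a\<^sup>2 + (cmod y)\<^sup>2)"
  have nonneg: "0 \<le> a" "0 \<le> q" "a \<le> s" by (auto simp: a_def q_def s_def intro: real_le_rsqrt)
  \<comment> \<open>Such an increment decreases in the base point, so \<open>s\<close> may be
    replaced by the smaller \<open>a\<close>.\<close>
  have "sqrt (s\<^sup>2 + 4 * q) - s \<le> sqrt (a\<^sup>2 + 4 * q) - a"
  proof -
    have "(sqrt (s\<^sup>2 + 4 * q) + a)\<^sup>2 \<le> (sqrt (a\<^sup>2 + 4 * q) + s)\<^sup>2"
    proof -
      have "a * sqrt (s\<^sup>2 + 4 * q) \<le> s * sqrt (a\<^sup>2 + 4 * q)"
      proof -
        have "(a * sqrt (s\<^sup>2 + 4 * q))\<^sup>2 \<le> (s * sqrt (a\<^sup>2 + 4 * q))\<^sup>2"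
          using nonneg mult_right_mono[of "a\<^sup>2" "s\<^sup>2" "4 * q"]
          by (simp add: power_mult_distrib distrib_left power_mono mult.commute)
        then show ?thesis using nonneg by (simp add: power2_le_iff_abs_le)
      qed
      then show ?thesis using nonneg by (simp add: power2_sum mult_ac)
    qed
    then show ?thesis using nonneg by (simp add: power2_le_iff_abs_le)
  qed
  \<comment> \<open>For \<open>0 < a\<close> and small \<open>q\<close> both sides are
    \<open>2 * q / a\<close> to first order, which explains the factor 4.\<close>
  also have "\<dots> \<le> 4 * (sqrt (a\<^sup>2 + q) - a)"
  proof -
    have 1: "a * sqrt (a\<^sup>2 + 4 * q) \<le> a\<^sup>2 + 2 * q"
    proof -
      have "(a * sqrt (a\<^sup>2 + 4 * q))\<^sup>2 \<le> (a\<^sup>2 + 2 * q)\<^sup>2"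
      proof -
        have "(a * sqrt (a\<^sup>2 + 4 * q))\<^sup>2 = a\<^sup>2 * (a\<^sup>2 + 4 * q)" using nonneg by (simp add: power_mult_distrib)
        also have "\<dots> \<le> a\<^sup>2 * (a\<^sup>2 + 4 * q) + (2 * q)\<^sup>2" by simp
        also have "\<dots> = (a\<^sup>2 + 2 * q)\<^sup>2" by (simp add: power2_eq_square algebra_simps)
        finally show ?thesis .
      qed
      then show ?thesis using nonneg by (simp add: power2_le_iff_abs_le)
    qed
    have "(sqrt (a\<^sup>2 + 4 * q) + 3 * a)\<^sup>2 \<le> (4 * sqrt (a\<^sup>2 + q))\<^sup>2"
      using nonneg 1 by (simp add: power_mult_distrib power2_sum mult_ac)
    then have "sqrt (a\<^sup>2 + 4 * q) + 3 * a \<le> 4 * sqrt (a\<^sup>2 + q)"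
      by (rule power2_le_imp_le) (use nonneg in simp)
    then show ?thesis by simp
  qed
  finally have key: "sqrt (s\<^sup>2 + 4 * q) - s \<le> 4 * (sqrt (a\<^sup>2 + q) - a)" .
  have 1: "(\<Sum>\<zeta>\<in>roots. sqrt ((cmod (x + \<zeta> * w))\<^sup>2 + (cmod (y + \<epsilon> * (\<zeta> * w)))\<^sup>2)) \<le> 4 * sqrt (s\<^sup>2 + 4 * q)"
    using sum_roots_sqrt_le[OF assms, of x w y] by (simp add: s_def q_def a_def)
  have 2: "2 * a + 2 * sqrt (a\<^sup>2 + q) \<le> (\<Sum>\<zeta>\<in>roots. cmod (x + \<zeta> * w))"
    using sum_roots_cmod_ge[of x w] by (simp add: a_def q_def)
  have "4 * (8 * a - s) \<le> 8 * (\<Sum>\<zeta>\<in>roots. cmod (x + \<zeta> * w))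
     - (\<Sum>\<zeta>\<in>roots. sqrt ((cmod (x + \<zeta> * w))\<^sup>2 + (cmod (y + \<epsilon> * (\<zeta> * w)))\<^sup>2))"
    using key 1 2 by argo
  then show ?thesis unfolding sum_subtractf sum_distrib_left[symmetric] a_def s_def .
qed

text \<open>Sums over \<open>root_seqs\<close> play the role of expectations, and invariance under
  changing a coordinate \<open>k \<ge> n\<close> encodes predictability. The sum of the comparison
  function is nonnegative at the start, where the transform is 0, and \<open>martingale_step\<close>
  keeps it so; dropping the first square under the root concludes.\<close>

lemma martingale_transform:
  fixes X \<phi> :: "nat \<Rightarrow> (nat \<Rightarrow> complex) \<Rightarrow> complex" and \<epsilon> :: "nat \<Rightarrow> real"
  assumes X: "\<And>n z. X (Suc n) z = X n z + z n * \<phi> n z"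
    and predX: "\<And>n k z \<zeta>. n \<le> k \<Longrightarrow> X n (z(k := \<zeta>)) = X n z"
    and pred: "\<And>n k z \<zeta>. n \<le> k \<Longrightarrow> \<phi> n (z(k := \<zeta>)) = \<phi> n z"
    and \<epsilon>: "\<And>n. 0 \<le> \<epsilon> n \<and> \<epsilon> n \<le> 1"
  shows "(\<Sum>z\<in>root_seqs n. cmod (\<Sum>m<n. \<epsilon> m * (z m * \<phi> m z))) \<le> 8 * (\<Sum>z\<in>root_seqs n. cmod (X n z))"
proof -
  define Y where "Y n z = (\<Sum>m<n. \<epsilon> m * (z m * \<phi> m z))" for n z
  have "0 \<le> (\<Sum>z\<in>root_seqs n. 8 * cmod (X n z) - sqrt ((cmod (X n z))\<^sup>2 + (cmod (Y n z))\<^sup>2))"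
  proof (induction n)
    case 0
    show ?case by (simp add: Y_def root_seqs_0)
  next
    case (Suc n)
    have Y: "Y n (z(n := \<zeta>)) = Y n z" for z \<zeta>
      unfolding Y_def using pred by (intro sum.cong) auto
    have "0 \<le> (\<Sum>z\<in>root_seqs n. 4 * (8 * cmod (X n z) - sqrt ((cmod (X n z))\<^sup>2 + (cmod (Y n z))\<^sup>2)))"
      unfolding sum_distrib_left[symmetric] using Suc by simp
    also have "\<dots> \<le> (\<Sum>z\<in>root_seqs n. \<Sum>\<zeta>\<in>roots. 8 * cmod (X n z + \<zeta> * \<phi> n z)
        - sqrt ((cmod (X n z + \<zeta> * \<phi> n z))\<^sup>2 + (cmod (Y n z + \<epsilon> n * (\<zeta> * \<phi> n z)))\<^sup>2))"
      using \<epsilon> by (intro sum_mono martingale_step) auto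
    also have "\<dots> = (\<Sum>z\<in>root_seqs (Suc n). 8 * cmod (X (Suc n) z) - sqrt ((cmod (X (Suc n) z))\<^sup>2 + (cmod (Y (Suc n) z))\<^sup>2))"
    proof -
      have "X (Suc n) (z(n := \<zeta>)) = X n z + \<zeta> * \<phi> n z" for z \<zeta>
        by (simp add: X predX pred)
      moreover have "Y (Suc n) (z(n := \<zeta>)) = Y n z + \<epsilon> n * (\<zeta> * \<phi> n z)" for z \<zeta>
        using Y[of z \<zeta>] by (simp add: Y_def pred)
      ultimately show ?thesis by (simp add: sum_root_seqs_Suc)
    qed
    finally show ?case .
  qed
  also have "\<dots> \<le> (\<Sum>z\<in>root_seqs n. 8 * cmod (X n z) - cmod (Y n z))"
    by (intro sum_mono diff_left_mono real_le_rsqrt) simp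
  finally show ?thesis by (simp add: sum_subtractf sum_distrib_left Y_def)
qed

section \<open>A bounded multiplier of the Hardy space\<close>

definition vk :: "nat \<Rightarrow> (nat \<Rightarrow> complex) \<Rightarrow> real \<Rightarrow> complex"
  where "vk N z r = (\<Sum>m<N. of_real (of_bool (even m)) * (z m * (rk m z (lam m) r / 2)))"

text \<open>\<open>vk\<close> keeps the even increments of the martingale; averaging against a second Riesz
  product turns this martingale transform into a convolution.\<close>

definition mult_kernel :: "nat \<Rightarrow> real \<Rightarrow> complex"
  where "mult_kernel N r = (\<Sum>z\<in>root_seqs N. cv (rk N (\<lambda>m. cnj (z m)) 0) (vk N z) r) / 4 ^ N"

lemma integrable_vk: "integrable lborel (vk N z)"
  unfolding vk_def[abs_def] by (intro Bochner_Integration.integrable_sum integrable_mult_right integrable_divide integrable_rk)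

lemma vk_measurable [measurable]: "vk N z \<in> borel_measurable borel"
  using borel_measurable_integrable[OF integrable_vk] by simp

lemma ex_vk_bound: "\<exists>B. \<forall>r. norm (vk N z r) \<le> B"
proof (intro exI allI)
  fix r
  show "norm (vk N z r) \<le> (\<Sum>m<N. norm (z m) * ((\<Prod>k<m. 1 + cmod (z k)) / 2))"
    unfolding vk_def
    by (rule order_trans[OF norm_sum], rule sum_mono)
      (auto simp: norm_mult norm_divide intro!: mult_left_mono divide_right_mono mult_nonneg_nonneg norm_rk_bounded prod_ge_one_cmod)
qed

lemma cv_vk:
  assumes h: "integrable lborel h"
  shows "cv (vk N z) h t = (\<Sum>m<N. of_real (of_bool (even m)) * (z m * (cv (rk m z (lam m)) h t / 2)))"
proof -
  have "cv (vk N z) h t = (LINT y|lborel. (\<Sum>m<N. of_real (of_bool (even m)) * (z m * ((rk m z (lam m) y * h (t - y)) / 2))))"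
    unfolding cv_def vk_def by (intro Bochner_Integration.integral_cong refl) (simp add: sum_distrib_right mult.assoc)
  also have "\<dots> = (\<Sum>m<N. LINT y|lborel. of_real (of_bool (even m)) * (z m * ((rk m z (lam m) y * h (t - y)) / 2)))"
    by (intro Bochner_Integration.integral_sum integrable_mult_right integrable_divide integrable_rk_at h)
  also have "\<dots> = (\<Sum>m<N. of_real (of_bool (even m)) * (z m * (cv (rk m z (lam m)) h t / 2)))"
    by (simp only: integral_mult_right_zero integral_divide_zero cv_def)
  finally show ?thesis .
qed

lemma integrable_mult_kernel: "integrable lborel (mult_kernel N)"
  unfolding mult_kernel_def[abs_def]
  by (intro integrable_divide Bochner_Integration.integrable_sum integrable_cv integrable_rk integrable_vk)

text \<open>Associativity lets \<open>vk\<close> act on \<open>h\<close> first, where the martingale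
  bound applies; the outer Riesz kernel then costs only its mass.\<close>

lemma cv_mult_kernel:
  assumes h: "integrable lborel h"
  shows "cv (mult_kernel N) h t = (\<Sum>z\<in>root_seqs N. cv (rk N (\<lambda>m. cnj (z m)) 0) (cv (vk N z) h) t) / 4 ^ N"
proof -
  let ?A = "\<lambda>z. rk N (\<lambda>m. cnj (z m)) 0"
  obtain B where B: "\<And>z r. norm (vk N z r) \<le> B z" using ex_vk_bound by metis
  have Abd: "norm (cv (?A z) (vk N z) x) \<le> (LINT y|lborel. norm (?A z y)) * B z" for z x
  proof -
    have "norm (cv (?A z) (vk N z) x) \<le> (LINT y|lborel. norm (?A z y * vk N z (x - y)))"
      unfolding cv_def by (rule integral_norm_bound)
    also have "\<dots> \<le> (LINT y|lborel. norm (?A z y) * B z)"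
    proof (rule integral_mono)
      have "integrable lborel (\<lambda>y. vk N z (x - y) * ?A z y)"
      proof -
        have "integrable lborel (\<lambda>y. vk N z y * ?A z (x - y))"
          by (rule integrable_cv_at[OF integrable_rk _ B]) simp
        from integrable_reflect[OF this, of x] show ?thesis by simp
      qed
      then show "integrable lborel (\<lambda>y. norm (?A z y * vk N z (x - y)))"
        by (simp add: mult.commute)
    qed (auto simp: norm_mult integrable_rk intro!: mult_left_mono B)
    finally show ?thesis by (simp add: mult.commute)
  qed
  have int: "integrable lborel (\<lambda>y. cv (?A z) (vk N z) y * h (t - y))" for z
    using borel_measurable_integrable[OF integrable_cv[OF integrable_rk integrable_vk]]
    by (intro integrable_cv_at[OF h _ Abd]) simp
  have "cv (mult_kernel N) h t = (LINT y|lborel. (\<Sum>z\<in>root_seqs N. cv (?A z) (vk N z) y * h (t - y)) / 4 ^ N)"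
    unfolding cv_def[of "mult_kernel N"] mult_kernel_def by (simp add: sum_distrib_right)
  also have "\<dots> = (\<Sum>z\<in>root_seqs N. cv (cv (?A z) (vk N z)) h t) / 4 ^ N"
    using int by (simp add: Bochner_Integration.integral_sum cv_def[of "cv _ _"])
  also have "\<dots> = (\<Sum>z\<in>root_seqs N. cv (?A z) (cv (vk N z) h) t) / 4 ^ N"
    using B by (simp add: cv_assoc[OF integrable_rk h _ B])
  finally show ?thesis .
qed

lemma fejer_mass_nonneg: "0 \<le> fejer_mass"
  unfolding fejer_mass_def by (intro integral_nonneg_AE) (simp add: fejer_nonneg)

text \<open>The 8 comes from the transform, one \<open>fejer_mass\<close> from the Riesz product
  that generates the martingale and the other from the averaging product. The division by
  \<open>4 ^ N\<close> matches the number of sign sequences.\<close>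

lemma mult_kernel_bound:
  assumes h: "h \<in> H1"
  shows "(LINT t|lborel. norm (cv (mult_kernel N) h t)) \<le> 8 * fejer_mass\<^sup>2 * L1_norm h"
proof -
  have hi: "integrable lborel h" and hz: "\<And>u. u \<le> 0 \<Longrightarrow> fourier h u = 0"
    using h by (auto simp: H1_def)
  let ?A = "\<lambda>z. rk N (\<lambda>m. cnj (z m)) 0"
  define X where "X t n z = cv (rk n z 0) h t" for t n z
  define \<phi> where "\<phi> t n z = cv (rk n z (lam n)) h t / 2" for t n z
  have pt: "(\<Sum>z\<in>root_seqs N. cmod (cv (vk N z) h t)) \<le> 8 * (\<Sum>z\<in>root_seqs N. cmod (X t N z))" for t
    unfolding cv_vk[OF hi] \<phi>_def[symmetric]
  proof (rule martingale_transform)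
    fix n k z and \<zeta> :: complex
    \<comment> \<open>The spectrum of this kernel lies on the negative half-line, where
      \<open>fourier h\<close> vanishes: analyticity removes the \<open>cnj (z n)\<close> term of
      the recursion.\<close>
    have "cv (rk n z (0 - lam n)) h t = 0"
      using lam_eq_lsum[of n] lsum_nonneg[of n] by (intro cv_rk_eq_0 hi hz) (simp add: abs_le_iff)
    then show "X t (Suc n) z = X t n z + z n * \<phi> t n z"
      by (simp add: X_def \<phi>_def cv_rk_Suc[OF hi])
    assume "n \<le> k"
    then have "rk n (z(k := \<zeta>)) \<kappa> = rk n z \<kappa>" for \<kappa> by (intro rk_cong) auto
    then show "X t n (z(k := \<zeta>)) = X t n z" "\<phi> t n (z(k := \<zeta>)) = \<phi> t n z"
      by (simp_all add: X_def \<phi>_def)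
  qed auto
  have iv: "integrable lborel (\<lambda>t. cmod (cv (vk N z) h t))" for z
    by (intro integrable_norm integrable_cv integrable_vk hi)
  have iX: "integrable lborel (\<lambda>t. cmod (X t N z))" for z
    unfolding X_def by (intro integrable_norm integrable_cv integrable_rk hi)
  have nz: "cmod (z m) = 1" "cmod (cnj (z m)) = 1" if "z \<in> root_seqs N" for z m using norm_root_seqs[OF that] by auto
  have "(LINT t|lborel. norm (cv (mult_kernel N) h t))
      \<le> (LINT t|lborel. (\<Sum>z\<in>root_seqs N. norm (cv (?A z) (cv (vk N z) h) t)) / 4 ^ N)"
  proof (rule integral_mono)
    show "integrable lborel (\<lambda>t. norm (cv (mult_kernel N) h t))"
      by (intro integrable_norm integrable_cv integrable_mult_kernel hi)
    show "integrable lborel (\<lambda>t. (\<Sum>z\<in>root_seqs N. norm (cv (?A z) (cv (vk N z) h) t)) / 4 ^ N)"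
      by (intro integrable_divide Bochner_Integration.integrable_sum integrable_norm integrable_cv integrable_rk integrable_vk hi)
    show "norm (cv (mult_kernel N) h t) \<le> (\<Sum>z\<in>root_seqs N. norm (cv (?A z) (cv (vk N z) h) t)) / 4 ^ N" for t
      unfolding cv_mult_kernel[OF hi] by (simp add: norm_divide norm_power divide_right_mono norm_sum)
  qed
  also have "\<dots> = (\<Sum>z\<in>root_seqs N. LINT t|lborel. norm (cv (?A z) (cv (vk N z) h) t)) / 4 ^ N"
    by (subst integral_divide_zero, subst Bochner_Integration.integral_sum)
      (auto intro!: integrable_norm integrable_cv integrable_rk integrable_vk hi)
  also have "\<dots> \<le> (\<Sum>z\<in>root_seqs N. fejer_mass * (LINT t|lborel. norm (cv (vk N z) h t))) / 4 ^ N"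
  proof (intro divide_right_mono sum_mono)
    fix z assume "z \<in> root_seqs N"
    then show "(LINT t|lborel. norm (cv (?A z) (cv (vk N z) h) t)) \<le> fejer_mass * (LINT t|lborel. norm (cv (vk N z) h t))"
      using L1_norm_cv_le[OF integrable_rk[of N "\<lambda>m. cnj (z m)" 0] integrable_cv[OF integrable_vk[of N z] hi]] nz
      by (simp add: L1_norm_rk)
  qed simp
  also have "\<dots> = fejer_mass * (LINT t|lborel. (\<Sum>z\<in>root_seqs N. cmod (cv (vk N z) h t))) / 4 ^ N"
    by (subst Bochner_Integration.integral_sum) (simp_all add: iv sum_distrib_left)
  also have "\<dots> \<le> fejer_mass * (LINT t|lborel. 8 * (\<Sum>z\<in>root_seqs N. cmod (X t N z))) / 4 ^ N"
    by (intro divide_right_mono mult_left_mono integral_mono pt) (auto simp: fejer_mass_nonneg iv iX)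
  also have "\<dots> = fejer_mass * (8 * (\<Sum>z\<in>root_seqs N. LINT t|lborel. cmod (X t N z))) / 4 ^ N"
    by (subst integral_mult_right_zero, subst Bochner_Integration.integral_sum) (simp_all add: iX)
  also have "\<dots> \<le> fejer_mass * (8 * (\<Sum>z\<in>root_seqs N. fejer_mass * L1_norm h)) / 4 ^ N"
  proof (intro divide_right_mono mult_left_mono sum_mono)
    fix z assume "z \<in> root_seqs N"
    then show "(LINT t|lborel. cmod (X t N z)) \<le> fejer_mass * L1_norm h"
      using L1_norm_cv_le[OF integrable_rk[of N z 0] hi] nz by (simp add: X_def L1_norm_rk L1_norm_def)
  qed (auto simp: fejer_mass_nonneg)
  also have "\<dots> = 8 * fejer_mass\<^sup>2 * L1_norm h"
    by (simp add: card_root_seqs power2_eq_square)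
  finally show ?thesis .
qed

section \<open>Evaluation of the multiplier at sums of two frequencies\<close>

text \<open>\<open>coef n z \<mu>\<close> is the coefficient of \<open>cis (\<mu> * t)\<close> in \<open>riesz n z t\<close>.\<close>

primrec coef :: "nat \<Rightarrow> (nat \<Rightarrow> complex) \<Rightarrow> real \<Rightarrow> complex" where
  "coef 0 z \<mu> = of_bool (\<mu> = 0)"
| "coef (Suc n) z \<mu> = coef n z \<mu> + z n / 2 * coef n z (\<mu> - lam n) + cnj (z n) / 2 * coef n z (\<mu> + lam n)"

lemma coef_eq_0: "lsum n < \<bar>\<mu>\<bar> \<Longrightarrow> coef n z \<mu> = 0"
proof (induction n arbitrary: \<mu>)
  case 0
  then show ?case by (simp add: lsum_def)
next
  case (Suc n)
  then show ?case using lam_pos[of n] by (simp add: lsum_Suc)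
qed

lemma lsum_less_lam: "lsum n < lam n"
  using lam_eq_lsum[of n] lsum_nonneg[of n] by simp

lemma lam_mono4: "m < n \<Longrightarrow> 4 * lam m \<le> lam n"
  unfolding lam_def using power_increasing[of "Suc (Suc m)" "Suc n" "4::real"] by simp

lemma coef_0: "coef n z 0 = 1"
  using lsum_less_lam lam_pos
  by (induction n) (simp_all add: coef_eq_0 order_trans[of 0 4 "lam _"] abs_of_nonneg)

text \<open>At the step \<open>n = B\<close> the new factor shifts the constant coefficient to
  \<open>lam B\<close>; at later steps both shifted arguments exceed \<open>lsum n\<close> in
  modulus and contribute nothing.\<close>

lemma coef_lam: "B < n \<Longrightarrow> coef n z (lam B) = z B / 2"
proof (induction n)
  case (Suc n)
  show ?case
  proof (cases "B = n")
    case True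
    have "coef n z (lam n) = 0" "coef n z (lam n + lam n) = 0"
      using lsum_less_lam[of n] lam_pos[of n] by (auto intro!: coef_eq_0)
    then show ?thesis using True by (simp add: coef_0)
  next
    case False
    then have B: "B < n" using Suc.prems by simp
    have "coef n z (lam B - lam n) = 0" "coef n z (lam B + lam n) = 0"
      using lam_eq_lsum[of n] lam_mono4[OF B] lam_pos[of B] by (auto intro!: coef_eq_0 simp: abs_if)
    then show ?thesis using Suc.IH[OF B] by simp
  qed
qed simp

text \<open>The same dichotomy at the larger index \<open>A\<close>: splitting off its factor leaves
  the single frequency \<open>lam B\<close> for the earlier ones.\<close>

lemma coef_lam_add: "B < A \<Longrightarrow> A < n \<Longrightarrow> coef n z (lam A + lam B) = z A * z B / 4"
proof (induction n)
  case (Suc n)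
  show ?case
  proof (cases "A = n")
    case True
    have "coef n z (lam n + lam B) = 0" "coef n z (lam n + lam B + lam n) = 0"
      using lsum_less_lam[of n] lam_pos[of n] lam_pos[of B] by (auto intro!: coef_eq_0)
    then show ?thesis using True Suc.prems by (simp add: coef_lam)
  next
    case False
    then have A: "A < n" using Suc.prems by simp
    have "coef n z (lam A + lam B - lam n) = 0" "coef n z (lam A + lam B + lam n) = 0"
      using lam_eq_lsum[of n] lam_mono4[OF A] lam_mono4[OF Suc.prems(1)] lam_pos[of A] lam_pos[of B]
      by (auto intro!: coef_eq_0 simp: abs_if)
    then show ?thesis using Suc.IH[OF Suc.prems(1) A] by simp
  qed
qed simp

text \<open>Signed sums of the \<open>lam n\<close> are multiples of 4, so windows around two
  different centres share no frequency.\<close>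

definition grid :: "real set" where "grid = {4 * of_int k | k. True}"

lemma grid_add: "x \<in> grid \<Longrightarrow> y \<in> grid \<Longrightarrow> x + y \<in> grid"
  and grid_diff: "x \<in> grid \<Longrightarrow> y \<in> grid \<Longrightarrow> x - y \<in> grid"
  unfolding grid_def by (auto simp: distrib_left[symmetric] right_diff_distrib[symmetric] simp del: of_int_add of_int_diff
      simp flip: of_int_add of_int_diff)

lemma grid_lam: "lam n \<in> grid"
  unfolding grid_def lam_def by (auto intro!: exI[of _ "4 ^ n"])

lemma grid_0: "0 \<in> grid"
  unfolding grid_def by (auto intro!: exI[of _ 0])

lemma grid_dist: "x \<in> grid \<Longrightarrow> y \<in> grid \<Longrightarrow> x \<noteq> y \<Longrightarrow> 4 \<le> \<bar>x - y\<bar>"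
proof -
  assume "x \<in> grid" "y \<in> grid" "x \<noteq> y"
  then obtain k l :: int where kl: "x = 4 * of_int k" "y = 4 * of_int l" "k \<noteq> l" by (auto simp: grid_def)
  have "1 \<le> \<bar>k - l\<bar>" using kl(3) by simp
  then have "1 \<le> \<bar>real_of_int (k - l)\<bar>" by linarith
  then show ?thesis by (simp add: kl abs_if split: if_splits)
qed

text \<open>The abstract \<open>H\<close> and \<open>G\<close> allow two applications: to a bump
  \<open>ek \<nu>\<close> for the first Riesz product, and to its self-convolution for the second. A
  window reproduces only the matching frequency, and the recursions of \<open>rk\<close> and
  \<open>coef\<close> agree.\<close>

lemma cv_rk_coef:
  assumes H: "integrable lborel H" and \<nu>: "\<nu> \<in> grid"
    and base: "\<And>\<kappa> t. \<kappa> \<in> grid \<Longrightarrow> cv (rk 0 z \<kappa>) H t = of_bool (\<kappa> = \<nu>) * G t"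
  shows "\<kappa> \<in> grid \<Longrightarrow> cv (rk n z \<kappa>) H t = coef n z (\<nu> - \<kappa>) * G t"
proof (induction n arbitrary: \<kappa>)
  case 0
  then show ?case by (cases "\<kappa> = \<nu>") (simp_all add: base)
next
  case (Suc n)
  have IH: "cv (rk n z \<kappa>) H t = coef n z (\<nu> - \<kappa>) * G t"
    "cv (rk n z (\<kappa> + lam n)) H t = coef n z (\<nu> - \<kappa> - lam n) * G t"
    "cv (rk n z (\<kappa> - lam n)) H t = coef n z (\<nu> - \<kappa> + lam n) * G t"
    using Suc.IH[OF Suc.prems] Suc.IH[OF grid_add[OF Suc.prems grid_lam]] Suc.IH[OF grid_diff[OF Suc.prems grid_lam]]
    by (simp_all only: diff_diff_eq diff_diff_eq2 diff_add_eq add_diff_eq)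
  show ?case
    unfolding cv_rk_Suc[OF H] IH by (simp only: coef.simps distrib_right mult.assoc)
qed

text \<open>A window moved to the frequency \<open>\<nu>\<close>. It serves both as a function
  vanishing at infinity and, for \<open>\<nu> \<ge> 1\<close>, as an element of the Hardy
  space.\<close>

definition ek :: "real \<Rightarrow> real \<Rightarrow> complex" where "ek \<nu> t = of_real (fejer t) * cis (\<nu> * t)"

lemma rk_0_ek: "rk 0 z \<nu> = ek \<nu>"
  by (rule ext) (simp add: rk_def riesz_def ek_def)

lemma integrable_ek: "integrable lborel (ek \<nu>)"
  unfolding rk_0_ek[of undefined, symmetric] by (rule integrable_rk)

lemma ek_measurable [measurable]: "ek \<nu> \<in> borel_measurable borel"
  unfolding rk_0_ek[of undefined, symmetric] by simp

lemma continuous_on_ek: "continuous_on S (ek \<nu>)"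
  unfolding rk_0_ek[of undefined, symmetric] by (rule continuous_on_rk)

lemma norm_ek: "norm (ek \<nu> t) = fejer t"
  by (simp add: ek_def norm_mult fejer_nonneg)

lemma norm_ek_le: "norm (ek \<nu> t) \<le> 1"
  by (simp add: norm_ek fejer_le)

lemma fourier_ek: "1 \<le> \<bar>\<nu> - u\<bar> \<Longrightarrow> fourier (ek \<nu>) u = 0"
proof -
  assume "1 \<le> \<bar>\<nu> - u\<bar>"
  have "fourier (ek \<nu>) u = (LINT t|lborel. of_real (fejer t) * cis ((\<nu> - u) * t))"
    unfolding fourier_def ek_def
    by (intro Bochner_Integration.integral_cong refl)
      (simp add: cis_conv_exp exp_add[symmetric] algebra_simps exp_diff exp_minus divide_simps)
  then show ?thesis using fejer_fourier_zero \<open>1 \<le> \<bar>\<nu> - u\<bar>\<close> by simp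
qed

lemma ek_H1: "1 \<le> \<nu> \<Longrightarrow> ek \<nu> \<in> H1"
  by (auto simp: H1_def integrable_ek intro!: fourier_ek)

lemma cv_modulate: "cv (\<lambda>t. cis (\<nu> * t) * f t) (\<lambda>t. cis (\<nu> * t) * g t) t = cis (\<nu> * t) * cv f g t"
proof -
  have "cis (\<nu> * y) * cis (\<nu> * (t - y)) = cis (\<nu> * t)" for y
    by (simp add: cis_mult algebra_simps)
  then have eq: "cis (\<nu> * y) * f y * (cis (\<nu> * (t - y)) * g (t - y)) = cis (\<nu> * t) * (f y * g (t - y))" for y
    by (metis mult.assoc mult.left_commute)
  show ?thesis unfolding cv_def eq by (rule integral_mult_right_zero)
qed

text \<open>Self-convolutions of the window without modulation. The multiplier turns a bump into the
  profile \<open>f3\<close>, since each of the two Riesz products brings one more window.\<close>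

definition f1 :: "real \<Rightarrow> complex" where "f1 t = of_real (fejer t)"
definition f2 :: "real \<Rightarrow> complex" where "f2 = cv f1 f1"
definition f3 :: "real \<Rightarrow> complex" where "f3 = cv f1 f2"

lemma ek_f1: "ek \<nu> = (\<lambda>t. cis (\<nu> * t) * f1 t)"
  by (rule ext) (simp add: ek_def f1_def)

lemma cv_ek_same: "cv (ek \<nu>) (ek \<nu>) = (\<lambda>t. cis (\<nu> * t) * f2 t)"
  by (rule ext) (simp add: ek_f1 cv_modulate f2_def)

lemma cv_ek_cv_ek: "cv (ek \<nu>) (cv (ek \<nu>) (ek \<nu>)) = (\<lambda>t. cis (\<nu> * t) * f3 t)"
  unfolding cv_ek_same by (rule ext) (simp add: ek_f1 cv_modulate f3_def)

lemma cv_ek_ek: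
  assumes "\<kappa> \<in> grid" "\<nu> \<in> grid"
  shows "cv (ek \<kappa>) (ek \<nu>) t = of_bool (\<kappa> = \<nu>) * (cis (\<nu> * t) * f2 t)"
proof (cases "\<kappa> = \<nu>")
  case True
  then show ?thesis by (simp add: cv_ek_same)
next
  case False
  have "cv (ek \<kappa>) (ek \<nu>) t = 0"
    unfolding rk_0_ek[of undefined, symmetric, of \<kappa>] rk_0
  proof (rule cv_fejer_eq_0[OF integrable_ek])
    fix u assume "\<bar>u - \<kappa>\<bar> \<le> 1"
    then show "fourier (ek \<nu>) u = 0"
      using grid_dist[OF assms False] by (intro fourier_ek) linarith
  qed
  then show ?thesis using False by simp
qed

lemma cv_ek_cv_ek_ek:
  assumes "\<kappa> \<in> grid" "\<nu> \<in> grid"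
  shows "cv (ek \<kappa>) (cv (ek \<nu>) (ek \<nu>)) t = of_bool (\<kappa> = \<nu>) * (cis (\<nu> * t) * f3 t)"
proof (cases "\<kappa> = \<nu>")
  case True
  then show ?thesis by (simp add: cv_ek_cv_ek)
next
  case False
  have "cv (ek \<kappa>) (cv (ek \<nu>) (ek \<nu>)) t = cv (cv (ek \<kappa>) (ek \<nu>)) (ek \<nu>) t"
    by (rule cv_assoc[symmetric, OF integrable_ek integrable_ek _ norm_ek_le]) simp
  also have "cv (ek \<kappa>) (ek \<nu>) = (\<lambda>t. 0)"
    by (rule ext) (use False in \<open>simp add: cv_ek_ek[OF assms]\<close>)
  finally show ?thesis using False by (simp add: cv_def)
qed

text \<open>For even \<open>A\<close>, \<open>vk\<close> contributes \<open>z A * z B / 4\<close>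
  and the second product its conjugate, so the signs cancel for each \<open>z\<close> separately and
  1/16 remains.\<close>

lemma cv_mult_kernel_ek:
  assumes AB: "B < A" "A < N" and \<nu>: "\<nu> = lam A + lam B"
  shows "cv (mult_kernel N) (ek \<nu>) t = of_bool (even A) / 16 * (cis (\<nu> * t) * f3 t)"
proof -
  have g: "\<nu> \<in> grid" unfolding \<nu> by (intro grid_add grid_lam)
  have term_z: "cv (rk N (\<lambda>m. cnj (z m)) 0) (cv (vk N z) (ek \<nu>)) t
      = of_bool (even A) / 16 * (cis (\<nu> * t) * f3 t)" if z: "z \<in> root_seqs N" for z
  proof -
    have "cv (vk N z) (ek \<nu>) s = (of_bool (even A) * z A * z B / 4) * cv (ek \<nu>) (ek \<nu>) s" for s
    proof -
      have rk: "cv (rk m z (lam m)) (ek \<nu>) s = coef m z (\<nu> - lam m) * cv (ek \<nu>) (ek \<nu>) s" for m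
        by (rule cv_rk_coef[OF integrable_ek g _ grid_lam]) (simp add: rk_0_ek cv_ek_ek g)
      \<comment> \<open>Only the increment with index \<open>A\<close> sees \<open>\<nu>\<close>:
        for smaller \<open>m\<close> the remainder \<open>\<nu> - lam m\<close> is too large for the
        first \<open>m\<close> factors, for larger \<open>m\<close> it is too negative.\<close>
      have zero: "coef m z (\<nu> - lam m) = 0" if "m \<noteq> A" for m
      proof (cases "m < A")
        case True
        then show ?thesis
          using lam_eq_lsum[of m] lam_mono4[OF True] lam_pos[of m] lam_pos[of B] unfolding \<nu>
          by (intro coef_eq_0) linarith
      next
        case False
        then have "A < m" using that by simp
        then show ?thesis
          using lam_eq_lsum[of m] lam_mono4[OF \<open>A < m\<close>] lam_mono4[OF AB(1)] lam_pos[of A] lam_pos[of B] unfolding \<nu>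
          by (intro coef_eq_0) linarith
      qed
      have "cv (vk N z) (ek \<nu>) s
        = (\<Sum>m<N. if m = A then of_bool (even A) * (z A * (coef A z (\<nu> - lam A) * cv (ek \<nu>) (ek \<nu>) s / 2)) else 0)"
        unfolding cv_vk[OF integrable_ek] rk by (intro sum.cong refl) (simp add: zero)
      also have "\<dots> = of_bool (even A) * (z A * (coef A z (lam B) * cv (ek \<nu>) (ek \<nu>) s / 2))"
        using AB by (simp add: \<nu>)
      finally show ?thesis using AB by (simp add: coef_lam)
    qed
    then have eq: "cv (vk N z) (ek \<nu>) = (\<lambda>s. (of_bool (even A) * z A * z B / 4) * cv (ek \<nu>) (ek \<nu>) s)" by blast
    have "cv (rk N (\<lambda>m. cnj (z m)) 0) (cv (vk N z) (ek \<nu>)) t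
      = (of_bool (even A) * z A * z B / 4) * cv (rk N (\<lambda>m. cnj (z m)) 0) (cv (ek \<nu>) (ek \<nu>)) t"
      unfolding eq cv_def[of "rk N _ 0"] integral_mult_right_zero[symmetric]
      by (intro Bochner_Integration.integral_cong refl) (simp add: mult_ac)
    also have "cv (rk N (\<lambda>m. cnj (z m)) 0) (cv (ek \<nu>) (ek \<nu>)) t = coef N (\<lambda>m. cnj (z m)) (\<nu> - 0) * (cis (\<nu> * t) * f3 t)"
      by (rule cv_rk_coef[OF integrable_cv[OF integrable_ek integrable_ek] g _ grid_0])
        (simp add: rk_0_ek cv_ek_cv_ek_ek g)
    also have "coef N (\<lambda>m. cnj (z m)) (\<nu> - 0) = cnj (z A) * cnj (z B) / 4"
      using AB by (simp add: \<nu> coef_lam_add)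
    also have "of_bool (even A) * z A * z B / 4 * (cnj (z A) * cnj (z B) / 4 * (cis (\<nu> * t) * f3 t))
      = of_bool (even A) / 16 * ((z A * cnj (z A)) * (z B * cnj (z B))) * (cis (\<nu> * t) * f3 t)"
      by simp
    also have "(z A * cnj (z A)) * (z B * cnj (z B)) = 1"
      unfolding complex_norm_square[symmetric] norm_root_seqs[OF z] by simp
    finally show ?thesis by simp
  qed
  have "(\<Sum>z\<in>root_seqs N. cv (rk N (\<lambda>m. cnj (z m)) 0) (cv (vk N z) (ek \<nu>)) t)
      = (\<Sum>z\<in>root_seqs N. of_bool (even A) / 16 * (cis (\<nu> * t) * f3 t))"
    by (intro sum.cong refl term_z)
  then show ?thesis
    unfolding cv_mult_kernel[OF integrable_ek] by (simp add: card_root_seqs)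
qed

section \<open>The functionals\<close>

text \<open>The value at 0 of the convolution with the kernel, hence the reflection.\<close>

definition pairing :: "nat \<Rightarrow> (real \<Rightarrow> complex) \<Rightarrow> complex"
  where "pairing N F = (LINT s|lborel. F s * mult_kernel N (- s))"

definition kernel_mass :: "nat \<Rightarrow> real" where "kernel_mass N = (LINT s|lborel. norm (mult_kernel N s))"

lemma integrable_mult_kernel_minus: "integrable lborel (\<lambda>s. mult_kernel N (- s))"
  using integrable_reflect[OF integrable_mult_kernel[of N], of 0] by simp

lemma kernel_mass_minus: "(LINT s|lborel. norm (mult_kernel N (- s))) = kernel_mass N"
  unfolding kernel_mass_def using lborel_integral_real_affine[of "-1" "\<lambda>s. norm (mult_kernel N s)" 0] by simp

lemma integrable_pairing:
  assumes [measurable]: "F \<in> borel_measurable borel" and bd: "\<And>s. norm (F s) \<le> B"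
  shows "integrable lborel (\<lambda>s. F s * mult_kernel N (- s))"
  using integrable_cv_at[OF integrable_mult_kernel[of N] assms, of 0] by simp

lemma norm_pairing_integrand_le:
  assumes [measurable]: "F \<in> borel_measurable borel" and bd: "\<And>s. norm (F s) \<le> B"
  shows "(LINT s|lborel. norm (F s * mult_kernel N (- s))) \<le> B * kernel_mass N"
proof -
  have "(LINT s|lborel. norm (F s * mult_kernel N (- s))) \<le> (LINT s|lborel. B * norm (mult_kernel N (- s)))"
  proof (rule integral_mono)
    show "integrable lborel (\<lambda>s. norm (F s * mult_kernel N (- s)))"
      by (intro integrable_norm integrable_pairing[OF assms])
    show "integrable lborel (\<lambda>s. B * norm (mult_kernel N (- s)))"
      by (intro integrable_mult_right integrable_norm integrable_mult_kernel_minus)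
  qed (auto simp: norm_mult intro!: mult_right_mono bd)
  then show ?thesis by (simp add: kernel_mass_minus)
qed

lemma norm_pairing_le:
  assumes "F \<in> borel_measurable borel" "\<And>s. norm (F s) \<le> B"
  shows "norm (pairing N F) \<le> B * kernel_mass N"
  unfolding pairing_def by (rule order_trans[OF integral_norm_bound norm_pairing_integrand_le[OF assms]])

lemma pairing_sums:
  assumes F: "\<And>s. (\<lambda>k. G k s) sums F s"
    and m[measurable]: "\<And>k. G k \<in> borel_measurable borel" and bd: "\<And>k s. norm (G k s) \<le> b k"
    and b: "summable b"
  shows "(\<lambda>k. pairing N (G k)) sums pairing N F"
proof -
  have int: "integrable lborel (\<lambda>s. G k s * mult_kernel N (- s))" for k
    by (rule integrable_pairing[OF m bd])
  have s1: "summable (\<lambda>k. norm (G k s * mult_kernel N (- s)))" for s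
  proof (rule summable_comparison_test')
    show "summable (\<lambda>k. b k * norm (mult_kernel N (- s)))" by (intro summable_mult2 b)
  qed (auto simp: norm_mult intro!: mult_right_mono bd)
  have s2: "summable (\<lambda>k. LINT s|lborel. norm (G k s * mult_kernel N (- s)))"
  proof (rule summable_comparison_test')
    show "summable (\<lambda>k. b k * kernel_mass N)" by (intro summable_mult2 b)
    show "norm (LINT s|lborel. norm (G k s * mult_kernel N (- s))) \<le> b k * kernel_mass N" for k
      using norm_pairing_integrand_le[OF m bd, of k N] by (simp add: integral_nonneg_AE)
  qed
  have "(\<lambda>k. LINT s|lborel. G k s * mult_kernel N (- s)) sums (LINT s|lborel. (\<Sum>k. G k s * mult_kernel N (- s)))"
    by (rule sums_integral[OF int _ s2]) (simp add: s1)
  moreover have "(\<Sum>k. G k s * mult_kernel N (- s)) = F s * mult_kernel N (- s)" for s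
    using sums_mult2[OF F[of s], of "mult_kernel N (- s)"] by (simp add: sums_iff)
  ultimately show ?thesis by (simp add: pairing_def)
qed

text \<open>Fubini moves the kernel onto \<open>h\<close>, where the Hardy space estimate of the
  multiplier applies.\<close>

lemma pairing_cv:
  assumes [measurable]: "f \<in> borel_measurable borel" and bd: "\<And>s. norm (f s) \<le> B" and h: "integrable lborel h"
  shows "pairing N (cv f h) = (LINT t|lborel. f t * cv (mult_kernel N) h (- t))"
proof -
  note [measurable] = borel_measurable_integrable[OF h] borel_measurable_integrable[OF integrable_mult_kernel]
  have hm: "integrable lborel (\<lambda>x. h (- x))" using integrable_reflect[OF h, of 0] by simp
  have pair: "integrable (lborel \<Otimes>\<^sub>M lborel) (\<lambda>(t, s). mult_kernel N (- s) * h (s - t))"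
    using integrable_cv_pair[OF integrable_mult_kernel_minus hm] by simp
  have int: "integrable (lborel \<Otimes>\<^sub>M lborel) (\<lambda>(t, s). f t * (mult_kernel N (- s) * h (s - t)))"
  proof (rule Bochner_Integration.integrable_bound)
    show "integrable (lborel \<Otimes>\<^sub>M lborel) (\<lambda>q. of_real B * (case q of (t, s) \<Rightarrow> mult_kernel N (- s) * h (s - t)))"
      by (intro integrable_mult_right pair)
    have "norm (f t * c) \<le> norm (of_real B * c)" for t and c :: complex
      using order_trans[OF bd abs_ge_self] by (simp add: norm_mult mult_right_mono)
    then show "AE q in lborel \<Otimes>\<^sub>M lborel. norm (case q of (t, s) \<Rightarrow> f t * (mult_kernel N (- s) * h (s - t)))
        \<le> norm (of_real B * (case q of (t, s) \<Rightarrow> mult_kernel N (- s) * h (s - t)))"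
      by (intro AE_I2) (auto split: prod.splits)
  qed simp
  have "pairing N (cv f h) = (LINT s|lborel. LINT t|lborel. f t * (mult_kernel N (- s) * h (s - t)))"
    unfolding pairing_def cv_def integral_mult_left_zero[symmetric] by (simp add: mult_ac)
  also have "\<dots> = (LINT t|lborel. LINT s|lborel. f t * (mult_kernel N (- s) * h (s - t)))"
    by (rule lborel_pair.Fubini_integral[OF int])
  also have "\<dots> = (LINT t|lborel. f t * cv (mult_kernel N) h (- t))"
  proof -
    have "(LINT s|lborel. mult_kernel N (- s) * h (s - t)) = cv (mult_kernel N) h (- t)" for t
      unfolding cv_def
      using lborel_integral_real_affine[of "-1" "\<lambda>s. mult_kernel N (- s) * h (s - t)" 0]
      by (simp add: minus_diff_commute)
    then show ?thesis by simp
  qed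
  finally show ?thesis .
qed

lemma norm_pairing_cv_le:
  assumes f: "f \<in> borel_measurable borel" and bd: "\<And>s. norm (f s) \<le> B" and h: "h \<in> H1"
  shows "norm (pairing N (cv f h)) \<le> B * (8 * fejer_mass\<^sup>2 * L1_norm h)"
proof -
  have hi: "integrable lborel h" using h by (simp add: H1_def)
  have B: "0 \<le> B" using order_trans[OF norm_ge_zero bd] .
  let ?g = "cv (mult_kernel N) h"
  have gi: "integrable lborel ?g" by (intro integrable_cv integrable_mult_kernel hi)
  have gm: "integrable lborel (\<lambda>t. ?g (- t))" using integrable_reflect[OF gi, of 0] by simp
  have "norm (pairing N (cv f h)) \<le> (LINT t|lborel. norm (f t * ?g (- t)))"
    unfolding pairing_cv[OF f bd hi] by (rule integral_norm_bound)
  also have "\<dots> \<le> (LINT t|lborel. B * norm (?g (- t)))"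
  proof (rule integral_mono)
    have "integrable lborel (\<lambda>t. f t * ?g (0 - t))" by (rule integrable_cv_at[OF gi f bd])
    then show "integrable lborel (\<lambda>t. norm (f t * ?g (- t)))" by (intro integrable_norm) simp
  qed (use gm in \<open>auto simp: norm_mult intro!: mult_right_mono bd\<close>)
  also have "\<dots> = B * (LINT t|lborel. norm (?g t))"
    using lborel_integral_real_affine[of "-1" "\<lambda>t. norm (?g t)" 0] by simp
  also have "\<dots> \<le> B * (8 * fejer_mass\<^sup>2 * L1_norm h)"
    by (intro mult_left_mono mult_kernel_bound h B)
  finally show ?thesis .
qed

lemma norm_cv_le:
  assumes f: "f \<in> borel_measurable borel" and bd: "\<And>s. norm (f s) \<le> B" and hi: "integrable lborel h"
  shows "norm (cv f h s) \<le> B * L1_norm h"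
proof -
  have "norm (cv f h s) \<le> (LINT t|lborel. norm (f t * h (s - t)))"
    unfolding cv_def by (rule integral_norm_bound)
  also have "\<dots> \<le> (LINT t|lborel. B * norm (h (s - t)))"
  proof (rule integral_mono)
    show "integrable lborel (\<lambda>t. norm (f t * h (s - t)))"
      by (intro integrable_norm integrable_cv_at[OF hi f bd])
    show "integrable lborel (\<lambda>t. B * norm (h (s - t)))"
      by (intro integrable_mult_right integrable_norm integrable_reflect hi)
  qed (auto simp: norm_mult intro!: mult_right_mono bd)
  also have "\<dots> = B * L1_norm h"
    using lborel_integral_real_affine[of "-1" "\<lambda>t. norm (h t)" s] by (simp add: L1_norm_def)
  finally show ?thesis .
qed

lemma cv_measurable:
  assumes [measurable]: "f \<in> borel_measurable borel" "h \<in> borel_measurable borel"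
  shows "cv f h \<in> borel_measurable borel"
  unfolding cv_def[abs_def] by measurable

text \<open>The constant does not depend on \<open>N\<close>. Summability of the costs dominates the
  series uniformly, so the functional may be applied term by term.\<close>

lemma norm_pairing_A0_le:
  assumes c: "c \<in> A0_costs F"
  shows "norm (pairing N F) \<le> 8 * fejer_mass\<^sup>2 * c"
proof -
  obtain f h where fh: "\<And>k::nat. f k \<in> C0 \<and> h k \<in> H1" "summable (\<lambda>k. norm (f k) * L1_norm (h k))"
    "\<And>s. (\<lambda>k. conv (f k) (h k) s) sums F s" and c: "c = (\<Sum>k. norm (f k) * L1_norm (h k))"
    using c unfolding A0_costs_def by blast
  have conv: "conv (f k) (h k) = cv (apply_bcontfun (f k)) (h k)" for k
    by (rule ext) (simp add: conv_def cv_def)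
  have hi: "integrable lborel (h k)" for k using fh(1) by (simp add: H1_def)
  have fm: "apply_bcontfun (f k) \<in> borel_measurable borel" for k
    by (intro borel_measurable_continuous_onI continuous_on_apply_bcontfun)
  have fb: "norm (apply_bcontfun (f k) s) \<le> norm (f k)" for k s by (rule norm_bounded)
  have sums: "(\<lambda>k. pairing N (conv (f k) (h k))) sums pairing N F"
    by (rule pairing_sums[OF fh(3) _ _ fh(2)])
      (use hi borel_measurable_integrable in \<open>auto simp: conv intro!: cv_measurable fm norm_cv_le fb\<close>)
  have le: "norm (pairing N (conv (f k) (h k))) \<le> 8 * fejer_mass\<^sup>2 * (norm (f k) * L1_norm (h k))" for k
    using norm_pairing_cv_le[OF fm[of k] fb[of k], of "h k" N] fh(1)[of k] by (simp add: conv mult_ac)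
  have sm: "summable (\<lambda>k. 8 * fejer_mass\<^sup>2 * (norm (f k) * L1_norm (h k)))"
    by (intro summable_mult fh(2))
  have sn: "summable (\<lambda>k. norm (pairing N (conv (f k) (h k))))"
    by (rule summable_comparison_test'[OF sm]) (use le in simp)
  have "norm (pairing N F) \<le> (\<Sum>k. norm (pairing N (conv (f k) (h k))))"
    using sums summable_norm[OF sn] by (simp add: sums_iff)
  also have "\<dots> \<le> (\<Sum>k. 8 * fejer_mass\<^sup>2 * (norm (f k) * L1_norm (h k)))"
    by (intro suminf_le le sn sm)
  also have "\<dots> = 8 * fejer_mass\<^sup>2 * c"
    unfolding c by (rule suminf_mult[OF fh(2)])
  finally show ?thesis .
qed

section \<open>Scalar functions as operator-valued functions\<close>

definition op_bcont :: "nat \<Rightarrow> (real \<Rightarrow> nat \<Rightarrow> nat \<Rightarrow> complex) \<Rightarrow> real \<Rightarrow>\<^sub>C ell2_op"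
  where "op_bcont N m = Bcontfun (\<lambda>t. fin_op N (m t))"

lemma op_bcont:
  assumes cont: "\<And>a b. a < N \<Longrightarrow> b < N \<Longrightarrow> continuous_on UNIV (\<lambda>t. m t a b)"
    and bd: "\<And>t. norm (fin_op N (m t)) \<le> C"
  shows "apply_bcontfun (op_bcont N m) t = fin_op N (m t)" "norm (op_bcont N m) \<le> C"
    and "(\<And>a b. a < N \<Longrightarrow> b < N \<Longrightarrow> ((\<lambda>t. m t a b) \<longlongrightarrow> 0) at_infinity) \<Longrightarrow> op_bcont N m \<in> C0_compact"
proof -
  have "(\<lambda>t. fin_op N (m t)) \<in> bcontfun"
    by (rule bcontfun_normI[OF continuous_on_fin_op[OF cont] bd])
  then have app: "apply_bcontfun (op_bcont N m) = (\<lambda>t. fin_op N (m t))"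
    unfolding op_bcont_def by (rule Bcontfun_inverse)
  then show "apply_bcontfun (op_bcont N m) t = fin_op N (m t)" by simp
  show "norm (op_bcont N m) \<le> C" by (rule norm_bound) (simp add: app bd)
  assume "\<And>a b. a < N \<Longrightarrow> b < N \<Longrightarrow> ((\<lambda>t. m t a b) \<longlongrightarrow> 0) at_infinity"
  then have "((\<lambda>t. fin_op N (m t)) \<longlongrightarrow> fin_op N (\<lambda>a b. 0)) at_infinity"
    by (rule tendsto_fin_op)
  then show "op_bcont N m \<in> C0_compact"
    by (simp add: C0_compact_def app fin_op_compact fin_op_zero)
qed

lemma zero_C0_compact: "0 \<in> C0_compact"
  using fin_op_compact[of 0 "\<lambda>_ _. 0"] by (simp add: C0_compact_def fin_op_zero)

lemma conv_trace_fin_op: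
  assumes "\<And>t. apply_bcontfun f t = fin_op N (m t)"
  shows "conv_trace f (\<lambda>t. fin_op N (m' t)) s = (LINT t|lborel. (\<Sum>i<N. \<Sum>j<N. m t i j * m' (s - t) j i))"
  by (simp add: conv_trace_def assms fin_op_compose trace_op_fin_op)

text \<open>Scalars embed as 1 by 1 corner matrices: the trace of a product is the scalar product,
  and neither norm increases.\<close>

lemma A0_subset_A0_trace: "A0 \<subseteq> A0_trace"
proof
  fix F assume "F \<in> A0"
  then obtain f h where fh: "\<And>k::nat. f k \<in> C0 \<and> h k \<in> H1" "summable (\<lambda>k. norm (f k) * L1_norm (h k))"
    "\<And>s. (\<lambda>k. conv (f k) (h k) s) sums F s"
    unfolding A0_def A0_costs_def by blast
  define g where "g k = op_bcont 1 (\<lambda>t a b. apply_bcontfun (f k) t)" for k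
  define q where "q k = (\<lambda>t. fin_op 1 (\<lambda>a b. h k t))" for k
  have bd: "norm (fin_op 1 (\<lambda>a b. apply_bcontfun (f k) t)) \<le> norm (f k)" for k t
    using norm_fin_op_le_sum[of 1 "\<lambda>a b. apply_bcontfun (f k) t"] norm_bounded[of "f k" t] by simp
  have g: "apply_bcontfun (g k) t = fin_op 1 (\<lambda>a b. apply_bcontfun (f k) t)" "norm (g k) \<le> norm (f k)"
    "g k \<in> C0_compact" for k t
    using op_bcont[of 1 "\<lambda>t a b. apply_bcontfun (f k) t" "norm (f k)", OF _ bd] fh(1)[of k]
    by (simp_all add: g_def C0_def)
  have q: "q k \<in> H1_trace" "L1_trace_norm (q k) = L1_norm (h k)" for k
  proof -
    have int: "integrable lborel (\<lambda>t. sqrt (\<Sum>a<(1::nat). (cmod (h k t))\<^sup>2) * sqrt (\<Sum>b<(1::nat). (cmod 1)\<^sup>2))"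
      using fh(1)[of k] by (simp add: H1_def)
    show "q k \<in> H1_trace" "L1_trace_norm (q k) = L1_norm (h k)"
      unfolding q_def using fin_op_H1_trace[of 1 "\<lambda>t a b. h k t" "\<lambda>t a. h k t" "\<lambda>t b. 1", OF _ _ int] fh(1)
      by (simp_all add: L1_norm_def)
  qed
  have "conv_trace (g k) (q k) s = conv (f k) (h k) s" for k s
    unfolding q_def by (subst conv_trace_fin_op[OF g(1)]) (simp add: conv_def)
  then have "(\<lambda>k. conv_trace (g k) (q k) s) sums F s" for s using fh(3) by simp
  moreover have "summable (\<lambda>k. norm (g k) * L1_trace_norm (q k))"
  proof (rule summable_comparison_test'[OF fh(2)])
    have "0 \<le> L1_norm (h k)" for k unfolding L1_norm_def by (intro integral_nonneg_AE) simp
    then show "norm (norm (g k) * L1_trace_norm (q k)) \<le> norm (f k) * L1_norm (h k)" for k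
      using g(2) by (simp add: q abs_mult mult_right_mono)
  qed
  ultimately have "(\<Sum>k. norm (g k) * L1_trace_norm (q k)) \<in> A0_trace_costs F"
    unfolding A0_trace_costs_def using g(3) q(1) by blast
  then show "F \<in> A0_trace" by (auto simp: A0_trace_def)
qed

section \<open>Hilbert's inequality\<close>

definition trig :: "int \<Rightarrow> real \<Rightarrow> complex" where "trig n \<theta> = cis (2 * pi * of_int n * \<theta>)"

lemma trig_add: "trig (m + n) \<theta> = trig m \<theta> * trig n \<theta>"
  by (simp add: trig_def cis_mult algebra_simps)

lemma cnj_trig: "cnj (trig n \<theta>) = trig (- n) \<theta>"
  by (simp add: trig_def cis_cnj)

lemma trig_ends: "trig n 0 = 1" "trig n 1 = 1"
  by (simp_all add: trig_def cis_multiple_2pi)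

lemma trig_derivative:
  "(trig n has_vector_derivative (2 * pi * \<i> * of_int n * trig n \<theta>)) (at \<theta> within S)"
  unfolding has_vector_derivative_complex_iff trig_def
  by (auto intro!: derivative_eq_intros)

lemma trig_integral: "(trig n has_integral of_bool (n = 0)) {0..1}"
proof (cases "n = 0")
  case True
  have "((\<lambda>\<theta>. 1 :: complex) has_integral 1) {0..1::real}"
    using has_integral_const_real[of "1::complex" 0 1] by simp
  then show ?thesis using True by (simp add: trig_def[abs_def])
next
  case False
  define c where "c = 2 * pi * \<i> * of_int n"
  have c: "c \<noteq> 0" using False by (simp add: c_def)
  have "((\<lambda>\<theta>. c * trig n \<theta> / c) has_integral (trig n 1 / c - trig n 0 / c)) {0..1}"
    using trig_derivative by (intro fundamental_theorem_of_calculus has_vector_derivative_divide) (auto simp: c_def)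
  then show ?thesis using False c by (simp add: trig_ends)
qed

text \<open>The sawtooth is the bounded symbol behind Hilbert's matrix: \<open>2 * pi\<close> times
  its maximum modulus 1/2 is the constant \<open>pi\<close> of the inequality.\<close>

lemma sawtooth_integral:
  "((\<lambda>\<theta>. of_real (\<theta> - 1/2) * trig n \<theta>) has_integral (if n = 0 then 0 else 1 / (2 * pi * \<i> * of_int n))) {0..1}"
proof (cases "n = 0")
  case True
  define G where "G \<theta> = complex_of_real (\<theta>\<^sup>2 / 2 - \<theta> / 2)" for \<theta> :: real
  have "((\<lambda>\<theta>. complex_of_real (\<theta> - 1/2)) has_integral (G 1 - G 0)) {0..1}"
    unfolding G_def
    by (rule fundamental_theorem_of_calculus)
      (auto simp: has_vector_derivative_complex_iff intro!: derivative_eq_intros)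
  then show ?thesis using True by (simp add: trig_def[abs_def] G_def)
next
  case False
  define c where "c = 2 * pi * \<i> * of_int n"
  have c: "c \<noteq> 0" using False by (simp add: c_def)
  define G where "G \<theta> = of_real (\<theta> - 1/2) * (trig n \<theta> / c) - trig n \<theta> / c / c" for \<theta>
  have "((\<lambda>\<theta>. of_real (\<theta> - 1/2) * trig n \<theta>) has_integral (G 1 - G 0)) {0..1}"
  proof (rule fundamental_theorem_of_calculus)
    fix \<theta> :: real assume "\<theta> \<in> {0..1}"
    have d1: "((\<lambda>\<theta>. trig n \<theta> / c) has_vector_derivative (c * trig n \<theta> / c)) (at \<theta> within {0..1})"
      using trig_derivative unfolding c_def by (rule has_vector_derivative_divide)
    have d2: "((\<lambda>\<theta>. complex_of_real (\<theta> - 1/2)) has_vector_derivative 1) (at \<theta> within {0..1})"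
      by (auto simp: has_vector_derivative_complex_iff intro!: derivative_eq_intros)
    have "(G has_vector_derivative (of_real (\<theta> - 1/2) * (c * trig n \<theta> / c) + 1 * (trig n \<theta> / c) - c * trig n \<theta> / c / c)) (at \<theta> within {0..1})"
      unfolding G_def[abs_def]
      by (intro has_vector_derivative_diff has_vector_derivative_mult has_vector_derivative_divide d1 d2)
    then show "(G has_vector_derivative (of_real (\<theta> - 1/2) * trig n \<theta>)) (at \<theta> within {0..1})"
      using c by simp
  qed simp
  moreover have "G 1 - G 0 = 1 / c" by (simp add: G_def trig_ends field_simps)
  ultimately show ?thesis using False by (simp add: c_def)
qed

lemma parseval:
  assumes k: "inj_on k {..<N::nat}"
  shows "((\<lambda>\<theta>. (cmod (\<Sum>b<N. x b * trig (k b) \<theta>))\<^sup>2) has_integral (\<Sum>b<N. (cmod (x b))\<^sup>2)) {0..1}"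
proof -
  have eq: "complex_of_real ((cmod (\<Sum>b<N. x b * trig (k b) \<theta>))\<^sup>2)
      = (\<Sum>b<N. \<Sum>a<N. x b * cnj (x a) * trig (k b - k a) \<theta>)" for \<theta>
    unfolding complex_norm_square cnj_sum sum_product
    by (simp add: cnj_trig trig_add[of _ "- _", simplified] mult_ac)
  have "((\<lambda>\<theta>. \<Sum>b<N. \<Sum>a<N. x b * cnj (x a) * trig (k b - k a) \<theta>)
      has_integral (\<Sum>b<N. \<Sum>a<N. x b * cnj (x a) * of_bool (k b - k a = 0))) {0..1}"
    by (intro has_integral_sum has_integral_mult_right trig_integral) auto
  also have "(\<Sum>b<N. \<Sum>a<N. x b * cnj (x a) * of_bool (k b - k a = 0)) = (\<Sum>b<N. \<Sum>a<N. if a = b then x b * cnj (x a) else 0)"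
    using k by (intro sum.cong refl) (auto simp: inj_on_def)
  also have "\<dots> = of_real (\<Sum>b<N. (cmod (x b))\<^sup>2)"
    by (simp add: complex_norm_square del: of_real_power)
  finally have "((\<lambda>\<theta>. complex_of_real ((cmod (\<Sum>b<N. x b * trig (k b) \<theta>))\<^sup>2)) has_integral of_real (\<Sum>b<N. (cmod (x b))\<^sup>2)) {0..1}"
    by (simp only: eq)
  from has_integral_Re[OF this] show ?thesis by simp
qed

definition hilb :: "nat \<Rightarrow> nat \<Rightarrow> real" where "hilb a b = (if a = b then 0 else 1 / (real a - real b))"

text \<open>The sum is \<open>2 * pi * \<i>\<close> times the integral of the sawtooth against
  trigonometric polynomials \<open>p\<close>, \<open>q\<close> with coefficients \<open>x\<close>,
  \<open>y\<close>. A weighted mean inequality under the integral and Parseval's identity give the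
  bound.\<close>

lemma hilbert_inequality:
  fixes x y :: "nat \<Rightarrow> complex"
  shows "cmod (\<Sum>a<N. \<Sum>b<N. hilb a b * x b * y a) \<le> pi * sqrt (\<Sum>b<N. (cmod (x b))\<^sup>2) * sqrt (\<Sum>a<N. (cmod (y a))\<^sup>2)"
proof -
  define X where "X = (\<Sum>b<N. (cmod (x b))\<^sup>2)"
  define Y where "Y = (\<Sum>a<N. (cmod (y a))\<^sup>2)"
  have nonneg: "0 \<le> X" "0 \<le> Y" unfolding X_def Y_def by (intro sum_nonneg; simp)+
  show ?thesis
  proof (cases "X = 0 \<or> Y = 0")
    case True
    have zero: "\<forall>b\<in>{..<N}. (cmod (u b))\<^sup>2 = 0" if "(\<Sum>b<N. (cmod (u b))\<^sup>2) = 0" for u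
      by (rule sum_nonneg_eq_0_iff[THEN iffD1]) (use that in auto)
    have "(\<forall>b\<in>{..<N}. (cmod (x b))\<^sup>2 = 0) \<or> (\<forall>b\<in>{..<N}. (cmod (y b))\<^sup>2 = 0)"
      using True zero unfolding X_def Y_def by blast
    then have "(\<Sum>a<N. \<Sum>b<N. hilb a b * x b * y a) = 0"
      by (intro sum.neutral ballI) auto
    then show ?thesis using nonneg by (simp add: X_def[symmetric] Y_def[symmetric])
  next
    case False
    then have pos: "0 < X" "0 < Y" using nonneg by auto
    define p where "p \<theta> = (\<Sum>b<N. x b * trig (- int b) \<theta>)" for \<theta>
    define q where "q \<theta> = (\<Sum>a<N. y a * trig (int a) \<theta>)" for \<theta>
    have P: "((\<lambda>\<theta>. (cmod (p \<theta>))\<^sup>2) has_integral X) {0..1}"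
      unfolding p_def X_def by (rule parseval) (auto simp: inj_on_def)
    have Q: "((\<lambda>\<theta>. (cmod (q \<theta>))\<^sup>2) has_integral Y) {0..1}"
      unfolding q_def Y_def by (rule parseval) (auto simp: inj_on_def)
    have h: "complex_of_real (hilb a b) = 2 * pi * \<i> * (if int a - int b = 0 then 0 else 1 / (2 * pi * \<i> * of_int (int a - int b)))" for a b
      by (simp add: hilb_def)
    have "((\<lambda>\<theta>. \<Sum>a<N. \<Sum>b<N. (x b * y a) * (of_real (\<theta> - 1/2) * trig (int a - int b) \<theta>))
      has_integral (\<Sum>a<N. \<Sum>b<N. (x b * y a) * (if int a - int b = 0 then 0 else 1 / (2 * pi * \<i> * of_int (int a - int b))))) {0..1}"
      by (intro has_integral_sum has_integral_mult_right sawtooth_integral) auto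
    moreover have "(\<Sum>a<N. \<Sum>b<N. (x b * y a) * (of_real (\<theta> - 1/2) * trig (int a - int b) \<theta>)) = of_real (\<theta> - 1/2) * (q \<theta> * p \<theta>)" for \<theta>
    proof -
      have "trig (int a - int b) \<theta> = trig (int a) \<theta> * trig (- int b) \<theta>" for a b
        using trig_add[of "int a" "- int b" \<theta>] by simp
      then show ?thesis
        unfolding q_def p_def sum_product unfolding sum_distrib_left
        by (intro sum.cong refl) (simp only: mult_ac)
    qed
    ultimately have I: "((\<lambda>\<theta>. of_real (\<theta> - 1/2) * (q \<theta> * p \<theta>)) has_integral
      (\<Sum>a<N. \<Sum>b<N. (x b * y a) * (if int a - int b = 0 then 0 else 1 / (2 * pi * \<i> * of_int (int a - int b))))) {0..1}"
      (is "(_ has_integral ?J) _") by simp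
    \<comment> \<open>The weight that balances the two terms of the bound; it requires
      \<open>X\<close> and \<open>Y\<close> to be positive, hence the case split.\<close>
    define r where "r = sqrt Y / sqrt X"
    have r: "0 < r" using pos by (simp add: r_def)
    have bound: "((\<lambda>\<theta>. (r / 4) * (cmod (p \<theta>))\<^sup>2 + (1 / (4 * r)) * (cmod (q \<theta>))\<^sup>2) has_integral (r / 4) * X + (1 / (4 * r)) * Y) {0..1}"
      by (intro has_integral_add has_integral_mult_right P Q)
    have "cmod ?J \<le> (r / 4) * X + (1 / (4 * r)) * Y"
    proof -
      have "norm (integral {0..1} (\<lambda>\<theta>. of_real (\<theta> - 1/2) * (q \<theta> * p \<theta>)))
        \<le> integral {0..1} (\<lambda>\<theta>. (r / 4) * (cmod (p \<theta>))\<^sup>2 + (1 / (4 * r)) * (cmod (q \<theta>))\<^sup>2)"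
      proof (rule integral_norm_bound_integral)
        show "(\<lambda>\<theta>. of_real (\<theta> - 1/2) * (q \<theta> * p \<theta>)) integrable_on {0..1}" using I by blast
        show "(\<lambda>\<theta>. (r / 4) * (cmod (p \<theta>))\<^sup>2 + (1 / (4 * r)) * (cmod (q \<theta>))\<^sup>2) integrable_on {0..1}" using bound by blast
        fix \<theta> :: real assume "\<theta> \<in> {0..1}"
        then have "\<bar>\<theta> - 1/2\<bar> \<le> 1/2" unfolding abs_diff_le_iff by auto
        then have "norm (of_real (\<theta> - 1/2) * (q \<theta> * p \<theta>)) \<le> 1/2 * (cmod (q \<theta>) * cmod (p \<theta>))"
          unfolding norm_mult norm_of_real by (rule mult_right_mono) simp
        also have "\<dots> \<le> (r / 4) * (cmod (p \<theta>))\<^sup>2 + (1 / (4 * r)) * (cmod (q \<theta>))\<^sup>2"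
        proof -
          have "0 \<le> (r * cmod (p \<theta>) - cmod (q \<theta>))\<^sup>2 / (4 * r)" using r by simp
          also have "\<dots> = (r / 4) * (cmod (p \<theta>))\<^sup>2 + (1 / (4 * r)) * (cmod (q \<theta>))\<^sup>2 - 1/2 * (cmod (q \<theta>) * cmod (p \<theta>))"
            using r by (simp add: field_simps power2_eq_square)
          finally show ?thesis by simp
        qed
        finally show "norm (of_real (\<theta> - 1/2) * (q \<theta> * p \<theta>)) \<le> (r / 4) * (cmod (p \<theta>))\<^sup>2 + (1 / (4 * r)) * (cmod (q \<theta>))\<^sup>2" .
      qed
      then show ?thesis using I bound by (simp add: integral_unique)
    qed
    also have "(r / 4) * X + (1 / (4 * r)) * Y = sqrt X * sqrt Y / 2"
    proof -
      have "r * X = sqrt X * sqrt Y" "Y / r = sqrt X * sqrt Y"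
        using pos unfolding r_def by (simp_all add: real_div_sqrt field_simps)
      then show ?thesis by (simp add: field_simps)
    qed
    finally have J: "cmod ?J \<le> sqrt X * sqrt Y / 2" .
    have "(\<Sum>a<N. \<Sum>b<N. hilb a b * x b * y a) = 2 * pi * \<i> * ?J"
      unfolding h sum_distrib_left by (intro sum.cong refl) (simp only: mult_ac)
    then have "cmod (\<Sum>a<N. \<Sum>b<N. hilb a b * x b * y a) = 2 * pi * cmod ?J"
      by (simp only: norm_mult) simp
    also have "\<dots> \<le> 2 * pi * (sqrt X * sqrt Y / 2)" using J by (intro mult_left_mono) auto
    finally show ?thesis by (simp add: X_def Y_def mult.assoc)
  qed
qed

section \<open>A gliding hump\<close>

text \<open>Read \<open>l M i\<close> as the functional \<open>M\<close> on the test function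
  \<open>i\<close>. Under the functional with index \<open>n (Suc k)\<close> its own term dominates:
  the earlier terms total at most \<open>S k\<close>, and later weights are small against every
  constant \<open>\<kappa>\<close> met before.\<close>

lemma gliding_hump:
  fixes l :: "nat \<Rightarrow> nat \<Rightarrow> complex"
  assumes \<kappa>: "\<And>M i. norm (l M i) \<le> \<kappa> M" and b: "\<And>M i. norm (l M i) \<le> b i"
    and unb: "\<And>R. \<exists>n. R \<le> norm (l n n)"
  obtains e :: "nat \<Rightarrow> real" and n :: "nat \<Rightarrow> nat"
  where "\<And>k. 0 \<le> e k" "summable e" "\<And>R. \<exists>M. R < norm (\<Sum>k. e k * l M (n k))"
proof -
  have nonneg: "0 \<le> \<kappa> M" "0 \<le> b i" for M i using order_trans[OF norm_ge_zero] \<kappa> b by blast+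
  text \<open>The state at step \<open>k\<close> consists of the index \<open>n k\<close>, the weight \<open>e k\<close>, a common bound of
    \<open>\<kappa> (n j)\<close> for \<open>j \<le> k\<close>, and the sum of \<open>e j * b (n j)\<close> over \<open>j \<le> k\<close>.\<close>
  define P where "P k x = (case x of (n, e, K, S) \<Rightarrow>
    0 < e \<and> 1 + \<kappa> n \<le> K \<and> (k = 0 \<longrightarrow> S = e * b n))" for k :: nat and x :: "nat \<times> real \<times> real \<times> real"
  define Q where "Q k x y = (case x of (n, e, K, S) \<Rightarrow> case y of (n', e', K', S') \<Rightarrow>
    e' = (1/2) ^ Suc k / K \<and> K' = K + \<kappa> n' \<and> S' = S + e' * b n' \<and> real (Suc k) + S + 2 \<le> e' * norm (l n' n'))"
    for k :: nat and x y :: "nat \<times> real \<times> real \<times> real"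
  have "\<exists>f. \<forall>k. P k (f k) \<and> Q k (f k) (f (Suc k))"
  proof (rule dependent_nat_choice)
    show "\<exists>x. P 0 x"
      by (intro exI[of _ "(0, 1, 1 + \<kappa> 0, 1 * b 0)"]) (simp add: P_def)
    fix x and k assume Px: "P k x"
    obtain n e K S where x: "x = (n, e, K, S)" by (metis prod.exhaust)
    have K: "1 \<le> K" using Px nonneg(1)[of n] unfolding P_def x by auto
    define e' where "e' = (1/2) ^ Suc k / K"
    have e': "0 < e'" using K by (simp add: e'_def)
    obtain n' where n': "(real (Suc k) + S + 2) / e' \<le> norm (l n' n')" using unb by blast
    then have "real (Suc k) + S + 2 \<le> e' * norm (l n' n')" using e' by (simp add: field_simps)
    then show "\<exists>y. P (Suc k) y \<and> Q k x y"
      using e' K by (intro exI[of _ "(n', e', K + \<kappa> n', S + e' * b n')"]) (simp add: P_def Q_def x e'_def)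
  qed
  then obtain f where f: "\<And>k. P k (f k)" "\<And>k. Q k (f k) (f (Suc k))" by blast
  define n where "n k = fst (f k)" for k
  define e where "e k = fst (snd (f k))" for k
  define K where "K k = fst (snd (snd (f k)))" for k
  define S where "S k = snd (snd (snd (f k)))" for k
  have fk: "f k = (n k, e k, K k, S k)" for k by (simp add: n_def e_def K_def S_def)
  have e: "0 < e k" and K1: "1 + \<kappa> (n k) \<le> K k" and S0: "S 0 = e 0 * b (n 0)" for k
    using f(1)[of k] f(1)[of 0] unfolding P_def fk by auto
  have eS: "e (Suc k) = (1/2) ^ Suc k / K k" and KS: "K (Suc k) = K k + \<kappa> (n (Suc k))"
    and SS: "S (Suc k) = S k + e (Suc k) * b (n (Suc k))"
    and big: "real (Suc k) + S k + 2 \<le> e (Suc k) * norm (l (n (Suc k)) (n (Suc k)))" for k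
    using f(2)[of k] unfolding Q_def fk by auto
  have S: "S k = (\<Sum>j<Suc k. e j * b (n j))" for k
    by (induction k) (simp_all add: S0 SS)
  have Kmono: "K j \<le> K k" if "j \<le> k" for j k
    using that by (rule lift_Suc_mono_le[of K, rotated]) (simp add: KS nonneg)
  have K0: "1 \<le> K k" "\<kappa> (n k) \<le> K k" for k using K1[of k] nonneg(1)[of "n k"] by linarith+
  \<comment> \<open>\<open>e j\<close> was divided by a bound that already includes
    \<open>\<kappa> (n k)\<close> for all \<open>k < j\<close>.\<close>
  have tail: "e j * \<kappa> (n k) \<le> (1/2) ^ j" if "k < j" for j k
  proof -
    define i where "i = j - 1"
    have i: "j = Suc i" "k \<le> i" using that by (simp_all add: i_def)
    have "\<kappa> (n k) \<le> K i" using K0(2)[of k] Kmono[OF i(2)] by linarith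
    then have "(1/2) ^ j / K i * \<kappa> (n k) \<le> (1/2) ^ j / K i * K i"
      using K0(1)[of i] by (intro mult_left_mono) auto
    then show ?thesis using K0(1)[of i] by (simp add: i(1) eS)
  qed
  have geo: "summable (\<lambda>k. (1/2) ^ k :: real)" by (rule summable_geometric) simp
  have es: "summable e"
  proof (rule summable_comparison_test'[OF geo, of 1])
    fix k :: nat assume "1 \<le> k"
    then obtain i where i: "k = Suc i" by (cases k) auto
    have "(1/2) ^ Suc i / K i \<le> (1/2) ^ Suc i / 1"
      using K0(1)[of i] by (intro divide_left_mono) auto
    then show "norm (e k) \<le> (1/2) ^ k" using e[of k] by (simp add: i eS)
  qed
  have "\<exists>M. R < norm (\<Sum>k. e k * l M (n k))" for R
  proof -
    obtain k :: nat where k: "R < real k" using reals_Archimedean2 by blast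
    define M where "M = n (Suc k)"
    define g where "g j = complex_of_real (e j) * l M (n j)" for j
    have gn: "norm (g j) \<le> e j * \<kappa> M" "norm (g j) \<le> e j * b (n j)" for j
      using e[of j] \<kappa> b by (auto simp: g_def norm_mult intro!: mult_left_mono)
    have sg: "summable (\<lambda>j. norm (g j))"
      by (rule summable_comparison_test'[OF summable_mult2[OF es, of "\<kappa> M"], of 0]) (use gn in simp)
    have "norm (\<Sum>j<Suc k. g j) \<le> S k"
      unfolding S by (intro order_trans[OF norm_sum] sum_mono gn)
    \<comment> \<open>Subtracting the earlier terms, at most \<open>S k\<close>, and the tail, at
      most 1, still leaves \<open>real (Suc k)\<close>.\<close>
    moreover have "real (Suc k) + S k + 2 \<le> norm (g (Suc k))"
      using big[of k] e[of "Suc k"] by (simp add: g_def norm_mult M_def)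
    moreover have "norm (\<Sum>j. g (j + Suc (Suc k))) \<le> 1"
    proof -
      have s: "summable (\<lambda>j. norm (g (j + Suc (Suc k))))" by (rule summable_ignore_initial_segment[OF sg])
      have geo2: "summable (\<lambda>j. (1/2) * (1/2) ^ j :: real)" by (intro summable_mult geo)
      have "norm (\<Sum>j. g (j + Suc (Suc k))) \<le> (\<Sum>j. norm (g (j + Suc (Suc k))))" by (rule summable_norm[OF s])
      also have "\<dots> \<le> (\<Sum>j. (1/2) * (1/2) ^ j)"
      proof (rule suminf_le[OF _ s geo2])
        fix j
        have "norm (g (j + Suc (Suc k))) \<le> (1/2) ^ (j + Suc (Suc k))"
          using order_trans[OF gn(1) tail[of "Suc k" "j + Suc (Suc k)", folded M_def]] by simp
        also have "\<dots> \<le> (1/2) ^ Suc j" by (rule power_decreasing) auto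
        finally show "norm (g (j + Suc (Suc k))) \<le> (1/2) * (1/2) ^ j" by simp
      qed
      also have "\<dots> = 1" by (subst suminf_mult[OF geo]) (simp add: suminf_geometric)
      finally show ?thesis .
    qed
    moreover have "(\<Sum>j. g j) = (\<Sum>j. g (j + Suc (Suc k))) + (g (Suc k) + (\<Sum>j<Suc k. g j))"
      using suminf_split_initial_segment[OF summable_norm_cancel[OF sg], of "Suc (Suc k)"] by simp
    moreover have "norm (g (Suc k)) \<le> norm (\<Sum>j. g j) + norm (\<Sum>j<Suc k. g j) + norm (\<Sum>j. g (j + Suc (Suc k)))"
    proof -
      have "g (Suc k) = (\<Sum>j. g j) - (\<Sum>j<Suc k. g j) - (\<Sum>j. g (j + Suc (Suc k)))"
        using calculation(4) by (simp add: algebra_simps)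
      moreover have "norm (u - v - w) \<le> norm u + norm v + norm w" for u v w :: complex
        using norm_triangle_ineq4[of "u - v" w] norm_triangle_ineq4[of u v] by linarith
      ultimately show ?thesis by metis
    qed
    ultimately have "real (Suc k) \<le> norm (\<Sum>j. g j)" by linarith
    then show ?thesis using k by (intro exI[of _ M]) (simp add: g_def)
  qed
  then show ?thesis using e es by (intro that[of e n]) (auto intro: less_imp_le)
qed

section \<open>The test functions\<close>

lemma fejer_AE_pos: "AE y in lborel. 0 < fejer (t - y)"
proof (rule AE_I')
  have "{x::real. sin x = 0} = range (\<lambda>i::int. of_int i * pi)"
    by (auto simp: sin_zero_iff_int2)
  then have "countable ((\<lambda>x. t - 2 * x) ` {x::real. sin x = 0})" by simp
  then show "(\<lambda>x. t - 2 * x) ` {x. sin x = 0} \<in> null_sets lborel"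
    by (rule countable_imp_null_set_lborel)
  show "{y \<in> space lborel. \<not> 0 < fejer (t - y)} \<subseteq> (\<lambda>x. t - 2 * x) ` {x. sin x = 0}"
  proof
    fix y assume "y \<in> {y \<in> space lborel. \<not> 0 < fejer (t - y)}"
    then have "fejer (t - y) = 0" using fejer_nonneg[of "t - y"] by simp
    then have "sin ((t - y) / 2) = 0" by (auto simp: fejer_def split: if_splits)
    then show "y \<in> (\<lambda>x. t - 2 * x) ` {x. sin x = 0}"
    proof (intro image_eqI[of _ _ "(t - y) / 2"])
      show "y = t - 2 * ((t - y) / 2)" by (simp add: field_simps)
    qed simp
  qed
qed

text \<open>The kernel has zeros, so the integrand is positive only almost everywhere, which already
  excludes integral 0. Iterating this yields the positivity of \<open>hump_mass\<close>.\<close>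

lemma integral_fejer_mult_pos:
  fixes g :: "real \<Rightarrow> real"
  assumes g: "integrable lborel g" and nn: "\<And>y. 0 \<le> g y" and pos: "AE y in lborel. 0 < g (t - y)"
  shows "0 < (LINT y|lborel. fejer y * g (t - y))"
proof -
  have gr: "integrable lborel (\<lambda>y. g (t - y))"
    using lborel_integrable_real_affine[OF g, of "-1" t] by simp
  have int: "integrable lborel (\<lambda>y. fejer y * g (t - y))"
  proof (rule Bochner_Integration.integrable_bound[OF gr])
    show "(\<lambda>y. fejer y * g (t - y)) \<in> borel_measurable lborel"
      using borel_measurable_integrable[OF gr] by measurable
    show "AE y in lborel. norm (fejer y * g (t - y)) \<le> norm (g (t - y))"
      using fejer_le(1) fejer_nonneg by (intro AE_I2) (simp add: abs_mult mult_left_le_one_le)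
  qed
  have nn': "AE y in lborel. 0 \<le> fejer y * g (t - y)"
    using fejer_nonneg nn by simp
  have "(LINT y|lborel. fejer y * g (t - y)) \<noteq> 0"
  proof
    assume "(LINT y|lborel. fejer y * g (t - y)) = 0"
    then have "AE y in lborel. fejer y * g (t - y) = 0"
      using integral_nonneg_eq_0_iff_AE[OF int nn'] by simp
    moreover have "AE y in lborel. 0 < fejer y"
      using fejer_AE_pos[of 0] by (simp add: fejer_minus)
    ultimately have "AE y in (lborel :: real measure). False"
      using pos by eventually_elim auto
    then show False by (simp add: eventually_False ae_filter_eq_bot_iff)
  qed
  then show ?thesis using integral_nonneg_AE[OF nn'] by simp
qed

text \<open>The value at 0 of the fourfold self-convolution of the window, a common factor of the
  functionals on the bumps.\<close>

definition hump_mass :: real where "hump_mass = Re (LINT t|lborel. of_real (fejer t) * f3 (- t))"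

lemma fejer_mass_pos: "0 < fejer_mass"
proof -
  have "0 < (LINT y|lborel. fejer y * fejer (0 - y))"
    by (rule integral_fejer_mult_pos[OF integrable_fejer fejer_nonneg fejer_AE_pos])
  also have "\<dots> \<le> fejer_mass"
    unfolding fejer_mass_def
  proof (rule integral_mono)
    show "integrable lborel (\<lambda>y. fejer y * fejer (0 - y))"
      by (rule Bochner_Integration.integrable_bound[OF integrable_fejer])
        (use fejer_le fejer_nonneg in \<open>auto simp: abs_mult mult_right_le_one_le\<close>)
  qed (use fejer_le fejer_nonneg integrable_fejer in \<open>auto intro!: mult_right_le_one_le\<close>)
  finally show ?thesis .
qed

lemma hump_mass_pos: "0 < hump_mass" and hump_mass_eq: "(LINT t|lborel. of_real (fejer t) * f3 (- t)) = of_real hump_mass"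
proof -
  define g2 where "g2 t = (LINT y|lborel. fejer y * fejer (t - y))" for t
  define g3 where "g3 t = (LINT y|lborel. fejer y * g2 (t - y))" for t
  have f2: "f2 t = of_real (g2 t)" for t
    by (simp add: f2_def cv_def f1_def g2_def flip: integral_complex_of_real)
  have f3: "f3 t = of_real (g3 t)" for t
    by (simp add: f3_def cv_def f1_def f2 g3_def flip: integral_complex_of_real)
  have f1_int: "integrable lborel f1"
    unfolding f1_def[abs_def] by (intro integrable_of_real integrable_fejer)
  have f2_int: "integrable lborel f2" unfolding f2_def by (rule integrable_cv[OF f1_int f1_int])
  have f3_int: "integrable lborel f3" unfolding f3_def by (rule integrable_cv[OF f1_int f2_int])
  have g2: "0 < g2 t" for t
    unfolding g2_def by (rule integral_fejer_mult_pos[OF integrable_fejer fejer_nonneg fejer_AE_pos])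
  have g2_int: "integrable lborel g2" using integrable_Re[OF f2_int] by (simp add: f2)
  have g3: "0 < g3 t" for t
    unfolding g3_def by (rule integral_fejer_mult_pos[OF g2_int]) (use g2 in \<open>auto intro: less_imp_le\<close>)
  have g3_int: "integrable lborel g3" using integrable_Re[OF f3_int] by (simp add: f3)
  have "0 < (LINT t|lborel. fejer t * g3 (0 - t))"
    by (rule integral_fejer_mult_pos[OF g3_int]) (use g3 in \<open>auto intro: less_imp_le\<close>)
  moreover have "(LINT t|lborel. of_real (fejer t) * f3 (- t)) = of_real (LINT t|lborel. fejer t * g3 (0 - t))"
    by (simp add: f3 flip: integral_complex_of_real)
  ultimately show "0 < hump_mass" "(LINT t|lborel. of_real (fejer t) * f3 (- t)) = of_real hump_mass"
    by (simp_all add: hump_mass_def)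
qed

text \<open>The larger of \<open>2 * j\<close> and \<open>2 * i + 1\<close> is even exactly when
  \<open>i < j\<close>, so its parity tells the side of the diagonal.\<close>

definition freq :: "nat \<Rightarrow> nat \<Rightarrow> real" where "freq j i = lam (2 * j) + lam (2 * i + 1)"

lemma freq_ge: "1 \<le> freq j i"
  using lam_pos[of "2 * j"] lam_pos[of "2 * i + 1"] by (simp add: freq_def)

text \<open>The weight \<open>hilb j i\<close> comes from the operator factor, and
  \<open>1 / N\<close> from the trace class factor, an all-ones matrix up to phases normalised to
  trace norm one.\<close>

definition test_fun :: "nat \<Rightarrow> real \<Rightarrow> complex"
  where "test_fun N s = (\<Sum>i<N. \<Sum>j<N. of_real (hilb j i / N) * cv (ek (freq j i)) (ek (freq j i)) s)"


lemma ek_tendsto_0: "(ek \<nu> \<longlongrightarrow> 0) at_infinity"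
proof (rule Lim_null_comparison)
  show "((\<lambda>t::real. 5 * norm (inverse t)) \<longlongrightarrow> 0) at_infinity"
    by (intro tendsto_mult_right_zero tendsto_norm_zero tendsto_inverse_0)
  have "fejer t \<le> 5 * norm (inverse t)" if "1 \<le> norm t" for t
  proof -
    have "\<bar>t\<bar> * 1 \<le> \<bar>t\<bar> * \<bar>t\<bar>" using that by (intro mult_left_mono) auto
    then have "\<bar>t\<bar> * fejer t \<le> (1 + t\<^sup>2) * fejer t"
      by (intro mult_right_mono fejer_nonneg) (simp add: power2_eq_square)
    then have "\<bar>t\<bar> * fejer t \<le> 5" using fejer_le(2)[of t] by linarith
    moreover have "0 < \<bar>t\<bar>" using that by simp
    ultimately show ?thesis by (simp add: field_simps)
  qed
  then show "\<forall>\<^sub>F t in at_infinity. norm (ek \<nu> t) \<le> 5 * norm (inverse t)"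
    unfolding eventually_at_infinity norm_ek by blast
qed

lemma test_fun_A0: "test_fun N \<in> A0"
proof -
  define c where "c k = hilb (k mod N) (k div N) / N" for k
  define u where "u k = freq (k mod N) (k div N)" for k
  \<comment> \<open>The double sum becomes a series that is zero from \<open>N * N\<close> on, with
    the coefficients placed in the first factor.\<close>
  define f where "f k = (if k < N * N then c k *\<^sub>R Bcontfun (ek (u k)) else 0)" for k
  define h where "h k = ek (u k)" for k
  have bc: "ek \<nu> \<in> bcontfun" for \<nu>
    by (rule bcontfun_normI[OF continuous_on_ek norm_ek_le])
  have app: "apply_bcontfun (f k) = (\<lambda>t. if k < N * N then of_real (c k) * ek (u k) t else 0)" for k
    by (rule ext) (simp add: f_def Bcontfun_inverse[OF bc] scaleR_conv_of_real)
  have C0: "f k \<in> C0" for k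
    unfolding C0_def mem_Collect_eq app using tendsto_mult_right_zero[OF ek_tendsto_0, of "of_real (c k)" "u k"]
    by (cases "k < N * N") simp_all
  have H1: "h k \<in> H1" for k
    unfolding h_def by (rule ek_H1) (simp add: u_def freq_ge)
  have fin: "f k = 0" if "k \<notin> {..<N * N}" for k using that by (simp add: f_def)
  have conv: "conv (f k) (h k) s = (if k < N * N then of_real (c k) * cv (ek (u k)) (ek (u k)) s else 0)" for k s
    unfolding conv_def app h_def cv_def by (simp add: mult.assoc)
  have "(\<Sum>k<N * N. conv (f k) (h k) s) = test_fun N s" for s
    unfolding test_fun_def by (subst sum_div_mod[symmetric]) (simp add: conv c_def u_def)
  moreover have "(\<lambda>k. conv (f k) (h k) s) sums (\<Sum>k<N * N. conv (f k) (h k) s)" for s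
    by (rule sums_finite) (auto simp: conv)
  moreover have "summable (\<lambda>k. norm (f k) * L1_norm (h k))"
    by (rule summable_finite[of "{..<N * N}"]) (auto simp: fin)
  ultimately have "(\<Sum>k. norm (f k) * L1_norm (h k)) \<in> A0_costs (test_fun N)"
    unfolding A0_costs_def using C0 H1 by fastforce
  then show ?thesis by (auto simp: A0_def)
qed

text \<open>The phase of \<open>freq j i\<close> splits into a row and a column phase, which neither
  changes the norm of Hilbert's matrix nor destroys rank one. The index orders are opposite because
  the trace of a product pairs the cell \<open>(i, j)\<close> with \<open>(j, i)\<close>. The scale
  \<open>e\<close> provides the weights of the later series.\<close>

lemma test_fun_trace:
  assumes N: "0 < N" and e: "0 \<le> e"
  shows "\<exists>f h. f \<in> C0_compact \<and> h \<in> H1_trace \<and> norm f \<le> e * pi \<and> L1_trace_norm h = fejer_mass \<and>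
    (\<forall>s. conv_trace f h s = of_real e * test_fun N s)"
proof -
  define m where "m t i j = of_real (e * hilb j i) * ek (freq j i) t" for t i j
  define q where "q t j i = ek (freq j i) t / N" for t j i
  define \<xi> where "\<xi> t j = of_real (fejer t / sqrt N) * cis (lam (2 * j) * t)" for t and j :: nat
  define \<eta> where "\<eta> t i = of_real (1 / sqrt N) * cis (lam (2 * i + 1) * t)" for t and i :: nat
  have ek: "ek (freq j i) t = of_real (fejer t) * (cis (lam (2 * j) * t) * cis (lam (2 * i + 1) * t))" for j i t
    by (simp add: ek_def freq_def cis_mult distrib_right)
  have sN: "complex_of_real (sqrt N) * of_real (sqrt N) = of_nat N"
    unfolding of_real_mult[symmetric] by simp
  have q\<xi>\<eta>: "q t j i = \<xi> t j * \<eta> t i" for t j i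
    using N by (simp add: q_def \<xi>_def \<eta>_def ek sN[symmetric])
  have n\<xi>: "sqrt (\<Sum>a<N. (cmod (\<xi> t a))\<^sup>2) = fejer t" for t
    using N fejer_nonneg[of t] by (simp add: \<xi>_def norm_mult norm_divide power_divide)
  have n\<eta>: "sqrt (\<Sum>b<N. (cmod (\<eta> t b))\<^sup>2) = 1" for t
    using N by (simp add: \<eta>_def norm_mult norm_divide power_divide)
  have qH1: "(\<lambda>t. q t j i) \<in> H1" for j i
  proof -
    have "fourier (\<lambda>t. q t j i) u = fourier (ek (freq j i)) u / N" for u
      by (simp add: fourier_def q_def flip: integral_divide_zero)
    then show ?thesis using ek_H1[OF freq_ge[of j i]] by (simp add: H1_def) (simp add: q_def)
  qed
  have h: "(\<lambda>t. fin_op N (q t)) \<in> H1_trace" "L1_trace_norm (\<lambda>t. fin_op N (q t)) = fejer_mass"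
    using fin_op_H1_trace[of N q \<xi> \<eta>] q\<xi>\<eta> qH1 integrable_fejer
    by (simp_all add: n\<xi> n\<eta> fejer_mass_def)
  have bd: "norm (fin_op N (m t)) \<le> e * pi" for t
  proof (rule norm_fin_op_le_form)
    fix x y :: "nat \<Rightarrow> complex"
    \<comment> \<open>Phases and window are absorbed into the test vectors, whose norms do not
      increase.\<close>
    define x' where "x' j = cis (lam (2 * j) * t) * x j" for j
    define y' where "y' i = of_real (fejer t) * cis (lam (2 * i + 1) * t) * y i" for i
    have "(\<Sum>i<N. \<Sum>j<N. m t i j * x j * y i) = of_real e * (\<Sum>j<N. \<Sum>i<N. hilb j i * y' i * x' j)"
      unfolding sum_distrib_left
      by (subst sum.swap) (intro sum.cong refl, simp add: m_def ek x'_def y'_def mult_ac)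
    then have "cmod (\<Sum>i<N. \<Sum>j<N. m t i j * x j * y i) = e * cmod (\<Sum>j<N. \<Sum>i<N. hilb j i * y' i * x' j)"
      using e by (simp add: norm_mult)
    also have "\<dots> \<le> e * (pi * sqrt (\<Sum>i<N. (cmod (y' i))\<^sup>2) * sqrt (\<Sum>j<N. (cmod (x' j))\<^sup>2))"
      by (intro mult_left_mono hilbert_inequality e)
    also have "\<dots> \<le> e * (pi * sqrt (\<Sum>i<N. (cmod (y i))\<^sup>2) * sqrt (\<Sum>j<N. (cmod (x j))\<^sup>2))"
    proof -
      have "cmod (y' i) \<le> cmod (y i)" for i
        using fejer_le(1)[of t] fejer_nonneg[of t] by (simp add: y'_def norm_mult mult_left_le_one_le)
      then have "sqrt (\<Sum>i<N. (cmod (y' i))\<^sup>2) \<le> sqrt (\<Sum>i<N. (cmod (y i))\<^sup>2)"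
        by (intro real_sqrt_le_mono sum_mono power_mono) auto
      moreover have "cmod (x' j) = cmod (x j)" for j by (simp add: x'_def norm_mult)
      ultimately show ?thesis
        using e by (intro mult_left_mono mult_mono) (auto intro!: sum_nonneg mult_nonneg_nonneg real_sqrt_ge_zero)
    qed
    finally show "cmod (\<Sum>i<N. \<Sum>j<N. m t i j * x j * y i)
        \<le> e * pi * sqrt (\<Sum>j<N. (cmod (x j))\<^sup>2) * sqrt (\<Sum>i<N. (cmod (y i))\<^sup>2)"
      by (simp add: mult_ac)
  qed (use e in simp)
  have cont: "continuous_on UNIV (\<lambda>t. m t i j)" for i j
    unfolding m_def by (intro continuous_intros continuous_on_ek)
  have lim: "((\<lambda>t. m t i j) \<longlongrightarrow> 0) at_infinity" for i j
    unfolding m_def by (intro tendsto_mult_right_zero ek_tendsto_0)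
  note f = op_bcont[of N m, OF cont bd]
  have "conv_trace (op_bcont N m) (\<lambda>t. fin_op N (q t)) s = of_real e * test_fun N s" for s
  proof -
    have int: "integrable lborel (\<lambda>t. m t i j * q (s - t) j i)" for i j
    proof -
      have "integrable lborel (\<lambda>t. of_real (e * hilb j i / N) * (ek (freq j i) t * ek (freq j i) (s - t)))"
        by (intro integrable_mult_right integrable_cv_at[OF integrable_ek _ norm_ek_le]) simp
      then show ?thesis by (simp add: m_def q_def mult_ac)
    qed
    have "conv_trace (op_bcont N m) (\<lambda>t. fin_op N (q t)) s = (\<Sum>i<N. \<Sum>j<N. LINT t|lborel. m t i j * q (s - t) j i)"
      unfolding conv_trace_fin_op[OF f(1)]
      by (simp add: Bochner_Integration.integral_sum Bochner_Integration.integrable_sum int)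
    also have "\<dots> = (\<Sum>i<N. \<Sum>j<N. of_real (e * hilb j i / N) * cv (ek (freq j i)) (ek (freq j i)) s)"
      unfolding cv_def integral_mult_right_zero[symmetric]
      by (intro sum.cong refl Bochner_Integration.integral_cong) (simp add: m_def q_def)
    also have "\<dots> = of_real e * test_fun N s"
      unfolding test_fun_def sum_distrib_left by (simp add: mult_ac)
    finally show ?thesis .
  qed
  then show ?thesis
    using f(2) f(3)[OF lim] h by (intro exI[of _ "op_bcont N m"] exI[of _ "\<lambda>t. fin_op N (q t)"]) blast
qed

section \<open>Bounds and values of the functionals on the test functions\<close>

lemma test_fun_measurable: "test_fun N \<in> borel_measurable borel"
  unfolding test_fun_def[abs_def]
  by (intro borel_measurable_sum borel_measurable_times borel_measurable_const cv_measurable) simp_all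

text \<open>Pointwise this is Hilbert's inequality for two unit vectors made of phases. Uniformity
  in \<open>N\<close> bounds each fixed functional on all test functions at once.\<close>

lemma norm_test_fun_le: "norm (test_fun N s) \<le> pi * fejer_mass"
proof (cases "N = 0")
  case True
  then show ?thesis using fejer_mass_nonneg by (simp add: test_fun_def)
next
  case False
  define x where "x j = cis (lam (2 * j) * s) / sqrt N" for j
  define y where "y i = cis (lam (2 * i + 1) * s) / sqrt N" for i
  have sN: "complex_of_real (sqrt N) * of_real (sqrt N) = of_nat N"
    unfolding of_real_mult[symmetric] by simp
  have fq: "cis (freq j i * s) = cis (lam (2 * j) * s) * cis (lam (2 * i + 1) * s)" for j i
    by (simp add: freq_def cis_mult distrib_right)
  have "test_fun N s = (\<Sum>j<N. \<Sum>i<N. hilb j i * y i * x j) * f2 s"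
    unfolding test_fun_def cv_ek_same sum_distrib_right x_def y_def fq
    by (subst sum.swap, intro sum.cong refl) (simp add: sN[symmetric] mult_ac)
  then have "norm (test_fun N s) = cmod (\<Sum>j<N. \<Sum>i<N. hilb j i * y i * x j) * norm (f2 s)"
    by (simp add: norm_mult)
  also have "\<dots> \<le> pi * fejer_mass"
  proof (rule mult_mono)
    have "sqrt (\<Sum>i<N. (cmod (y i))\<^sup>2) = 1" "sqrt (\<Sum>i<N. (cmod (x i))\<^sup>2) = 1"
      using False by (simp_all add: x_def y_def norm_divide power_divide)
    then show "cmod (\<Sum>j<N. \<Sum>i<N. hilb j i * y i * x j) \<le> pi"
      using hilbert_inequality[where N = N and x = y and y = x] by simp
    have "norm (cv (ek 0) (ek 0) s) \<le> 1 * L1_norm (ek 0)"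
      by (rule norm_cv_le[OF _ norm_ek_le integrable_ek]) simp
    then show "norm (f2 s) \<le> fejer_mass"
      by (simp add: cv_ek_same L1_norm_def norm_ek fejer_mass_def)
  qed auto
  finally show ?thesis .
qed

text \<open>For \<open>i < j\<close> the top index \<open>2 * j\<close> is even and survives;
  otherwise it is \<open>2 * i + 1\<close> and is discarded. The phases of the bump and of its
  reflected image cancel.\<close>

lemma pairing_cv_ek:
  assumes "i < N" "j < N"
  shows "pairing (2 * N) (cv (ek (freq j i)) (ek (freq j i))) = of_real (of_bool (i < j) / 16 * hump_mass)"
proof -
  have K: "cv (mult_kernel (2 * N)) (ek (freq j i)) t = of_bool (i < j) / 16 * (cis (freq j i * t) * f3 t)" for t
  proof (cases "i < j")
    case True
    then show ?thesis
      using assms cv_mult_kernel_ek[of "2 * i + 1" "2 * j" "2 * N" "freq j i" t] by (simp add: freq_def)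
  next
    case False
    then show ?thesis
      using assms cv_mult_kernel_ek[of "2 * j" "2 * i + 1" "2 * N" "freq j i" t] by (simp add: freq_def)
  qed
  have "ek \<nu> t * (of_bool (i < j) / 16 * (cis (\<nu> * - t) * f3 (- t)))
      = of_bool (i < j) / 16 * (of_real (fejer t) * f3 (- t))" for \<nu> t
  proof -
    have "cis (\<nu> * t) * cis (\<nu> * - t) = 1" by (simp add: cis_mult)
    then show ?thesis by (simp add: ek_def)
  qed
  then have "pairing (2 * N) (cv (ek (freq j i)) (ek (freq j i)))
      = (LINT t|lborel. of_bool (i < j) / 16 * (of_real (fejer t) * f3 (- t)))"
    by (subst pairing_cv[OF _ norm_ek_le integrable_ek]) (simp_all only: K ek_measurable)
  also have "\<dots> = of_bool (i < j) / 16 * of_real hump_mass"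
    unfolding integral_mult_right_zero hump_mass_eq ..
  finally show ?thesis by simp
qed

text \<open>Truncation keeps exactly the positive entries of Hilbert's matrix, so nothing cancels
  and row \<open>j\<close> sums to a harmonic number.\<close>

lemma pairing_test_fun: "pairing (2 * N) (test_fun N) = of_real (hump_mass / 16 * ((\<Sum>j<N. harm j) / N))"
proof -
  have int: "integrable lborel (\<lambda>s. cv (ek \<nu>) (ek \<nu>) s * mult_kernel M (- s))" for \<nu> M
    by (rule integrable_pairing[OF cv_measurable norm_cv_le[OF _ norm_ek_le integrable_ek]]) simp_all
  have "pairing (2 * N) (test_fun N) = (LINT s|lborel. (\<Sum>i<N. \<Sum>j<N. of_real (hilb j i / N)
      * (cv (ek (freq j i)) (ek (freq j i)) s * mult_kernel (2 * N) (- s))))"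
    unfolding pairing_def test_fun_def by (simp add: sum_distrib_right mult.assoc)
  also have "\<dots> = (\<Sum>i<N. \<Sum>j<N. of_real (hilb j i / N) * pairing (2 * N) (cv (ek (freq j i)) (ek (freq j i))))"
    unfolding pairing_def integral_mult_right_zero[symmetric]
    by (subst Bochner_Integration.integral_sum, intro Bochner_Integration.integrable_sum integrable_mult_right int,
        intro sum.cong refl, subst Bochner_Integration.integral_sum, intro integrable_mult_right int, rule refl)
  also have "\<dots> = (\<Sum>i<N. \<Sum>j<N. of_real (hilb j i / N) * of_real (of_bool (i < j) / 16 * hump_mass))"
    by (intro sum.cong refl arg_cong2[where f = "(*)"] pairing_cv_ek) auto
  also have "\<dots> = of_real (\<Sum>j<N. \<Sum>i<N. hilb j i / N * (of_bool (i < j) / 16 * hump_mass))"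
    by (subst sum.swap) simp
  also have "(\<Sum>j<N. \<Sum>i<N. hilb j i / N * (of_bool (i < j) / 16 * hump_mass))
      = (\<Sum>j<N. hump_mass / 16 / N * harm j)"
  proof (intro sum.cong refl)
    fix j assume "j \<in> {..<N}"
    then have "(\<Sum>i<N. hilb j i / N * (of_bool (i < j) / 16 * hump_mass))
        = (\<Sum>i<j. hump_mass / 16 / N * inverse (real (Suc (j - Suc i))))"
      by (intro sum.mono_neutral_cong_right) (auto simp: hilb_def field_simps Suc_diff_Suc of_nat_diff)
    also have "\<dots> = hump_mass / 16 / N * (\<Sum>i<j. inverse (real (Suc (j - Suc i))))"
      by (rule sum_distrib_left[symmetric])
    also have "(\<Sum>i<j. inverse (real (Suc (j - Suc i)))) = harm j"
      unfolding harm_altdef by (rule sum.nat_diff_reindex)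
    finally show "(\<Sum>i<N. hilb j i / N * (of_bool (i < j) / 16 * hump_mass)) = hump_mass / 16 / N * harm j" .
  qed
  also have "\<dots> = hump_mass / 16 * ((\<Sum>j<N. harm j) / N)"
    by (simp add: sum_distrib_left sum_divide_distrib)
  finally show ?thesis .
qed

lemma pairing_test_fun_unbounded: "\<exists>N. 0 < N \<and> R \<le> norm (pairing (2 * N) (test_fun N))"
proof -
  \<comment> \<open>32 is 16 from the functional times 2, since only the upper half of the averaged
    range is kept below.\<close>
  obtain n where n: "0 < n" "32 * \<bar>R\<bar> / hump_mass \<le> harm n"
  proof -
    have "eventually (\<lambda>n. 32 * \<bar>R\<bar> / hump_mass \<le> harm n) sequentially"
      using harm_at_top by (simp add: filterlim_at_top)
    then obtain n0 where "\<And>n. n0 \<le> n \<Longrightarrow> 32 * \<bar>R\<bar> / hump_mass \<le> harm n"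
      unfolding eventually_sequentially by blast
    from this[of "Suc n0"] show thesis using that[of "Suc n0"] by simp
  qed
  have "real n * harm n = (\<Sum>j\<in>{n..<2 * n}. harm n)" by simp
  also have "\<dots> \<le> (\<Sum>j\<in>{n..<2 * n}. harm j)" by (intro sum_mono harm_mono) auto
  also have "\<dots> \<le> (\<Sum>j<2 * n. harm j)" by (intro sum_mono2) (auto simp: harm_nonneg)
  finally have "harm n / 2 \<le> (\<Sum>j<2 * n. harm j) / real (2 * n)" using n(1) by (simp add: field_simps)
  then have "hump_mass / 16 * (harm n / 2) \<le> hump_mass / 16 * ((\<Sum>j<2 * n. harm j) / real (2 * n))"
    using hump_mass_pos by (intro mult_left_mono) auto
  moreover have "\<bar>R\<bar> \<le> hump_mass / 16 * (harm n / 2)"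
    using n(2) hump_mass_pos by (simp add: field_simps)
  ultimately have "R \<le> hump_mass / 16 * ((\<Sum>j<2 * n. harm j) / real (2 * n))" by linarith
  also have "\<dots> \<le> norm (pairing (2 * (2 * n)) (test_fun (2 * n)))"
    unfolding pairing_test_fun norm_of_real by (rule abs_ge_self)
  finally show ?thesis using n(1) by (intro exI[of _ "2 * n"]) simp
qed

section \<open>The two algebras differ\<close>

text \<open>Provides the lower bound under which the infimum in \<open>A0_trace_norm\<close> lies
  below every cost.\<close>

lemma A0_trace_costs_nonneg:
  assumes "c \<in> A0_trace_costs F"
  shows "0 \<le> c"
proof -
  obtain f :: "nat \<Rightarrow> real \<Rightarrow>\<^sub>C ell2_op" and h where fh: "\<And>k::nat. h k \<in> H1_trace" "summable (\<lambda>k. norm (f k) * L1_trace_norm (h k))"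
    and c: "c = (\<Sum>k. norm (f k) * L1_trace_norm (h k))"
    using assms unfolding A0_trace_costs_def by blast
  have "0 \<le> L1_trace_norm (h k)" for k
    unfolding L1_trace_norm_def using fh(1)[of k]
    by (intro integral_nonneg_AE) (auto simp: H1_trace_def L1_trace_def intro!: trace_norm_nonneg)
  then show ?thesis unfolding c by (intro suminf_nonneg fh(2)) simp
qed

lemma A0_trace_norm_test_fun_le:
  assumes N: "0 < N"
  shows "A0_trace_norm (test_fun N) \<le> pi * fejer_mass"
proof -
  obtain f h where fh: "f \<in> C0_compact" "h \<in> H1_trace" "norm f \<le> 1 * pi" "L1_trace_norm h = fejer_mass"
    "\<And>s. conv_trace f h s = test_fun N s"
    using test_fun_trace[OF N, of 1] by auto
  \<comment> \<open>Padding with 0 affects the first factor only; \<open>h\<close> is repeated, so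
    membership in \<open>H1_trace\<close> persists while the further costs vanish.\<close>
  define f' where "f' k = (if k = (0::nat) then f else 0)" for k
  have z: "conv_trace 0 h s = 0" for s by (simp add: conv_trace_def trace_op_def)
  have "norm (f' k) * L1_trace_norm h = (if k = 0 then norm f * fejer_mass else 0)" for k
    by (simp add: f'_def fh)
  then have 1: "(\<lambda>k. norm (f' k) * L1_trace_norm h) sums (norm f * fejer_mass)"
    using sums_single[of 0 "\<lambda>_. norm f * fejer_mass"] by simp
  have "conv_trace (f' k) h s = (if k = 0 then test_fun N s else 0)" for k s
    by (simp add: f'_def fh z)
  then have 2: "(\<lambda>k. conv_trace (f' k) h s) sums test_fun N s" for s
    using sums_single[of 0 "\<lambda>_. test_fun N s"] by simp
  have "norm f * fejer_mass \<in> A0_trace_costs (test_fun N)"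
    unfolding A0_trace_costs_def mem_Collect_eq
    by (rule exI[of _ f'], rule exI[of _ "\<lambda>_. h"])
      (use 1 2 fh zero_C0_compact in \<open>auto simp: sums_iff f'_def\<close>)
  then have "A0_trace_norm (test_fun N) \<le> norm f * fejer_mass"
    unfolding A0_trace_norm_def by (intro cInf_lower bdd_belowI[of _ 0] A0_trace_costs_nonneg)
  also have "\<dots> \<le> pi * fejer_mass" using fh(3) fejer_mass_nonneg by (intro mult_right_mono) auto
  finally show ?thesis .
qed

lemma A0_norm_ge: "F \<in> A0 \<Longrightarrow> norm (pairing M F) \<le> 8 * fejer_mass\<^sup>2 * A0_norm F"
proof -
  assume "F \<in> A0"
  have c: "0 < 8 * fejer_mass\<^sup>2" using fejer_mass_pos by simp
  have "norm (pairing M F) / (8 * fejer_mass\<^sup>2) \<le> A0_norm F"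
    unfolding A0_norm_def
  proof (rule cInf_greatest)
    show "A0_costs F \<noteq> {}" using \<open>F \<in> A0\<close> by (simp add: A0_def)
    show "norm (pairing M F) / (8 * fejer_mass\<^sup>2) \<le> x" if "x \<in> A0_costs F" for x
      using norm_pairing_A0_le[OF that, of M] c by (simp only: divide_le_eq) (simp add: mult.commute)
  qed
  then show ?thesis using c by (simp only: divide_le_eq) (simp add: mult.commute)
qed

lemma norms_not_equivalent: "\<not> (\<exists>\<delta>::real>0. \<forall>F\<in>A0. \<delta> * A0_norm F \<le> A0_trace_norm F)"
proof
  assume "\<exists>\<delta>::real>0. \<forall>F\<in>A0. \<delta> * A0_norm F \<le> A0_trace_norm F"
  then obtain \<delta> :: real where \<delta>: "0 < \<delta>" "\<And>F. F \<in> A0 \<Longrightarrow> \<delta> * A0_norm F \<le> A0_trace_norm F" by blast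
  \<comment> \<open>The threshold corresponds to the largest scalar norm that
    \<open>\<delta>\<close> would allow; the added 1 makes the contradiction strict.\<close>
  obtain N where N: "0 < N" "8 * fejer_mass\<^sup>2 * (pi * fejer_mass / \<delta> + 1) \<le> norm (pairing (2 * N) (test_fun N))"
    using pairing_test_fun_unbounded by blast
  have c: "0 < 8 * fejer_mass\<^sup>2" using fejer_mass_pos by simp
  have "8 * fejer_mass\<^sup>2 * (pi * fejer_mass / \<delta> + 1) \<le> 8 * fejer_mass\<^sup>2 * A0_norm (test_fun N)"
    using N(2) A0_norm_ge[OF test_fun_A0] order_trans by blast
  then have "pi * fejer_mass / \<delta> + 1 \<le> A0_norm (test_fun N)" using c by (simp only: mult_le_cancel_left_pos)
  then have "\<delta> * (pi * fejer_mass / \<delta> + 1) \<le> \<delta> * A0_norm (test_fun N)" using \<delta>(1) by (intro mult_left_mono) auto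
  also have "\<dots> \<le> pi * fejer_mass"
    using \<delta>(2)[OF test_fun_A0] A0_trace_norm_test_fun_le[OF N(1)] by (rule order_trans)
  finally show False using \<delta>(1) by (simp add: distrib_left)
qed

text \<open>A summably weighted series of test functions has finite trace class cost, while the hump
  makes the functionals unbounded on its sum. This contradicts \<open>A0_norm_ge\<close>, whose
  constant is the same for all functionals.\<close>

lemma ex_A0_trace_not_A0: "\<exists>F\<in>A0_trace. F \<notin> A0"
proof -
  \<comment> \<open>The shift by \<open>Suc\<close> excludes size 0, to which
    \<open>test_fun_trace\<close> does not apply.\<close>
  define l where "l M i = pairing (2 * Suc M) (test_fun (Suc i))" for M i
  have l1: "norm (l M i) \<le> pi * fejer_mass * kernel_mass (2 * Suc M)" for M i
    unfolding l_def by (rule norm_pairing_le[OF test_fun_measurable norm_test_fun_le])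
  have l2: "norm (l M i) \<le> 8 * fejer_mass\<^sup>2 * A0_norm (test_fun (Suc i))" for M i
    unfolding l_def by (rule A0_norm_ge[OF test_fun_A0])
  have l3: "\<exists>n. R \<le> norm (l n n)" for R
    using pairing_test_fun_unbounded[of R] unfolding l_def by (metis Suc_pred)
  obtain e n where e: "\<And>k. 0 \<le> e k" "summable e"
    and unb: "\<And>R. \<exists>M. R < norm (\<Sum>k. complex_of_real (e k) * l M (n k))"
    by (rule gliding_hump[OF l1 l2 l3]) blast
  define F where "F s = (\<Sum>k. of_real (e k) * test_fun (Suc (n k)) s)" for s
  have bd: "norm (of_real (e k) * test_fun (Suc (n k)) s) \<le> e k * (pi * fejer_mass)" for k s
    using e(1)[of k] by (simp add: norm_mult mult_left_mono norm_test_fun_le)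
  have sume: "summable (\<lambda>k. e k * (pi * fejer_mass))" by (intro summable_mult2 e)
  have F: "(\<lambda>k. of_real (e k) * test_fun (Suc (n k)) s) sums F s" for s
    unfolding F_def by (intro summable_sums summable_comparison_test'[OF sume]) (rule bd)
  have "\<exists>f h. f \<in> C0_compact \<and> h \<in> H1_trace \<and> norm f \<le> e k * pi \<and> L1_trace_norm h = fejer_mass \<and>
    (\<forall>s. conv_trace f h s = of_real (e k) * test_fun (Suc (n k)) s)" for k
    by (rule test_fun_trace[OF _ e(1)]) simp
  then obtain f h where fh: "\<And>k. f k \<in> C0_compact" "\<And>k. h k \<in> H1_trace" "\<And>k. norm (f k) \<le> e k * pi"
    "\<And>k. L1_trace_norm (h k) = fejer_mass" "\<And>k s. conv_trace (f k) (h k) s = of_real (e k) * test_fun (Suc (n k)) s"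
    by metis
  have "summable (\<lambda>k. norm (f k) * L1_trace_norm (h k))"
  proof (rule summable_comparison_test'[OF sume])
    show "norm (norm (f k) * L1_trace_norm (h k)) \<le> e k * (pi * fejer_mass)" for k
      using mult_right_mono[OF fh(3)[of k] fejer_mass_nonneg] fejer_mass_nonneg by (simp add: fh(4) abs_mult)
  qed
  moreover have "(\<lambda>k. conv_trace (f k) (h k) s) sums F s" for s unfolding fh(5) by (rule F)
  ultimately have "(\<Sum>k. norm (f k) * L1_trace_norm (h k)) \<in> A0_trace_costs F"
    unfolding A0_trace_costs_def using fh(1,2) by blast
  then have "F \<in> A0_trace" by (auto simp: A0_trace_def)
  moreover have "F \<notin> A0"
  proof
    assume "F \<in> A0"
    obtain M where M: "8 * fejer_mass\<^sup>2 * A0_norm F < norm (\<Sum>k. complex_of_real (e k) * l M (n k))"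
      using unb by blast
    have "(\<lambda>k. pairing (2 * Suc M) (\<lambda>s. of_real (e k) * test_fun (Suc (n k)) s)) sums pairing (2 * Suc M) F"
      by (rule pairing_sums[OF F _ bd sume]) (intro borel_measurable_times borel_measurable_const test_fun_measurable)
    moreover have "pairing (2 * Suc M) (\<lambda>s. of_real (e k) * test_fun (Suc (n k)) s) = of_real (e k) * l M (n k)" for k
      by (simp only: pairing_def l_def mult.assoc integral_mult_right_zero)
    ultimately have "(\<Sum>k. of_real (e k) * l M (n k)) = pairing (2 * Suc M) F" by (simp add: sums_iff)
    then show False using M A0_norm_ge[OF \<open>F \<in> A0\<close>, of "2 * Suc M"] by simp
  qed
  ultimately show ?thesis by blast
qed

theorem mainTheorem5:
  shows "\<not> (\<exists>\<delta>::real>0. \<forall>F\<in>A0. \<delta> * A0_norm F \<le> A0_trace_norm F) \<and> A0 \<subset> A0_trace"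
  using norms_not_equivalent A0_subset_A0_trace ex_A0_trace_not_A0 by blast

end
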